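(* Let $\epsilon<1/3$ be a positive constant and let $d\ge 2$ be a power of two with $d=O(\log^{\epsilon}n)$. There is a parallel algorithm which, given a sequence $S$ of length $n$ over the alphabet $\Sigma=\{0,\ldots,\sigma-1\}$ with $\sigma\le n$, constructs the $d$-ary (multiary) wavelet tree of $S$ using $O(n\log_d\sigma)$ work and $O(\log n\log_d\sigma)$ depth.
   Context: Model: work-depth model with concurrent reads and writes permitted, with unit-cost operations on machine words of $\Theta(\log n)$ bits. The work is the total number of operations and the depth is the number of parallel time steps. $\log$ is base 2, and, as usual in asymptotic bounds, logarithmic factors (including $\log_d\sigma$) are read as being at least $1$. In the multiary wavelet tree each node has up to $d$ children and stores a sequence of symbols in the range $[0,\ldots,d-1]$, and the height is $O(\log_d\sigma)$. Explicitly: write each symbol with $\lceil\log_d\sigma\rceil$ base-$d$ digits (i.e. blocks of $\log d$ bits), most significant first. The nodes on level $l$ ($l=0$ being the root, $0\le l<\lceil\log_d\sigma\rceil$) correspond to the length-$l$ digit prefixes occurring among the symbols of $S$; the node $v$ for prefix $p$ stores the sequence of $(l+1)$'st digits of the subsequence (in the original order) of the symbols of $S$ with prefix $p$, as a sequence of $\log d$-bit entries. The children of $v$ are the nodes for the prefixes $p$ extended by one digit. Each node also stores a generalized rank/select structure on its sequence $T$, supporting in $O(1)$ work the queries $\mathrm{rank}_c(T,i)$ (the number of symbols less than or equal to $c$ in positions $0$ to $i$ of $T$) and $\mathrm{select}_c(T,i)$ (the position of the $i$'th occurrence of $c$ in $T$). *)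

theory Defs
  imports Complex_Main
begin

section \<open>A work-depth machine with word size \<open>w\<close>\<close>

text \<open>
  A word is a natural number below \<open>2 ^ w\<close>. The machine has a shared memory and finitely
  many scalar registers (those named in the program). A program is a sequence of parallel time
  steps under scalar control: in \<open>Pardo k g a v\<close> the processors \<open>0, \<dots>, k - 1\<close> act
  synchronously, and each processor whose guard \<open>g\<close> is nonzero writes the value of \<open>v\<close> to the
  address given by \<open>a\<close>. \<open>Proc\<close> is the number of the processor (0 in scalar code).
\<close>

datatype binop = Plus | Minus | Times | Divide | Modulo
  | BitAnd | BitOr | BitXor | ShiftL | ShiftR | LessThan | Equal

datatype expr = Const nat | Reg nat | Proc | Load expr | Op binop expr expr

datatype com = Skip | Assign nat expr | Pardo expr expr expr expr
  | Seq com com | If expr com com | While expr com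

type_synonym regs = "nat \<Rightarrow> nat"
type_synonym mem = "nat \<Rightarrow> nat"
type_synonym state = "regs \<times> mem"

text \<open>Addition, subtraction, multiplication and left shift wrap around modulo \<open>2 ^ w\<close>.\<close>

fun word_op :: "nat \<Rightarrow> binop \<Rightarrow> nat \<Rightarrow> nat \<Rightarrow> nat" where
  "word_op w Plus x y = take_bit w (x + y)"
| "word_op w Minus x y = take_bit w (x + 2 ^ w - y)"
| "word_op w Times x y = take_bit w (x * y)"
| "word_op w Divide x y = x div y"
| "word_op w Modulo x y = x mod y"
| "word_op w BitAnd x y = Bit_Operations.and x y"
| "word_op w BitOr x y = Bit_Operations.or x y"
| "word_op w BitXor x y = Bit_Operations.xor x y"
| "word_op w ShiftL x y = take_bit w (push_bit y x)"
| "word_op w ShiftR x y = drop_bit y x"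
| "word_op w LessThan x y = take_bit w (of_bool (x < y))"
| "word_op w Equal x y = take_bit w (of_bool (x = y))"

primrec eval :: "nat \<Rightarrow> nat \<Rightarrow> state \<Rightarrow> expr \<Rightarrow> nat" where
  "eval w i s (Const k) = take_bit w k"
| "eval w i s (Reg x) = fst s x"
| "eval w i s Proc = i"
| "eval w i s (Load e) = snd s (eval w i s e)"
| "eval w i s (Op f e1 e2) = word_op w f (eval w i s e1) (eval w i s e2)"

primrec cost :: "expr \<Rightarrow> nat" where
  "cost (Const k) = 1"
| "cost (Reg x) = 1"
| "cost Proc = 1"
| "cost (Load e) = 1 + cost e"
| "cost (Op f e1 e2) = 1 + cost e1 + cost e2"

text \<open>
  \<open>exec w p s W D s'\<close>: started in \<open>s\<close>, the program \<open>p\<close> terminates in \<open>s'\<close> after \<open>W\<close> operations in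
  \<open>D\<close> parallel time steps. In a \<open>Pardo\<close> all reads precede all writes. Reads may be concurrent;
  concurrent writes to one cell must write the same value, since otherwise no \<open>M'\<close> satisfies the
  premises and the execution is stuck. A program that terminates here therefore behaves
  identically, at the same cost, under the arbitrary and the priority write rule. Processors with
  a false guard are charged too.
\<close>

inductive exec :: "nat \<Rightarrow> com \<Rightarrow> state \<Rightarrow> nat \<Rightarrow> nat \<Rightarrow> state \<Rightarrow> bool" for w where
  Skip: "exec w Skip s 1 1 s"
| Assign: "exec w (Assign x e) (R, M) (cost e + 1) (cost e + 1) (R(x := eval w 0 (R, M) e), M)"
| Pardo:
  "\<lbrakk> A = {i. i < eval w 0 (R, M) k \<and> eval w i (R, M) g \<noteq> 0};
     \<forall>i\<in>A. M' (eval w i (R, M) a) = eval w i (R, M) v;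
     \<forall>x. x \<notin> (\<lambda>i. eval w i (R, M) a) ` A \<longrightarrow> M' x = M x \<rbrakk>
   \<Longrightarrow> exec w (Pardo k g a v) (R, M)
        (cost k + 1 + eval w 0 (R, M) k * (cost g + cost a + cost v + 1))
        (cost k + 1 + (cost g + cost a + cost v + 1))
        (R, M')"
| Seq:
  "\<lbrakk> exec w p s W1 D1 s'; exec w q s' W2 D2 s'' \<rbrakk>
   \<Longrightarrow> exec w (Seq p q) s (W1 + W2) (D1 + D2) s''"
| IfTrue:
  "\<lbrakk> eval w 0 s e \<noteq> 0; exec w p s W D s' \<rbrakk>
   \<Longrightarrow> exec w (If e p q) s (cost e + 1 + W) (cost e + 1 + D) s'"
| IfFalse:
  "\<lbrakk> eval w 0 s e = 0; exec w q s W D s' \<rbrakk>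
   \<Longrightarrow> exec w (If e p q) s (cost e + 1 + W) (cost e + 1 + D) s'"
| WhileTrue:
  "\<lbrakk> eval w 0 s e \<noteq> 0; exec w p s W1 D1 s'; exec w (While e p) s' W2 D2 s'' \<rbrakk>
   \<Longrightarrow> exec w (While e p) s (cost e + 1 + W1 + W2) (cost e + 1 + D1 + D2) s''"
| WhileFalse:
  "eval w 0 s e = 0 \<Longrightarrow> exec w (While e p) s (cost e + 1) (cost e + 1) s"

text \<open>
  Executions are deterministic, so the existence of a terminating execution with some property
  means that the execution terminates and has this property.
\<close>

lemma exec_deterministic:
  assumes "exec w p s W D s'" and "exec w p s W' D' s''"
  shows "W' = W \<and> D' = D \<and> s'' = s'"
  using assms
proof (induction arbitrary: W' D' s'' rule: exec.induct)
  case (Skip s)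
  then show ?case by (cases rule: exec.cases) auto
next
  case (Assign x e R M)
  then show ?case by (cases rule: exec.cases) auto
next
  case (Pardo A R M k g M' a v)
  from Pardo.prems obtain M'' where s'': "s'' = (R, M'')"
    and W: "W' = cost k + 1 + eval w 0 (R, M) k * (cost g + cost a + cost v + 1)"
    and D: "D' = cost k + 1 + (cost g + cost a + cost v + 1)"
    and 1: "\<forall>i\<in>A. M'' (eval w i (R, M) a) = eval w i (R, M) v"
    and 2: "\<forall>x. x \<notin> (\<lambda>i. eval w i (R, M) a) ` A \<longrightarrow> M'' x = M x"
    unfolding Pardo.hyps(1) by (cases rule: exec.cases) auto
  have "M'' x = M' x" for x
    using 1 2 Pardo.hyps(2,3) by (cases "x \<in> (\<lambda>i. eval w i (R, M) a) ` A") auto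
  then show ?case using s'' W D by auto
next
  case (Seq p s W1 D1 s' q W2 D2 s3)
  from Seq.prems show ?case by (cases rule: exec.cases) (use Seq.IH in blast)
next
  case (IfTrue s e p W D s' q)
  from IfTrue.prems show ?case
    by (cases rule: exec.cases) (use IfTrue.IH IfTrue.hyps in blast)+
next
  case (IfFalse s e q W D s' p)
  from IfFalse.prems show ?case
    by (cases rule: exec.cases) (use IfFalse.IH IfFalse.hyps in blast)+
next
  case (WhileTrue s e p W1 D1 s' W2 D2 s3)
  from WhileTrue.prems show ?case
    by (cases rule: exec.cases) (use WhileTrue.IH WhileTrue.hyps in blast)+
next
  case (WhileFalse s e p)
  from WhileFalse.prems show ?case
    by (cases rule: exec.cases) (use WhileFalse.hyps in auto)
qed

definition init_regs :: "nat list \<Rightarrow> regs" where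
  "init_regs xs = (\<lambda>j. if j < length xs then xs ! j else 0)"


section \<open>Logarithmic factors\<close>

definition lg :: "nat \<Rightarrow> nat \<Rightarrow> real" where
  "lg b x = max 1 (log (real b) (real x))"

text \<open>Word size for inputs of length \<open>n\<close>, with constant factor \<open>c\<close>.\<close>

definition word_size :: "nat \<Rightarrow> nat \<Rightarrow> nat" where
  "word_size c n = c * nat \<lceil>lg 2 n\<rceil>"


section \<open>Multiary wavelet trees\<close>

text \<open>There is no rounding up to 1 here: for \<open>\<sigma> = 1\<close> symbols have no digits, and the tree no nodes.\<close>

definition num_levels :: "nat \<Rightarrow> nat \<Rightarrow> nat" where
  "num_levels d \<sigma> = nat \<lceil>log (real d) (real \<sigma>)\<rceil>"

definition digits :: "nat \<Rightarrow> nat \<Rightarrow> nat \<Rightarrow> nat list" where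
  "digits d L s = map (\<lambda>l. s div d ^ (L - 1 - l) mod d) [0..<L]"

text \<open>A node is identified with its digit prefix.\<close>

definition nodes :: "nat \<Rightarrow> nat \<Rightarrow> nat list \<Rightarrow> nat list set" where
  "nodes d \<sigma> S = {take l (digits d (num_levels d \<sigma>) s) | l s. l < num_levels d \<sigma> \<and> s \<in> set S}"

definition node_seq :: "nat \<Rightarrow> nat \<Rightarrow> nat list \<Rightarrow> nat list \<Rightarrow> nat list" where
  "node_seq d \<sigma> S p =
     [digits d (num_levels d \<sigma>) s ! length p.
        s \<leftarrow> S, take (length p) (digits d (num_levels d \<sigma>) s) = p]"

text \<open>Positions are counted from 0, occurrences from 1.\<close>

definition gen_rank :: "nat \<Rightarrow> nat list \<Rightarrow> nat \<Rightarrow> nat" where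
  "gen_rank c T i = card {j. j \<le> i \<and> j < length T \<and> T ! j \<le> c}"

definition gen_select :: "nat \<Rightarrow> nat list \<Rightarrow> nat \<Rightarrow> nat" where
  "gen_select c T i = filter (\<lambda>j. T ! j = c) [0..<length T] ! (i - 1)"


section \<open>Representation in memory\<close>

text \<open>\<open>T\<close> is stored from address \<open>a\<close> on as \<open>b\<close>-bit entries, \<open>w div b\<close> entries to a word.\<close>

definition packed :: "nat \<Rightarrow> nat \<Rightarrow> mem \<Rightarrow> nat \<Rightarrow> nat list \<Rightarrow> bool" where
  "packed w b M a T \<longleftrightarrow>
     (\<forall>i < length T. T ! i = take_bit b (drop_bit (b * (i mod (w div b))) (M (a + i div (w div b)))))"

text \<open>The query program \<open>Q\<close> answers \<open>out\<close> on \<open>args\<close> within work \<open>q\<close>, and leaves the memory as it was.\<close>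

definition answers :: "nat \<Rightarrow> nat \<Rightarrow> com \<Rightarrow> mem \<Rightarrow> nat list \<Rightarrow> nat \<Rightarrow> bool" where
  "answers w q Q M args out \<longleftrightarrow>
     (\<exists>W D R. exec w Q (init_regs args, M) W D (R, M) \<and> W \<le> q \<and> R 0 = out)"

text \<open>
  The data at address \<open>v\<close> support generalized rank and select on \<open>T\<close>, a sequence over \<open>{0..<d}\<close>,
  by means of the query programs \<open>Qr\<close> and \<open>Qs\<close>.
\<close>

definition supports_rank_select ::
    "nat \<Rightarrow> nat \<Rightarrow> com \<Rightarrow> com \<Rightarrow> nat \<Rightarrow> mem \<Rightarrow> nat \<Rightarrow> nat list \<Rightarrow> bool" where
  "supports_rank_select w q Qr Qs d M v T \<longleftrightarrow>
     (\<forall>c < d. \<forall>i < length T. answers w q Qr M [v, c, i] (gen_rank c T i)) \<and>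
     (\<forall>c < d. \<forall>i \<in> {1..count_list T c}. answers w q Qs M [v, c, i] (gen_select c T i))"

text \<open>
  The record of a node at address \<open>v\<close> starts with the length of its sequence, the address of its
  packed sequence and the address of the array of its \<open>d\<close> child pointers; it may have further
  fields for the rank/select structure. The null pointer is 0, and \<open>loc\<close> gives the addresses of
  the records.
\<close>

definition represents_wavelet_tree ::
    "nat \<Rightarrow> nat \<Rightarrow> com \<Rightarrow> com \<Rightarrow> nat \<Rightarrow> nat \<Rightarrow> nat \<Rightarrow> nat list \<Rightarrow> mem \<Rightarrow> nat \<Rightarrow> bool" where
  "represents_wavelet_tree w q Qr Qs b d \<sigma> S M r \<longleftrightarrow>
     (\<exists>loc :: nat list \<Rightarrow> nat.
        inj_on loc (nodes d \<sigma> S) \<and> 0 \<notin> loc ` nodes d \<sigma> S \<and>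
        r = (if [] \<in> nodes d \<sigma> S then loc [] else 0) \<and>
        (\<forall>p \<in> nodes d \<sigma> S.
           M (loc p) = length (node_seq d \<sigma> S p) \<and>
           packed w b M (M (loc p + 1)) (node_seq d \<sigma> S p) \<and>
           (\<forall>j < d. M (M (loc p + 2) + j) =
              (if p @ [j] \<in> nodes d \<sigma> S then loc (p @ [j]) else 0)) \<and>
           supports_rank_select w q Qr Qs d M (loc p) (node_seq d \<sigma> S p)))"

end

(*
  Every level is built from parallel prefix sums modulo 2^w. Let T be the sequence of digits of a
  level, the nodes one after the other. An element with digit a contributes the word
  sum_{a <= c < d} (2d)^c, which has a 1 in each of the fields a, ..., d - 1. A difference of two
  prefix sums of these words inside a block of d positions is exact, because a field counts at
  most d elements and d fields fit in a word; its fields count the elements <= c of the block.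
  A second prefix sum, over the block counts in lane-major order, gives the counts of the whole
  blocks. So #{j < i. T!j <= c} takes O(1) operations for all c and i. This answers rank queries,
  and it yields the position of every element in the next level. The inverse of this permutation,
  stored as a table, answers select queries, and a third prefix sum packs the digits into words.
  A level has O(n) words, so no o(n)-bit structure is needed within the bound on the work.
*)
theory Submission
  imports Defs
begin

section \<open>Executions with cost bounds\<close>

text \<open>Everything hinges on \<open>d * (b + 1) < w\<close>. A field needs \<open>b + 1\<close>
  bits because a block of \<open>d = 2 ^ b\<close> elements can raise a count to \<open>d\<close>
  itself; as \<open>b + 1 \<le> d\<close>, it suffices that \<open>d * d\<close> stays below the
  word size. This follows from \<epsilon> < 1/3, since \<open>2 * \<epsilon> < 1\<close> gives
  \<open>d * d = O(log n)\<close>, with the constant factor \<open>c\<close> of the word size large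
  enough for \<open>C\<close>. A level is indexed by all prefixes below \<open>d ^ l\<close>,
  whether they occur or not. This makes every address computable from a symbol by division, and it
  is cheap because \<open>d ^ l < \<sigma> \<le> n\<close> for \<open>l < L\<close>. Only
  \<open>d ^ L\<close> can exceed \<open>n\<close>, so on the last level all nodes share one array
  of \<open>d\<close> null pointers. The array size \<open>Z\<close> is a power of two, so that
  prefix sum trees are complete, and it is still \<open>O(n)\<close>. Array cells that no phase
  fills have arbitrary contents; they do no harm, because only such differences of prefix sums are
  used as involve none of these cells.\<close>

definition runs :: "nat \<Rightarrow> nat \<Rightarrow> nat \<Rightarrow> com \<Rightarrow> state \<Rightarrow> nat \<Rightarrow> state \<Rightarrow> bool" where
  "runs w Z T p s k s' \<longleftrightarrow> (\<exists>W D. exec w p s W D s' \<and> W \<le> k * Z \<and> D \<le> k * T)"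

text \<open>A unit is \<open>Z\<close> operations and \<open>T\<close> time steps, and
  \<open>k\<close> counts units. As both bounds share the factor \<open>k\<close>, sequential
  composition just adds numerals, and the cost of a phase is settled by arithmetic on constants. For
  a level, \<open>Z\<close> is the array size \<open>2 ^ H\<close> and \<open>T\<close> is
  \<open>H + 1\<close>.\<close>

lemma runs_Seq:
  "runs w Z T p s k s' \<Longrightarrow> runs w Z T q s' l s'' \<Longrightarrow> runs w Z T (Seq p q) s (k + l) s''"
  unfolding runs_def by (fastforce intro: exec.Seq simp: add_mult_distrib)

lemma runs_mono: "runs w Z T p s k s' \<Longrightarrow> k \<le> l \<Longrightarrow> runs w Z T p s l s'"
  unfolding runs_def by (meson le_trans mult_le_mono1)

lemma runs_Assign:
  assumes "Z \<ge> 1" "T \<ge> 1" "eval w 0 (R, M) e = v" "cost e < k"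
  shows "runs w Z T (Assign x e) (R, M) k (R(x := v), M)"
proof -
  have "k * 1 \<le> k * Z" "k * 1 \<le> k * T" using assms by (intro mult_le_mono; simp)+
  then show ?thesis
    unfolding runs_def using exec.Assign[of w x e R M] assms
    by (metis Suc_eq_plus1 Suc_leI le_trans mult.right_neutral)
qed

lemma runs_If:
  assumes "runs w Z T (if eval w 0 s e \<noteq> 0 then p else q) s k s'" "Z \<ge> 1" "T \<ge> 1" "cost e + 1 + k \<le> l"
  shows "runs w Z T (If e p q) s l s'"
proof -
  obtain W D where *: "exec w (if eval w 0 s e \<noteq> 0 then p else q) s W D s'" "W \<le> k * Z" "D \<le> k * T"
    using assms(1) unfolding runs_def by blast
  have "exec w (If e p q) s (cost e + 1 + W) (cost e + 1 + D) s'"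
    using *(1) by (cases "eval w 0 s e = 0") (simp_all add: exec.IfTrue exec.IfFalse del: add_Suc_right One_nat_def)
  moreover have "(cost e + 1) * 1 + k * Z \<le> (cost e + 1) * Z + k * Z" "(cost e + 1) * 1 + k * T \<le> (cost e + 1) * T + k * T"
    using assms(2,3) by (intro add_right_mono mult_le_mono2; simp)+
  moreover have "(cost e + 1 + k) * Z \<le> l * Z" "(cost e + 1 + k) * T \<le> l * T"
    using assms(4) by (rule mult_le_mono1)+
  ultimately show ?thesis
    unfolding runs_def using *(2,3)
    by (intro exI[of _ "cost e + 1 + W"] exI[of _ "cost e + 1 + D"]) (auto simp: add_mult_distrib)
qed

text \<open>The premise on equal addresses is the consistency of concurrent writes without which
  \<open>exec\<close> is stuck. The two conclusions on \<open>M'\<close> are all that later proofs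
  know of a parallel step: the written values and the frame.\<close>

lemma runs_Pardo:
  assumes "Z \<ge> 1" "T \<ge> 1" "eval w 0 (R, M) k \<le> Z"
    and "\<And>i j. \<lbrakk> i < eval w 0 (R, M) k; j < eval w 0 (R, M) k; eval w i (R, M) g \<noteq> 0; eval w j (R, M) g \<noteq> 0;
      eval w i (R, M) a = eval w j (R, M) a \<rbrakk> \<Longrightarrow> eval w i (R, M) v = eval w j (R, M) v"
  obtains M' where "runs w Z T (Pardo k g a v) (R, M) (cost k + cost g + cost a + cost v + 2) (R, M')"
    and "\<And>i. i < eval w 0 (R, M) k \<Longrightarrow> eval w i (R, M) g \<noteq> 0 \<Longrightarrow> M' (eval w i (R, M) a) = eval w i (R, M) v"
    and "\<And>x. (\<And>i. i < eval w 0 (R, M) k \<Longrightarrow> eval w i (R, M) g \<noteq> 0 \<Longrightarrow> x \<noteq> eval w i (R, M) a) \<Longrightarrow> M' x = M x"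
proof -
  let ?A = "{i. i < eval w 0 (R, M) k \<and> eval w i (R, M) g \<noteq> 0}"
  \<comment> \<open>Which writer of \<open>x\<close> is picked does not matter, since all of them
    agree on the value.\<close>
  define M' where "M' x = (if x \<in> (\<lambda>i. eval w i (R, M) a) ` ?A
    then eval w (SOME i. i \<in> ?A \<and> eval w i (R, M) a = x) (R, M) v else M x)" for x
  have *: "M' (eval w i (R, M) a) = eval w i (R, M) v" if "i \<in> ?A" for i
  proof -
    let ?i = "SOME j. j \<in> ?A \<and> eval w j (R, M) a = eval w i (R, M) a"
    have "?i \<in> ?A \<and> eval w ?i (R, M) a = eval w i (R, M) a"
      by (rule someI_ex) (use that in blast)
    then show ?thesis using that assms(4)[of ?i i] by (auto simp: M'_def)
  qed
  have ex: "exec w (Pardo k g a v) (R, M)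
      (cost k + 1 + eval w 0 (R, M) k * (cost g + cost a + cost v + 1))
      (cost k + 1 + (cost g + cost a + cost v + 1)) (R, M')"
    by (rule exec.Pardo[OF refl]) (use * in \<open>auto simp: M'_def\<close>)
  have "cost k + 1 + eval w 0 (R, M) k * (cost g + cost a + cost v + 1)
      \<le> (cost k + 1) * Z + Z * (cost g + cost a + cost v + 1)"
    using assms(1,3) mult_le_mono2[OF assms(1), of "cost k + 1"] by (intro add_mono mult_le_mono) auto
  also have "\<dots> = (cost k + cost g + cost a + cost v + 2) * Z" by (simp add: algebra_simps)
  finally have W: "cost k + 1 + eval w 0 (R, M) k * (cost g + cost a + cost v + 1)
      \<le> (cost k + cost g + cost a + cost v + 2) * Z" .
  have D: "cost k + 1 + (cost g + cost a + cost v + 1) \<le> (cost k + cost g + cost a + cost v + 2) * T"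
  proof -
    have "(cost k + cost g + cost a + cost v + 2) * 1 \<le> (cost k + cost g + cost a + cost v + 2) * T"
      using assms(2) by (intro mult_le_mono) auto
    then show ?thesis by simp
  qed
  show thesis
  proof (rule that)
    show "runs w Z T (Pardo k g a v) (R, M) (cost k + cost g + cost a + cost v + 2) (R, M')"
      unfolding runs_def using ex W D by blast
    show "M' (eval w i (R, M) a) = eval w i (R, M) v"
      if "i < eval w 0 (R, M) k" "eval w i (R, M) g \<noteq> 0" for i
      using * that by blast
    show "M' x = M x" if "\<And>i. i < eval w 0 (R, M) k \<Longrightarrow> eval w i (R, M) g \<noteq> 0 \<Longrightarrow> x \<noteq> eval w i (R, M) a" for x
      using that by (auto simp: M'_def)
  qed
qed

text \<open>With a guard that is always true and processor \<open>i\<close> writing to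
  \<open>B + i\<close> the addresses are distinct, so no consistency condition remains and the frame
  is the complement of an interval.\<close>

lemma runs_Pardo_array:
  assumes "Z \<ge> 1" "T \<ge> 1" "eval w 0 (R, M) k = K" "K \<le> Z"
    and "\<And>i. i < K \<Longrightarrow> eval w i (R, M) a = B + i" and "w > 0"
  obtains M' where "runs w Z T (Pardo k (Const 1) a v) (R, M) (cost k + cost a + cost v + 3) (R, M')"
    and "\<And>i. i < K \<Longrightarrow> M' (B + i) = eval w i (R, M) v"
    and "\<And>x. x < B \<or> B + K \<le> x \<Longrightarrow> M' x = M x"
proof -
  have 1: "eval w i (R, M) (Const 1) \<noteq> 0" for i using assms(6) by (simp add: take_bit_nat_eq_self)
  obtain M' where M': "runs w Z T (Pardo k (Const 1) a v) (R, M) (cost k + cost (Const 1) + cost a + cost v + 2) (R, M')"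
    "\<And>i. i < K \<Longrightarrow> M' (eval w i (R, M) a) = eval w i (R, M) v"
    "\<And>x. (\<And>i. i < K \<Longrightarrow> x \<noteq> eval w i (R, M) a) \<Longrightarrow> M' x = M x"
    by (rule runs_Pardo[of Z T w R M k "Const 1" a v]) (use assms 1 in auto)
  show thesis
    by (rule that[of M']) (use M' assms(5) in \<open>auto simp: add_ac numeral_3_eq_3 numeral_2_eq_2 intro!: M'(3)\<close>)
qed


section \<open>Evaluation without overflow\<close>

abbreviation plus_expr (infixl \<open>\<oplus>\<close> 65) where "a \<oplus> b \<equiv> Op Plus a b"
abbreviation minus_expr (infixl \<open>\<ominus>\<close> 65) where "a \<ominus> b \<equiv> Op Minus a b"
abbreviation times_expr (infixl \<open>\<otimes>\<close> 70) where "a \<otimes> b \<equiv> Op Times a b"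
abbreviation div_expr (infixl \<open>\<oslash>\<close> 70) where "a \<oslash> b \<equiv> Op Divide a b"
abbreviation mod_expr (infixl \<open>\<odot>\<close> 70) where "a \<odot> b \<equiv> Op Modulo a b"
abbreviation less_expr (infix \<open>\<lhd>\<close> 50) where "a \<lhd> b \<equiv> Op LessThan a b"
abbreviation seq_com (infixr \<open>;;\<close> 60) where "p ;; q \<equiv> Seq p q"

lemma word_Plus: "x + y < 2 ^ w \<Longrightarrow> word_op w Plus x y = x + y"
  by (simp add: take_bit_nat_eq_self)

lemma word_Times: "x * y < 2 ^ w \<Longrightarrow> word_op w Times x y = x * y"
  by (simp add: take_bit_nat_eq_self)

lemma word_Minus: "y \<le> x \<Longrightarrow> x < 2 ^ w \<Longrightarrow> word_op w Minus x y = x - y"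
proof -
  assume a: "y \<le> x" "x < 2 ^ w"
  have "x + 2 ^ w - y = (x - y) + 2 ^ w" using a by simp
  then have "take_bit w (x + 2 ^ w - y) = take_bit w (x - y)"
    by (simp only: take_bit_eq_mod mod_add_self2)
  then show ?thesis using a by (simp add: take_bit_nat_eq_self)
qed

lemma word_ShiftL: "x * 2 ^ y < 2 ^ w \<Longrightarrow> word_op w ShiftL x y = x * 2 ^ y"
  by (simp add: take_bit_nat_eq_self push_bit_eq_mult)

lemma word_ShiftR: "word_op w ShiftR x y = x div 2 ^ y"
  by (simp add: drop_bit_eq_div)

lemma word_LessThan: "w > 0 \<Longrightarrow> word_op w LessThan x y = of_bool (x < y)"
  by (simp add: take_bit_nat_eq_self)

lemma word_Equal: "w > 0 \<Longrightarrow> word_op w Equal x y = of_bool (x = y)"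
  by (simp add: take_bit_nat_eq_self)

text \<open>Reduction modulo \<open>2 ^ w\<close> is compatible with sums, so wrapped prefix sums
  still have the right wrapped difference. Hence nothing is required of the total; only the sum over
  the interval of interest has to fit in a word.\<close>

lemma word_Minus_sums:
  fixes g :: "nat \<Rightarrow> nat"
  assumes "a \<le> b"
  shows "word_op w Minus (take_bit w (\<Sum>i<b. g i)) (take_bit w (\<Sum>i<a. g i)) = take_bit w (\<Sum>i=a..<b. g i)"
proof -
  let ?x = "\<Sum>i<a. g i" and ?y = "\<Sum>i=a..<b. g i"
  have s: "(\<Sum>i<b. g i) = ?x + ?y"
    using sum.atLeastLessThan_concat[of 0 a b g] assms by (simp add: atLeast0LessThan)
  \<comment> \<open>The summand \<open>m\<close> mirrors the \<open>2 ^ w\<close> that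
    \<open>Minus\<close> adds before subtracting. It prevents truncation on the natural numbers, so
    the computation can be moved to the integers.\<close>
  have aux: "((u + v) mod m + m - u mod m) mod m = v mod m" for u v m :: int
  proof -
    have "((u + v) mod m + m - u mod m) mod m = ((u + v) mod m - u mod m + m) mod m"
      by (simp add: algebra_simps)
    also have "\<dots> = v mod m" by (simp add: mod_diff_eq)
    finally show ?thesis .
  qed
  have le: "take_bit w ?x \<le> (2::nat) ^ w" by (rule less_imp_le[OF take_bit_nat_less_exp])
  have "int (take_bit w (\<Sum>i<b. g i) + 2 ^ w - take_bit w ?x) = int ((?x + ?y) mod 2 ^ w) + 2 ^ w - int (?x mod 2 ^ w)"
    using le by (simp add: s take_bit_eq_mod of_nat_diff trans_le_add2)
  also have "\<dots> mod 2 ^ w = int ?y mod 2 ^ w"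
    using aux[of "int ?x" "int ?y" "2 ^ w"] by (simp only: of_nat_mod of_nat_add of_nat_power of_nat_numeral)
  finally have "(take_bit w (\<Sum>i<b. g i) + 2 ^ w - take_bit w ?x) mod 2 ^ w = ?y mod 2 ^ w"
    by (metis (mono_tags) of_nat_eq_iff of_nat_mod of_nat_numeral of_nat_power)
  then show ?thesis by (simp add: take_bit_eq_mod)
qed

lemma eval_Const: "k < 2 ^ w \<Longrightarrow> eval w i s (Const k) = k"
  by (simp add: take_bit_nat_eq_self)

lemma eval_Const_01 [simp]:
  "eval w i s (Const 0) = 0" "w > 0 \<Longrightarrow> eval w i s (Const 1) = 1" "w > 0 \<Longrightarrow> eval w i s (Const (Suc 0)) = 1"
  by (simp_all add: take_bit_nat_eq_self)

lemma word_Divide: "word_op w Divide x y = x div y"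
  by simp

lemma word_Modulo: "word_op w Modulo x y = x mod y"
  by simp

declare word_op.simps [simp del] eval.simps(1) [simp del]
declare word_Divide [simp] word_Modulo [simp]

section \<open>Parallel prefix sums\<close>

text \<open>The tree is stored as a heap: node \<open>k\<close> of depth \<open>t\<close> is at
  \<open>a + 2 ^ t + k\<close>, so the children of the node at offset \<open>m\<close> are at
  offsets \<open>2 * m\<close> and \<open>2 * m + 1\<close>. Register 16 holds \<open>a\<close>,
  register 6 the number of leaves, and register 15 the width \<open>2 ^ t\<close> of the current
  depth.\<close>

definition up_sweep :: com where
  "up_sweep = While (Const 1 \<lhd> Reg 15)
     (Assign 15 (Reg 15 \<oslash> Const 2) ;;
      Pardo (Reg 15) (Const 1) (Reg 16 \<oplus> (Reg 15 \<oplus> Proc))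
       (Load (Reg 16 \<oplus> Const 2 \<otimes> (Reg 15 \<oplus> Proc)) \<oplus>
        Load (Reg 16 \<oplus> (Const 2 \<otimes> (Reg 15 \<oplus> Proc) \<oplus> Const 1))))"

text \<open>A left child inherits the prefix sum of its parent; a right child adds the block sum of
  its left sibling. Both siblings are overwritten in the same step, which is sound because all reads
  precede the writes. The factor \<open>Proc \<odot> Const 2\<close> replaces a branch.\<close>

definition down_sweep :: com where
  "down_sweep = While (Reg 15 \<lhd> Reg 6)
     (Pardo (Const 2 \<otimes> Reg 15) (Const 1) (Reg 16 \<oplus> (Const 2 \<otimes> Reg 15 \<oplus> Proc))
       (Load (Reg 16 \<oplus> (Reg 15 \<oplus> Proc \<oslash> Const 2)) \<oplus>
        Proc \<odot> Const 2 \<otimes> Load (Reg 16 \<oplus> (Const 2 \<otimes> Reg 15 \<oplus> Proc \<ominus> Const 1))) ;;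
      Assign 15 (Const 2 \<otimes> Reg 15))"

text \<open>The sums are exclusive, since the root starts from 0, and they replace the leaves. The
  inner nodes lie within the \<open>2 ^ H\<close> cells before the leaves, so every scanned array
  needs a scratch array in front of it.\<close>

definition scan :: com where
  "scan = Assign 15 (Reg 6) ;; up_sweep ;;
     Pardo (Const 1) (Const 1) (Reg 16 \<oplus> Const 1) (Const 0) ;; down_sweep"

definition block_sum :: "(nat \<Rightarrow> nat) \<Rightarrow> nat \<Rightarrow> nat \<Rightarrow> nat" where
  "block_sum g s k = (\<Sum>j = k * 2 ^ s..<Suc k * 2 ^ s. g j)"

lemma block_sum_Suc: "block_sum g (Suc s) k = block_sum g s (2 * k) + block_sum g s (2 * k + 1)"
proof -
  have "k * 2 ^ Suc s = 2 * k * 2 ^ s" "Suc (2 * k) * 2 ^ s = (2 * k + 1) * 2 ^ s"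
    "Suc k * 2 ^ Suc s = Suc (2 * k + 1) * 2 ^ s" by (simp_all add: algebra_simps)
  then show ?thesis unfolding block_sum_def
    by (metis (no_types, lifting) sum.atLeastLessThan_concat mult_le_mono1 le_add1 lessI less_imp_le_nat Suc_eq_plus1)
qed

lemma prefix_block_sum: "(\<Sum>j<Suc k * 2 ^ s. g j) = (\<Sum>j<k * 2 ^ s. g j) + block_sum g s k"
  unfolding block_sum_def
  by (metis atLeast0LessThan sum.atLeastLessThan_concat mult_le_mono1 lessI less_imp_le_nat zero_le)

text \<open>Both sides are reduced, because a leaf may hold any number while an inner node holds a
  sum that may have wrapped around.\<close>

definition tree_sums :: "nat \<Rightarrow> nat \<Rightarrow> nat \<Rightarrow> (nat \<Rightarrow> nat) \<Rightarrow> nat \<Rightarrow> mem \<Rightarrow> bool" where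
  "tree_sums w a H g h M \<longleftrightarrow> (\<forall>t. h \<le> t \<and> t \<le> H \<longrightarrow>
     (\<forall>k<2 ^ t. take_bit w (M (a + 2 ^ t + k)) = take_bit w (block_sum g (H - t) k)))"

lemma take_bit_add_cong:
  fixes x y :: nat
  assumes "take_bit w x = take_bit w x'" "take_bit w y = take_bit w y'"
  shows "take_bit w (x + y) = take_bit w (x' + y')"
  using assms by (metis take_bit_add)

text \<open>The number of processors halves with each round, so the work is a geometric sum and
  stays linear in \<open>2 ^ h\<close>. One fixed unit for all rounds would lose this, which is why
  the bounds are stated for \<open>exec\<close>.\<close>

lemma up_sweep_exec:
  assumes "w > 1" "a + 4 * 2 ^ H < 2 ^ w" "h \<le> H" "R 15 = 2 ^ h" "R 16 = a"
    "tree_sums w a H g h M"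
  shows "\<exists>W D M'. exec w up_sweep (R, M) W D (R(15 := 1), M') \<and> W \<le> 50 * 2 ^ h \<and> D \<le> 50 * (h + 1)
     \<and> tree_sums w a H g 0 M' \<and> (\<forall>x. x < a \<or> a + 2 * 2 ^ H \<le> x \<longrightarrow> M' x = M x)"
  using assms(3-)
proof (induction h arbitrary: R M)
  case 0
  have "eval w 0 (R, M) (Const 1 \<lhd> Reg 15) = 0"
    using 0 assms(1) by (simp add: word_LessThan eval_Const)
  from exec.WhileFalse[OF this] show ?case
    using 0 unfolding up_sweep_def by (intro exI[of _ M] exI conjI) (auto simp: fun_upd_idem)
next
  case (Suc h)
  have w1: "(2::nat) ^ 1 < 2 ^ w" using assms(1) by (intro power_strict_increasing) auto
  then have w2: "(2::nat) < 2 ^ w" "(1::nat) < 2 ^ w" "w > 0" "2 \<le> w" using assms(1) by simp_all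
  let ?R = "R(15 := 2 ^ h)"
  have pw: "(2::nat) ^ Suc h \<le> 2 ^ H" using Suc.prems(1) by (intro power_increasing) auto
  have e0: "eval w 0 (R, M) (Const 1 \<lhd> Reg 15) \<noteq> 0"
  proof -
    have "(1::nat) < 2 ^ Suc h" by (rule one_less_power) auto
    then show ?thesis using Suc.prems(2) w2 by (simp add: word_LessThan eval_Const)
  qed
  have e1: "eval w 0 (R, M) (Reg 15 \<oslash> Const 2) = 2 ^ h"
    using Suc.prems w2 assms(1) by (simp add: eval_Const)
  have r1: "runs w (2 ^ h) 1 (Assign 15 (Reg 15 \<oslash> Const 2)) (R, M) (3 + 1) (?R, M)"
    by (rule runs_Assign[OF _ _ e1]) simp_all
  let ?v = "Load (Reg 16 \<oplus> Const 2 \<otimes> (Reg 15 \<oplus> Proc)) \<oplus>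
        Load (Reg 16 \<oplus> (Const 2 \<otimes> (Reg 15 \<oplus> Proc) \<oplus> Const 1))"
  obtain M' where r2: "runs w (2 ^ h) 1 (Pardo (Reg 15) (Const 1) (Reg 16 \<oplus> (Reg 15 \<oplus> Proc)) ?v) (?R, M) 
      (cost (Reg 15) + cost (Reg 16 \<oplus> (Reg 15 \<oplus> Proc)) + cost ?v + 3) (?R, M')"
    and M': "\<And>i. i < 2 ^ h \<Longrightarrow> M' (a + 2 ^ h + i) = eval w i (?R, M) ?v"
    and fr: "\<And>x. x < a + 2 ^ h \<or> a + 2 ^ h + 2 ^ h \<le> x \<Longrightarrow> M' x = M x"
  proof (rule runs_Pardo_array[of "2 ^ h" 1 w ?R M "Reg 15" "2 ^ h" "Reg 16 \<oplus> (Reg 15 \<oplus> Proc)" "a + 2 ^ h" ?v])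
    fix i :: nat assume "i < 2 ^ h"
    then show "eval w i (?R, M) (Reg 16 \<oplus> (Reg 15 \<oplus> Proc)) = a + 2 ^ h + i"
      using Suc.prems pw assms(2) by (simp add: word_Plus)
  qed (use w2 in auto)
  have body: "runs w (2 ^ h) 1 (Assign 15 (Reg 15 \<oslash> Const 2) ;; Pardo (Reg 15) (Const 1) (Reg 16 \<oplus> (Reg 15 \<oplus> Proc)) ?v)
     (R, M) 40 (?R, M')"
    by (rule runs_mono[OF runs_Seq[OF r1 r2]]) simp
  have val: "M' (a + 2 ^ h + i) = take_bit w (M (a + 2 ^ Suc h + 2 * i) + M (a + 2 ^ Suc h + (2 * i + 1)))"
    if "i < 2 ^ h" for i
  proof -
    have "eval w i (?R, M) ?v = word_op w Plus (M (a + 2 * (2 ^ h + i))) (M (a + (2 * (2 ^ h + i) + 1)))"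
      using that Suc.prems pw assms(2) w2 by (simp add: word_Plus word_Times eval_Const)
    then show ?thesis using M'[OF that] by (simp add: word_op.simps algebra_simps)
  qed
  have inv: "tree_sums w a H g h M'"
    unfolding tree_sums_def
  proof safe
    fix t k :: nat assume t: "h \<le> t" "t \<le> H" "k < 2 ^ t"
    show "take_bit w (M' (a + 2 ^ t + k)) = take_bit w (block_sum g (H - t) k)"
    proof (cases "t = h")
      case True
      have *: "take_bit w (M (a + 2 ^ Suc h + j)) = take_bit w (block_sum g (H - Suc h) j)" if "j < 2 ^ Suc h" for j
        using Suc.prems(1,4) that unfolding tree_sums_def by blast
      have "H - h = Suc (H - Suc h)" using Suc.prems(1) by simp
      then have "take_bit w (block_sum g (H - t) k)
          = take_bit w (block_sum g (H - Suc h) (2 * k) + block_sum g (H - Suc h) (2 * k + 1))"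
        using True block_sum_Suc by simp
      also have "\<dots> = take_bit w (M (a + 2 ^ Suc h + 2 * k) + M (a + 2 ^ Suc h + (2 * k + 1)))"
        using *[of "2 * k"] *[of "2 * k + 1"] t True by (intro take_bit_add_cong) auto
      also have "\<dots> = take_bit w (M' (a + 2 ^ t + k))" using val t True by simp
      finally show ?thesis by simp
    next
      case False
      then have t': "Suc h \<le> t" using t by simp
      then have "(2::nat) ^ Suc h \<le> 2 ^ t" by (intro power_increasing) auto
      then have "M' (a + 2 ^ t + k) = M (a + 2 ^ t + k)" by (intro fr) auto
      then show ?thesis using Suc.prems(4) t t' unfolding tree_sums_def by simp
    qed
  qed
  obtain W D M'' where IH: "exec w up_sweep (?R, M') W D (?R(15 := 1), M'')" "W \<le> 50 * 2 ^ h" "D \<le> 50 * (h + 1)"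
    "tree_sums w a H g 0 M''" "\<forall>x. x < a \<or> a + 2 * 2 ^ H \<le> x \<longrightarrow> M'' x = M' x"
  proof -
    have "\<exists>W D M''. exec w up_sweep (?R, M') W D (?R(15 := 1), M'') \<and> W \<le> 50 * 2 ^ h \<and> D \<le> 50 * (h + 1)
      \<and> tree_sums w a H g 0 M'' \<and> (\<forall>x. x < a \<or> a + 2 * 2 ^ H \<le> x \<longrightarrow> M'' x = M' x)"
      by (rule Suc.IH[OF _ _ _ inv]) (use Suc.prems in simp_all)
    then show thesis using that by blast
  qed
  obtain W' D' where b: "exec w (Assign 15 (Reg 15 \<oslash> Const 2) ;; Pardo (Reg 15) (Const 1) (Reg 16 \<oplus> (Reg 15 \<oplus> Proc)) ?v)
     (R, M) W' D' (?R, M')" "W' \<le> 40 * 2 ^ h" "D' \<le> 40 * 1"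
    using body unfolding runs_def by blast
  have "(1::nat) \<le> 2 ^ h" by simp
  then have "3 + 1 + W' + W \<le> 50 * 2 ^ Suc h" using b(2) IH(2) unfolding power_Suc by linarith
  moreover have "3 + 1 + D' + D \<le> 50 * (Suc h + 1)" using b(3) IH(3) by simp
  moreover have "M'' x = M x" if x: "x < a \<or> a + 2 * 2 ^ H \<le> x" for x
  proof -
    have "M' x = M x" by (rule fr) (use x pw in auto)
    then show ?thesis using x IH(5) by metis
  qed
  moreover have "exec w up_sweep (R, M) (3 + 1 + W' + W) (3 + 1 + D' + D) (R(15 := 1), M'')"
  proof -
    have c: "cost (Const 1 \<lhd> Reg 15) = 3" by simp
    show ?thesis
      using exec.WhileTrue[OF e0 b(1) IH(1)[unfolded up_sweep_def], unfolded c]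
      unfolding up_sweep_def fun_upd_upd .
  qed
  ultimately show ?case using IH(4) by blast
qed

text \<open>The rounds double in size, so \<open>150 * 2 ^ h\<close> acts as a potential: its
  increase in one round, again \<open>150 * 2 ^ h\<close>, covers the cost of that round.\<close>

lemma down_sweep_exec:
  assumes "w > 1" "a + 4 * 2 ^ H < 2 ^ w" "h \<le> H" "R 15 = 2 ^ h" "R 16 = a" "R 6 = 2 ^ H"
    "tree_sums w a H g (Suc h) M"
    "\<forall>k<2 ^ h. M (a + 2 ^ h + k) = take_bit w (\<Sum>j<k * 2 ^ (H - h). g j)"
  shows "\<exists>W D M'. exec w down_sweep (R, M) W D (R(15 := 2 ^ H), M') \<and> W + 150 * 2 ^ h \<le> 300 * 2 ^ H \<and> D \<le> 150 * (H - h + 1)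
     \<and> (\<forall>k<2 ^ H. M' (a + 2 ^ H + k) = take_bit w (\<Sum>j<k. g j))
     \<and> (\<forall>x. x < a \<or> a + 2 * 2 ^ H \<le> x \<longrightarrow> M' x = M x)"
  using assms(3-)
proof (induction "H - h" arbitrary: h R M)
  case 0
  then have [simp]: "h = H" by simp
  have "eval w 0 (R, M) (Reg 15 \<lhd> Reg 6) = 0"
    using 0 assms(1) by (simp add: word_LessThan eval_Const)
  moreover have "cost (Reg 15 \<lhd> Reg 6) + 1 = 4" by simp
  ultimately have "exec w down_sweep (R, M) 4 4 (R(15 := 2 ^ H), M)"
    using 0 exec.WhileFalse unfolding down_sweep_def by (metis \<open>h = H\<close> fun_upd_triv)
  moreover have "(4::nat) + 150 * 2 ^ H \<le> 300 * 2 ^ H" 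
    using one_le_power[of "2::nat" H] by linarith
  moreover have "\<forall>k<2 ^ H. M (a + 2 ^ H + k) = take_bit w (\<Sum>j<k. g j)" using 0 by simp
  ultimately show ?case
    unfolding \<open>h = H\<close>
    by (rule_tac exI[of _ 4], rule_tac exI[of _ 4], rule_tac exI[of _ M]) (simp del: fun_upd_apply)
next
  case (Suc s)
  have hH: "h < H" and s: "s = H - Suc h" "H - h = Suc s" using Suc by simp_all
  have w1: "(2::nat) ^ 1 < 2 ^ w" using assms(1) by (intro power_strict_increasing) auto
  then have w2: "(2::nat) < 2 ^ w" "(1::nat) < 2 ^ w" "w > 0" "2 \<le> w" using assms(1) by simp_all
  let ?R = "R(15 := 2 ^ Suc h)"
  have pw: "(2::nat) ^ Suc h \<le> 2 ^ H" using hH by (intro power_increasing) auto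
  have e0: "eval w 0 (R, M) (Reg 15 \<lhd> Reg 6) \<noteq> 0"
    using Suc.prems w2 hH by (simp add: word_LessThan eval_Const)
  let ?v = "Load (Reg 16 \<oplus> (Reg 15 \<oplus> Proc \<oslash> Const 2)) \<oplus>
        Proc \<odot> Const 2 \<otimes> Load (Reg 16 \<oplus> (Const 2 \<otimes> Reg 15 \<oplus> Proc \<ominus> Const 1))"
  let ?a = "Reg 16 \<oplus> (Const 2 \<otimes> Reg 15 \<oplus> Proc)"
  obtain M' where r1: "runs w (2 ^ Suc h) 1 (Pardo (Const 2 \<otimes> Reg 15) (Const 1) ?a ?v) (R, M) 
      (cost (Const 2 \<otimes> Reg 15) + cost ?a + cost ?v + 3) (R, M')"
    and M': "\<And>i. i < 2 ^ Suc h \<Longrightarrow> M' (a + 2 ^ Suc h + i) = eval w i (R, M) ?v"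
    and fr: "\<And>x. x < a + 2 ^ Suc h \<or> a + 2 ^ Suc h + 2 ^ Suc h \<le> x \<Longrightarrow> M' x = M x"
  proof (rule runs_Pardo_array[of "2 ^ Suc h" 1 w R M "Const 2 \<otimes> Reg 15" "2 ^ Suc h" ?a "a + 2 ^ Suc h" ?v])
    show "eval w 0 (R, M) (Const 2 \<otimes> Reg 15) = 2 ^ Suc h"
      using Suc.prems pw assms(2) w2 by (simp add: word_Times eval_Const)
    fix i :: nat assume "i < 2 ^ Suc h"
    then show "eval w i (R, M) ?a = a + 2 ^ Suc h + i"
      using Suc.prems pw assms(2) w2 by (simp add: word_Plus word_Times eval_Const)
  qed (use w2 in auto)
  have "eval w 0 (R, M') (Const 2 \<otimes> Reg 15) = 2 ^ Suc h"
    using Suc.prems pw assms(2) w2 by (simp add: word_Times eval_Const)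
  then have r2: "runs w (2 ^ Suc h) 1 (Assign 15 (Const 2 \<otimes> Reg 15)) (R, M') (3 + 1) (?R, M')"
    by (intro runs_Assign) simp_all
  let ?body = "Pardo (Const 2 \<otimes> Reg 15) (Const 1) ?a ?v ;; Assign 15 (Const 2 \<otimes> Reg 15)"
  have body: "runs w (2 ^ Suc h) 1 ?body (R, M) 40 (?R, M')"
    by (rule runs_mono[OF runs_Seq[OF r1 r2]]) simp
  have new: "M' (a + 2 ^ Suc h + k) = take_bit w (\<Sum>j<k * 2 ^ (H - Suc h). g j)" if "k < 2 ^ Suc h" for k
  proof -
    define q where "q = k div 2"
    have q: "q < 2 ^ h" using that by (simp add: q_def)
    have p: "M (a + 2 ^ h + q) = take_bit w (\<Sum>j<q * 2 ^ (H - h). g j)" using Suc.prems q by blast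
    have qq: "q * 2 ^ (H - h) = 2 * q * 2 ^ (H - Suc h)" using s by simp
    have ev: "eval w k (R, M) ?v = word_op w Plus (M (a + 2 ^ h + q)) 
       (word_op w Times (k mod 2) (M (eval w k (R, M) (Reg 16 \<oplus> (Const 2 \<otimes> Reg 15 \<oplus> Proc \<ominus> Const 1)))))"
      using that Suc.prems pw assms(2) w2 q
      by (simp add: word_Plus word_Times eval_Const q_def add.assoc)
    show ?thesis
    proof (cases "even k")
      case True
      then have "k = 2 * q" by (simp add: q_def)
      then show ?thesis using M'[OF that] ev p qq True by (simp add: word_op.simps)
    next
      case False
      then have k: "k = 2 * q + 1" by (simp add: q_def)
      have "eval w k (R, M) (Reg 16 \<oplus> (Const 2 \<otimes> Reg 15 \<oplus> Proc \<ominus> Const 1)) = a + 2 ^ Suc h + 2 * q"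
        using that Suc.prems pw assms(2) w2 k
        by (simp add: word_Plus word_Times word_Minus eval_Const)
      then have "M' (a + 2 ^ Suc h + k) = take_bit w (M (a + 2 ^ h + q) + take_bit w (M (a + 2 ^ Suc h + 2 * q)))"
        using M'[OF that] ev k by (simp add: word_op.simps)
      \<comment> \<open>The left sibling is read from the old memory \<open>M\<close>, where depth
        \<open>Suc h\<close> still has its block sums from the up sweep.\<close>
      also have "take_bit w (M (a + 2 ^ Suc h + 2 * q)) = take_bit w (block_sum g (H - Suc h) (2 * q))"
      proof -
        have "2 * q < 2 ^ Suc h" using q by simp
        then show ?thesis using Suc.prems(5) hH unfolding tree_sums_def by (meson Suc_leI order_refl)
      qed
      also have "take_bit w (M (a + 2 ^ h + q) + \<dots>)
          = take_bit w ((\<Sum>j<2 * q * 2 ^ (H - Suc h). g j) + block_sum g (H - Suc h) (2 * q))"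
        unfolding p qq by (metis take_bit_add)
      also have "\<dots> = take_bit w (\<Sum>j<k * 2 ^ (H - Suc h). g j)"
        unfolding prefix_block_sum[symmetric] by (simp add: k)
      finally show ?thesis .
    qed
  qed
  have inv: "tree_sums w a H g (Suc (Suc h)) M'"
    unfolding tree_sums_def
  proof safe
    fix t k :: nat assume t: "Suc (Suc h) \<le> t" "t \<le> H" "k < 2 ^ t"
    then have "(2::nat) ^ Suc (Suc h) \<le> 2 ^ t" by (intro power_increasing) auto
    then have "M' (a + 2 ^ t + k) = M (a + 2 ^ t + k)" by (intro fr) auto
    then show "take_bit w (M' (a + 2 ^ t + k)) = take_bit w (block_sum g (H - t) k)"
      using Suc.prems(5) t unfolding tree_sums_def by simp
  qed
  obtain W D M'' where IH: "exec w down_sweep (?R, M') W D (?R(15 := 2 ^ H), M'')" 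
    "W + 150 * 2 ^ Suc h \<le> 300 * 2 ^ H" "D \<le> 150 * (H - Suc h + 1)"
    "\<forall>k<2 ^ H. M'' (a + 2 ^ H + k) = take_bit w (\<Sum>j<k. g j)"
    "\<forall>x. x < a \<or> a + 2 * 2 ^ H \<le> x \<longrightarrow> M'' x = M' x"
    using Suc.hyps(1)[OF s(1), of ?R M'] Suc.prems inv new hH by (auto simp del: fun_upd_upd)
  obtain W' D' where b: "exec w ?body (R, M) W' D' (?R, M')" "W' \<le> 40 * 2 ^ Suc h" "D' \<le> 40 * 1"
    using body unfolding runs_def by blast
  have "(1::nat) \<le> 2 ^ h" by simp
  then have "(3 + 1 + W' + W) + 150 * 2 ^ h \<le> 300 * 2 ^ H" using b(2) IH(2) unfolding power_Suc by linarith
  moreover have "3 + 1 + D' + D \<le> 150 * (H - h + 1)" using b(3) IH(3) s by simp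
  moreover have "M'' x = M x" if x: "x < a \<or> a + 2 * 2 ^ H \<le> x" for x
  proof -
    have "M' x = M x" by (rule fr) (use x pw in auto)
    then show ?thesis using x IH(5) by metis
  qed
  moreover have "exec w down_sweep (R, M) (3 + 1 + W' + W) (3 + 1 + D' + D) (R(15 := 2 ^ H), M'')"
  proof -
    have c: "cost (Reg 15 \<lhd> Reg 6) = 3" by simp
    show ?thesis
      using exec.WhileTrue[OF e0 b(1) IH(1)[unfolded down_sweep_def], unfolded c]
      unfolding down_sweep_def fun_upd_upd .
  qed
  ultimately show ?case using IH(4) by blast
qed

lemma runs_scan:
  assumes "w > 1" "a + 4 * 2 ^ H < 2 ^ w" "R 16 = a" "R 6 = 2 ^ H"
  obtains M' where "runs w (2 ^ H) (H + 1) scan (R, M) 500 (R(15 := 2 ^ H), M')"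
    and "\<And>j. j < 2 ^ H \<Longrightarrow> M' (a + 2 ^ H + j) = take_bit w (\<Sum>i<j. M (a + 2 ^ H + i))"
    and "\<And>x. x < a \<or> a + 2 * 2 ^ H \<le> x \<Longrightarrow> M' x = M x"
proof -
  let ?g = "\<lambda>j. M (a + 2 ^ H + j)" and ?R = "R(15 := 2 ^ H)"
  have "tree_sums w a H ?g H M" by (auto simp: tree_sums_def block_sum_def)
  then obtain W1 D1 M1 where 1: "exec w up_sweep (?R, M) W1 D1 (?R(15 := 1), M1)"
    "W1 \<le> 50 * 2 ^ H" "D1 \<le> 50 * (H + 1)" "tree_sums w a H ?g 0 M1"
    "\<forall>x. x < a \<or> a + 2 * 2 ^ H \<le> x \<longrightarrow> M1 x = M x"
    using up_sweep_exec[of w a H H ?R ?g M] assms by auto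
  have w1: "(2::nat) ^ 1 < 2 ^ w" using assms(1) by (intro power_strict_increasing) auto
  then have w2: "(2::nat) < 2 ^ w" "(1::nat) < 2 ^ w" "w > 0" "2 \<le> w" using assms(1) by simp_all
  have H1: "(1::nat) \<le> 2 ^ H" by simp
  have r0: "runs w (2 ^ H) (H + 1) (Assign 15 (Reg 6)) (R, M) 2 (?R, M)"
    by (intro runs_Assign) (simp_all add: assms)
  have r1: "runs w (2 ^ H) (H + 1) up_sweep (?R, M) 50 (?R(15 := 1), M1)"
    using 1 unfolding runs_def by blast
  let ?R1 = "?R(15 := 1)"
  let ?p = "Pardo (Const 1) (Const 1) (Reg 16 \<oplus> Const 1) (Const 0)"
  obtain M2 where r2: "runs w (2 ^ H) (H + 1) ?p (?R1, M1) (cost (Const 1) + cost (Reg 16 \<oplus> Const 1) + cost (Const 0) + 3) (?R1, M2)"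
    and M2: "\<And>i. i < 1 \<Longrightarrow> M2 (a + 1 + i) = eval w i (?R1, M1) (Const 0)"
    and fr2: "\<And>x. x < a + 1 \<or> a + 1 + 1 \<le> x \<Longrightarrow> M2 x = M1 x"
  proof (rule runs_Pardo_array[of "2 ^ H" "H + 1" w ?R1 M1 "Const 1" 1 "Reg 16 \<oplus> Const 1" "a + 1" "Const 0"])
    show "eval w 0 (?R1, M1) (Const 1) = 1" using w2 by (simp add: eval_Const)
    have "a + 1 < 2 ^ w" using assms(2) H1 by linarith
    then show "eval w i (?R1, M1) (Reg 16 \<oplus> Const 1) = a + 1 + i" if "i < 1" for i 
      using that assms w2 by (simp add: eval_Const word_Plus)
  qed (use w2 H1 in auto)
  have 2: "\<forall>k<2 ^ 0. M2 (a + 2 ^ 0 + k) = take_bit w (\<Sum>j<k * 2 ^ (H - 0). ?g j)"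
    using M2[of 0] by (simp add: eval_Const)
  have 3: "tree_sums w a H ?g (Suc 0) M2"
    unfolding tree_sums_def
  proof safe
    fix t k :: nat assume t: "Suc 0 \<le> t" "t \<le> H" "k < 2 ^ t"
    have "(2::nat) ^ 1 \<le> 2 ^ t" using t by (intro power_increasing) auto
    then have "M2 (a + 2 ^ t + k) = M1 (a + 2 ^ t + k)" by (intro fr2) auto
    then show "take_bit w (M2 (a + 2 ^ t + k)) = take_bit w (block_sum ?g (H - t) k)"
      using 1(4) t unfolding tree_sums_def by simp
  qed
  obtain W3 D3 M3 where M3: "exec w down_sweep (?R1, M2) W3 D3 (?R1(15 := 2 ^ H), M3)"
    "W3 + 150 * 2 ^ 0 \<le> 300 * 2 ^ H" "D3 \<le> 150 * (H - 0 + 1)"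
    "\<forall>k<2 ^ H. M3 (a + 2 ^ H + k) = take_bit w (\<Sum>j<k. ?g j)"
    "\<forall>x. x < a \<or> a + 2 * 2 ^ H \<le> x \<longrightarrow> M3 x = M2 x"
    using down_sweep_exec[of w a H 0 ?R1 ?g M2] assms 2 3 by auto
  have r3: "runs w (2 ^ H) (H + 1) down_sweep (?R1, M2) 300 (?R, M3)"
    using M3 unfolding runs_def by (intro exI[of _ W3] exI[of _ D3]) auto
  have "runs w (2 ^ H) (H + 1) scan (R, M) 500 (?R, M3)"
    unfolding scan_def by (rule runs_mono[OF runs_Seq[OF r0 runs_Seq[OF r1 runs_Seq[OF r2 r3]]]]) simp
  moreover have "M3 x = M x" if x: "x < a \<or> a + 2 * 2 ^ H \<le> x" for x
  proof -
    have "M3 x = M2 x" using x M3(5) by blast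
    also have "\<dots> = M1 x" by (rule fr2) (use x H1 in linarith)
    also have "\<dots> = M x" using x 1(5) by blast
    finally show ?thesis .
  qed
  ultimately show thesis using that M3(4) by blast
qed

section \<open>Concatenations of blocks\<close>

text \<open>A level is the concatenation of the blocks of its nodes in the order of the prefixes; a
  block may be empty. \<open>off F x\<close> is then the left boundary of node \<open>x\<close>, and
  \<open>off F V\<close> the length of the level.\<close>

definition flat :: "(nat \<Rightarrow> 'a list) \<Rightarrow> nat \<Rightarrow> 'a list" where
  "flat F V = concat (map F [0..<V])"

definition off :: "(nat \<Rightarrow> 'a list) \<Rightarrow> nat \<Rightarrow> nat" where
  "off F x = (\<Sum>y<x. length (F y))"

lemma off_0 [simp]: "off F 0 = 0" and off_Suc [simp]: "off F (Suc x) = off F x + length (F x)"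
  by (simp_all add: off_def)

lemma off_mono: "x \<le> y \<Longrightarrow> off F x \<le> off F y"
  unfolding off_def by (rule sum_mono2) auto

lemma flat_0 [simp]: "flat F 0 = []" and flat_Suc [simp]: "flat F (Suc V) = flat F V @ F V"
  by (simp_all add: flat_def)

lemma length_flat [simp]: "length (flat F V) = off F V"
  by (induction V) auto

lemma off_less: "x < V \<Longrightarrow> i < length (F x) \<Longrightarrow> off F x + i < off F V"
  using off_mono[of "Suc x" V F] by simp

lemma off_le: "x < V \<Longrightarrow> i \<le> length (F x) \<Longrightarrow> off F x + i \<le> off F V"
  using off_mono[of "Suc x" V F] by simp

lemma take_flat:
  "x < V \<Longrightarrow> i \<le> length (F x) \<Longrightarrow> take (off F x + i) (flat F V) = flat F x @ take i (F x)"
proof (induction V)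
  case (Suc V)
  show ?case
  proof (cases "x < V")
    case True
    then show ?thesis using Suc off_le[of x V i F] by simp
  next
    case False
    then show ?thesis using Suc.prems by (simp add: less_Suc_eq)
  qed
qed simp

lemma nth_flat: "x < V \<Longrightarrow> i < length (F x) \<Longrightarrow> flat F V ! (off F x + i) = F x ! i"
proof (induction V)
  case (Suc V)
  show ?case
  proof (cases "x < V")
    case True
    then show ?thesis using Suc off_less[of x V i F] by (simp add: nth_append)
  next
    case False
    then show ?thesis using Suc.prems by (simp add: less_Suc_eq nth_append)
  qed
qed simp

lemma off_decompose:
  assumes "j < off F V"
  obtains x i where "x < V" "i < length (F x)" "j = off F x + i"
proof -
  have "\<exists>x i. x < V \<and> i < length (F x) \<and> j = off F x + i" using assms
  proof (induction V)
    case (Suc V)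
    show ?case
    proof (cases "j < off F V")
      case True
      then show ?thesis using Suc.IH less_SucI by blast
    next
      case False
      then show ?thesis using Suc.prems by (intro exI[of _ V] exI[of _ "j - off F V"]) simp
    qed
  qed simp
  then show thesis using that by blast
qed

lemma off_inj:
  assumes "off F x + i = off F y + j" "i < length (F x)" "j < length (F y)"
  shows "x = y \<and> i = j"
proof -
  have "\<not> x < y" if "off F x + i = off F y + j" "i < length (F x)" for x y i j
    using that off_mono[of "Suc x" y F] by auto
  from this[OF assms(1,2)] this[OF assms(1)[symmetric] assms(3)] have "x = y" by simp
  then show ?thesis using assms(1) by simp
qed

lemma off_cong: "(\<And>y. y < x \<Longrightarrow> length (F y) = length (G y)) \<Longrightarrow> off F x = off G x"
  unfolding off_def by (rule sum.cong) auto


section \<open>Stable partition by a digit\<close>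

lemma nth_filter_position:
  assumes "i < length xs" "P (xs ! i)"
  shows "length (filter P (take i xs)) < length (filter P xs)"
    and "filter P xs ! length (filter P (take i xs)) = xs ! i"
proof -
  have "filter P xs = filter P (take i xs) @ xs ! i # filter P (drop (Suc i) xs)"
    using assms by (metis filter.simps(2) filter_append id_take_nth_drop)
  then show "length (filter P (take i xs)) < length (filter P xs)"
    "filter P xs ! length (filter P (take i xs)) = xs ! i" by simp_all
qed

lemma filter_nth: "filter P xs = map ((!) xs) (filter (\<lambda>i. P (xs ! i)) [0..<length xs])"
proof -
  have "filter P (map ((!) xs) [0..<length xs]) = map ((!) xs) (filter (\<lambda>i. P (xs ! i)) [0..<length xs])"
    by (simp add: filter_map comp_def)
  then show ?thesis by (simp add: map_nth)
qed

lemma length_filter_take_nth: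
  assumes "i \<le> length xs"
  shows "length (filter (\<lambda>i. P (xs ! i)) [0..<i]) = length (filter P (take i xs))"
proof -
  have "filter P (take i xs) = map ((!) (take i xs)) (filter (\<lambda>j. P (take i xs ! j)) [0..<i])"
    using filter_nth[of P "take i xs"] assms by (simp add: min_absorb2)
  moreover have "filter (\<lambda>j. P (take i xs ! j)) [0..<i] = filter (\<lambda>j. P (xs ! j)) [0..<i]"
    by (rule filter_cong) auto
  ultimately show ?thesis by simp
qed

text \<open>The children of node \<open>y\<close> are numbered \<open>y * d + c\<close>, so
  \<open>x div d\<close> is the parent of \<open>x\<close> and \<open>x mod d\<close> the digit that
  leads to it. Filtering keeps the original order, as the tree demands.\<close>

definition split_block :: "('a \<Rightarrow> nat) \<Rightarrow> nat \<Rightarrow> (nat \<Rightarrow> 'a list) \<Rightarrow> nat \<Rightarrow> 'a list" where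
  "split_block dig d F x = filter (\<lambda>s. dig s = x mod d) (F (x div d))"

text \<open>This is the same partition applied to positions instead of symbols. Concatenated over
  all children it is the inverse of the permutation to the next level, and each block lists the
  occurrences of one digit in one node in increasing order.\<close>

definition origin_block :: "('a \<Rightarrow> nat) \<Rightarrow> nat \<Rightarrow> (nat \<Rightarrow> 'a list) \<Rightarrow> nat \<Rightarrow> nat list" where
  "origin_block dig d F x = map (\<lambda>i. off F (x div d) + i)
     (filter (\<lambda>i. dig (F (x div d) ! i) = x mod d) [0..<length (F (x div d))])"

lemma length_origin_block [simp]: "length (origin_block dig d F x) = length (split_block dig d F x)"
  unfolding origin_block_def split_block_def
  using length_filter_take_nth[of "length (F (x div d))" "F (x div d)" "\<lambda>s. dig s = x mod d"] by simp

lemma off_origin_block [simp]: "off (origin_block dig d F) = off (split_block dig d F)"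
  by (rule ext, rule off_cong) simp

text \<open>The children of the nodes before \<open>x\<close> exhaust these nodes, and the children
  of \<open>x\<close> below \<open>c\<close> hold its smaller digits. The case \<open>c = d\<close>
  is the boundary to the next node and drives the induction on \<open>x\<close>.\<close>

lemma off_split_block:
  assumes "\<And>x s. s \<in> set (F x) \<Longrightarrow> dig s < d" "c \<le> d"
  shows "off (split_block dig d F) (x * d + c) = off F x + length (filter (\<lambda>s. dig s < c) (F x))"
proof -
  have *: "off (split_block dig d F) (x * d + c)
      = off (split_block dig d F) (x * d) + length (filter (\<lambda>s. dig s < c) (F x))" if "c \<le> d" for x c
    using that
  proof (induction c)
    case (Suc c)
    have "length (filter (\<lambda>s. dig s < Suc c) xs)
        = length (filter (\<lambda>s. dig s < c) xs) + length (filter (\<lambda>s. dig s = c) xs)" for xs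
      by (induction xs) auto
    then show ?case using Suc by (simp add: split_block_def)
  qed simp
  have "off (split_block dig d F) (x * d) = off F x" for x
  proof (induction x)
    case (Suc x)
    have "filter (\<lambda>s. dig s < d) (F x) = F x" using assms(1) by (simp add: filter_id_conv)
    then show ?case using *[of d x] Suc by (simp add: add_ac)
  qed simp
  then show ?thesis using * assms(2) by simp
qed

text \<open>The number \<open>off (split_block dig d F) (x * d + c) + k\<close> is the new position
  of the element: the start of its child plus the number of earlier elements of the node with the
  same digit. So the table is a left inverse of the map to new positions.\<close>

lemma nth_origin_block:
  assumes "x < V" "i < length (F x)" "c = dig (F x ! i)" "c < d"
  defines "k \<equiv> length (filter (\<lambda>s. dig s = c) (take i (F x)))"
  shows "flat (origin_block dig d F) (V * d) ! (off (split_block dig d F) (x * d + c) + k) = off F x + i"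
    and "off (split_block dig d F) (x * d + c) + k < off (split_block dig d F) (V * d)"
proof -
  let ?y = "x * d + c"
  have "Suc x * d \<le> V * d" using assms(1) by (intro mult_le_mono1) simp
  then have y: "?y < V * d" "?y div d = x" "?y mod d = c" using assms(4) by auto
  have "k = length (filter (\<lambda>j. dig (F x ! j) = c) (take i [0..<length (F x)]))"
    unfolding k_def using length_filter_take_nth[of i "F x" "\<lambda>s. dig s = c"] assms(2) by simp
  then have k: "k < length (filter (\<lambda>j. dig (F x ! j) = c) [0..<length (F x)])"
    "filter (\<lambda>j. dig (F x ! j) = c) [0..<length (F x)] ! k = i"
    using nth_filter_position[of i "[0..<length (F x)]" "\<lambda>j. dig (F x ! j) = c"] assms(2,3) by simp_all
  then have len: "k < length (origin_block dig d F ?y)" by (simp only: origin_block_def y length_map)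
  have "origin_block dig d F ?y ! k = off F x + i"
    unfolding origin_block_def y using k by simp
  then show "flat (origin_block dig d F) (V * d) ! (off (split_block dig d F) ?y + k) = off F x + i"
    using nth_flat[of ?y "V * d" k "origin_block dig d F"] y(1) len by simp
  show "off (split_block dig d F) ?y + k < off (split_block dig d F) (V * d)"
    using off_less[of ?y "V * d" k "split_block dig d F"] y(1) len by simp
qed

text \<open>This reduces the construction of the next level to a gather through the inverse
  table.\<close>

lemma flat_split_block:
  assumes "j < off (split_block dig d F) (V * d)" "d > 0"
  shows "flat (split_block dig d F) (V * d) ! j = flat F V ! (flat (origin_block dig d F) (V * d) ! j)"
proof -
  obtain x i where x: "x < V * d" "i < length (split_block dig d F x)" "j = off (split_block dig d F) x + i"
    by (rule off_decompose[OF assms(1)])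
  have xd: "x div d < V" using x(1) assms(2) by (simp add: less_mult_imp_div_less)
  let ?I = "filter (\<lambda>i. dig (F (x div d) ! i) = x mod d) [0..<length (F (x div d))]"
  have s: "split_block dig d F x = map ((!) (F (x div d))) ?I"
    unfolding split_block_def by (subst filter_nth) simp
  then have i: "i < length ?I" using x(2) by simp
  then have "?I ! i \<in> set ?I" by (rule nth_mem)
  then have "?I ! i < length (F (x div d))" by simp
  then have "flat F V ! (off F (x div d) + ?I ! i) = F (x div d) ! (?I ! i)" by (intro nth_flat xd)
  moreover have "flat (origin_block dig d F) (V * d) ! j = off F (x div d) + ?I ! i"
    unfolding x(3) using nth_flat[of x "V * d" i "origin_block dig d F"] x(1,2) i by (simp add: origin_block_def)
  moreover have "flat (split_block dig d F) (V * d) ! j = F (x div d) ! (?I ! i)"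
    unfolding x(3) using nth_flat[of x "V * d" i "split_block dig d F"] x(1,2) i by (simp add: s)
  ultimately show ?thesis by simp
qed


section \<open>Counting digits in a prefix\<close>

definition count_le :: "('a \<Rightarrow> nat) \<Rightarrow> 'a list \<Rightarrow> nat \<Rightarrow> nat \<Rightarrow> nat" where
  "count_le dig xs c j = length (filter (\<lambda>s. dig s \<le> c) (take j xs))"

lemma count_le_Suc: "j < length xs \<Longrightarrow> count_le dig xs c (Suc j) = count_le dig xs c j + of_bool (dig (xs ! j) \<le> c)"
  by (simp add: count_le_def take_Suc_conv_app_nth)

lemma count_le_mono: "i \<le> j \<Longrightarrow> count_le dig xs c i \<le> count_le dig xs c j"
proof -
  assume "i \<le> j"
  then obtain k where "j = i + k" using le_Suc_ex by blast
  then show ?thesis by (simp add: count_le_def take_add)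
qed

lemma count_le_diff: "count_le dig xs c j - count_le dig xs c i \<le> j - i"
proof (cases "i \<le> j")
  case True
  then obtain k where "j = i + k" using le_Suc_ex by blast
  moreover have "length (filter (\<lambda>s. dig s \<le> c) (take k (drop i xs))) \<le> k"
    by (rule order_trans[OF length_filter_le]) simp
  ultimately show ?thesis by (simp add: count_le_def take_add)
next
  case False
  then show ?thesis using count_le_mono[of j i] by simp
qed

lemma count_le_flat:
  assumes "x < V" "i \<le> length (F x)"
  shows "count_le dig (flat F V) c (off F x + i)
    = count_le dig (flat F V) c (off F x) + length (filter (\<lambda>s. dig s \<le> c) (take i (F x)))"
  using take_flat[of x V i F] take_flat[of x V 0 F] assms by (simp add: count_le_def)

text \<open>An element with digit \<open>a\<close> adds 1 to each of the fields \<open>a, \<dots>, d - 1\<close>, in base \<open>B\<close>.\<close>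

lemma sum_fields:
  assumes "i \<le> j" "j \<le> length xs"
  shows "(\<Sum>k = i..<j. \<Sum>c = dig (xs ! k)..<d. B ^ c)
    = (\<Sum>c<d. (count_le dig xs c j - count_le dig xs c i) * B ^ c)"
  using assms
proof (induction j rule: dec_induct)
  case (step j)
  have "(\<Sum>c = dig (xs ! j)..<d. B ^ c) = (\<Sum>c<d. of_bool (dig (xs ! j) \<le> c) * B ^ c)"
    by (rule sum.mono_neutral_cong_left) auto
  moreover have "count_le dig xs c (Suc j) - count_le dig xs c i
      = (count_le dig xs c j - count_le dig xs c i) + of_bool (dig (xs ! j) \<le> c)" for c
    using count_le_Suc[of j xs dig c] count_le_mono[of i j dig xs c] step by simp
  ultimately show ?case using step by (simp add: sum.distrib add_mult_distrib)
qed simp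

lemma sum_digits_less:
  fixes g :: "nat \<Rightarrow> nat"
  assumes "\<And>c. c < d \<Longrightarrow> g c < B"
  shows "(\<Sum>c<d. g c * B ^ c) < B ^ d"
  using assms
proof (induction d)
  case (Suc d)
  then have "(\<Sum>c<d. g c * B ^ c) < B ^ d" "g d + 1 \<le> B" by (simp_all add: Suc_leI)
  moreover have "(g d + 1) * B ^ d \<le> B * B ^ d" using calculation(2) by (rule mult_le_mono1)
  ultimately show ?case by simp
qed simp

lemma nth_digit_sum:
  fixes g :: "nat \<Rightarrow> nat"
  assumes "\<And>c. c < d \<Longrightarrow> g c < B" "c < d"
  shows "(\<Sum>c<d. g c * B ^ c) div B ^ c mod B = g c"
  using assms
proof (induction d)
  case (Suc d)
  have B: "B > 0" using Suc.prems(1)[of 0] by simp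
  show ?case
  proof (cases "c = d")
    case True
    have "(\<Sum>c<d. g c * B ^ c) < B ^ d" using sum_digits_less Suc.prems by simp
    then show ?thesis using True Suc.prems B by simp
  next
    case False
    then have "c < d" using Suc.prems by simp
    \<comment> \<open>As \<open>c < d\<close>, the top term is a multiple of
      \<open>B * B ^ c\<close>, so it vanishes under division by \<open>B ^ c\<close> followed by
      reduction modulo \<open>B\<close>.\<close>
    then obtain e where "d = c + Suc e" using less_imp_Suc_add by fastforce
    then have Bd: "B ^ d = B ^ e * B * B ^ c" by (simp add: power_add mult_ac)
    have "(\<Sum>c<Suc d. g c * B ^ c) = (\<Sum>c<d. g c * B ^ c) + g d * (B ^ e * B) * B ^ c"
      by (simp only: sum.lessThan_Suc Bd mult.assoc)
    then have "(\<Sum>c<Suc d. g c * B ^ c) div B ^ c mod B = ((\<Sum>c<d. g c * B ^ c) div B ^ c + g d * (B ^ e * B)) mod B"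
      using B by (simp only: div_mult_self1[OF power_not_zero] neq0_conv not_False_eq_True add.commute)
    also have "\<dots> = (\<Sum>c<d. g c * B ^ c) div B ^ c mod B"
      by (metis mod_mult_self1 mult.assoc)
    finally have "(\<Sum>c<Suc d. g c * B ^ c) div B ^ c mod B = (\<Sum>c<d. g c * B ^ c) div B ^ c mod B" .
    then show ?thesis using Suc \<open>c < d\<close> by simp
  qed
qed simp

text \<open>The closed form lets a processor build its field word with two shifts, a subtraction and
  a division instead of up to \<open>d\<close> additions.\<close>

lemma sum_powers_from:
  fixes B :: nat
  assumes "B \<ge> 2" "a \<le> d"
  shows "(\<Sum>c = a..<d. B ^ c) = (B ^ d - B ^ a) div (B - 1)"
proof -
  have "(\<Sum>c = a..<d. B ^ c) * (B - 1) + B ^ a = B ^ d"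
    using assms(2)
  proof (induction d rule: dec_induct)
    case (step m)
    have "B ^ m * (B - 1) + B ^ m = B ^ Suc m" using assms(1) by (cases B) simp_all
    then show ?case using step by (simp add: add_mult_distrib)
  qed simp
  then have "B ^ d - B ^ a = (\<Sum>c = a..<d. B ^ c) * (B - 1)" by (metis add_diff_cancel_right')
  then show ?thesis using assms(1) by simp
qed

section \<open>Constant-time counting\<close>

definition arr :: "nat \<Rightarrow> expr \<Rightarrow> expr \<Rightarrow> expr \<Rightarrow> expr" where
  "arr k y z i = y \<oplus> Const k \<otimes> z \<oplus> i"

text \<open>
  The layout of the area of a level, which starts at address \<open>Y\<close> and consists of arrays of \<open>Z\<close> cells,
  where \<open>Z \<ge> n + d\<close> is a power of two: \<open>arr k\<close> is the array at \<open>Y + k * Z\<close>. Arrays 1, 3 and 5 are the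
  leaves of the three prefix sum trees (field words, block counts in lane-major order, shifted
  digits), 6 is the select table, 7 and 8 are the symbols and the node boundaries of the next level,
  9 has the child pointers, 10 the packed sequences, and from 11 on there are the node records of
  5 cells each (length, packed sequence, child pointers, left boundary, \<open>Y\<close>).
\<close>

definition le_count :: "expr \<Rightarrow> expr \<Rightarrow> expr \<Rightarrow> expr \<Rightarrow> expr \<Rightarrow> expr \<Rightarrow> expr" where
  "le_count y z d f c j =
     (Load (arr 3 y z (c \<otimes> (z \<oslash> d) \<oplus> j \<oslash> d)) \<ominus> Load (arr 3 y z (c \<otimes> (z \<oslash> d)))) \<oplus>
     Op ShiftR (Load (arr 1 y z j) \<ominus> Load (arr 1 y z (j \<oslash> d \<otimes> d))) (f \<otimes> c) \<odot> (Const 2 \<otimes> d)"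

text \<open>The comparison factor replaces a branch. For \<open>c = 0\<close> the decrement wraps
  around and the loads go to meaningless cells, but the product is 0.\<close>

definition lt_count :: "expr \<Rightarrow> expr \<Rightarrow> expr \<Rightarrow> expr \<Rightarrow> expr \<Rightarrow> expr \<Rightarrow> expr" where
  "lt_count y z d f c j = (Const 0 \<lhd> c) \<otimes> le_count y z d f (c \<ominus> Const 1) j"

definition count_lt :: "('a \<Rightarrow> nat) \<Rightarrow> 'a list \<Rightarrow> nat \<Rightarrow> nat \<Rightarrow> nat" where
  "count_lt dig xs c j = length (filter (\<lambda>s. dig s < c) (take j xs))"

lemma count_lt_0 [simp]: "count_lt dig xs 0 j = 0"
  by (simp add: count_lt_def)

lemma count_lt_Suc: "count_lt dig xs (Suc c) j = count_le dig xs c j"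
  by (simp add: count_lt_def count_le_def less_Suc_eq_le)

lemma count_le_bound: "count_le dig xs c j \<le> j"
  unfolding count_le_def by (rule order_trans[OF length_filter_le]) simp

lemma count_lt_bound: "count_lt dig xs c j \<le> j"
  unfolding count_lt_def by (rule order_trans[OF length_filter_le]) simp

lemma count_lt_mono: "i \<le> j \<Longrightarrow> count_lt dig xs c i \<le> count_lt dig xs c j"
  by (cases c) (simp_all add: count_lt_Suc count_le_mono)

lemma count_lt_flat:
  assumes "x < V" "i \<le> length (F x)"
  shows "count_lt dig (flat F V) c (off F x + i)
    = count_lt dig (flat F V) c (off F x) + length (filter (\<lambda>s. dig s < c) (take i (F x)))"
  using take_flat[of x V i F] take_flat[of x V 0 F] assms by (simp add: count_lt_def)

text \<open>The bound \<open>n + d \<le> Z\<close> gives \<open>n < Z\<close>, so that an exclusive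
  prefix sum exists at position \<open>n\<close>, and \<open>d \<le> Z\<close>, so that
  \<open>d\<close> divides \<open>Z\<close> and a lane of block counts has exactly
  \<open>Z div d\<close> cells.\<close>

locale word_params =
  fixes w n d b Z H :: nat
  assumes n_pos: "1 \<le> n" and d_def: "d = 2 ^ b" and b_pos: "1 \<le> b" and Z_def: "Z = 2 ^ H"
    and nd_Z: "n + d \<le> Z" and bits: "d * (b + 1) < w"
begin

lemma d_ge_2: "2 \<le> d"
proof -
  have "(2::nat) ^ 1 \<le> 2 ^ b" using b_pos by (intro power_increasing) auto
  then show ?thesis by (simp add: d_def)
qed

lemma Z_ge_3: "3 \<le> Z" using nd_Z n_pos d_ge_2 by linarith

lemma w_gt_1: "1 < w"
proof -
  have "2 * 2 \<le> d * (b + 1)" using d_ge_2 b_pos by (intro mult_le_mono) auto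
  then show ?thesis using bits by linarith
qed

lemma w_pos: "0 < w" using w_gt_1 by simp

definition NB :: nat where "NB = Z div d"

lemma NB_d: "NB * d = Z"
proof -
  have "b \<le> H"
  proof (rule ccontr)
    assume "\<not> b \<le> H"
    then have "(2::nat) ^ H \<le> 2 ^ b" by (intro power_increasing) auto
    then show False using nd_Z n_pos unfolding d_def Z_def by linarith
  qed
  then have "d dvd Z" unfolding d_def Z_def by (rule le_imp_power_dvd)
  then show ?thesis by (simp add: NB_def)
qed

lemma div_d_less_NB: "j \<le> n \<Longrightarrow> j div d < NB"
  using nd_Z d_ge_2 NB_d less_mult_imp_div_less[of j NB d] by linarith

lemma lane_less: 
  assumes "c < d" "k < NB"
  shows "c * NB + k < Z"
proof -
  have "Suc c * NB \<le> d * NB" using assms by (intro mult_le_mono1) simp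
  then show ?thesis using assms NB_d by (simp add: mult.commute)
qed

lemma fields_less: "2 ^ ((b + 1) * d) < (2::nat) ^ w"
  using bits by (intro power_strict_increasing) (auto simp: mult.commute)

lemma w_less: "w < 2 ^ w" by (rule less_exp)

lemma twice_d: "2 * d = 2 ^ (b + 1)" by (simp add: d_def)

text \<open>The left side is literally what \<open>le_count\<close> computes: the difference inside
  lane \<open>c\<close> accounts for the whole blocks before \<open>j\<close>, and field
  \<open>c\<close> of the word difference for the rest. In this form the property mentions only
  cells of the first four arrays and passes to any memory that agrees there.\<close>

definition rank_mem :: "nat \<Rightarrow> (nat \<Rightarrow> nat \<Rightarrow> nat) \<Rightarrow> mem \<Rightarrow> bool" where
  "rank_mem Y cnt M \<longleftrightarrow> (\<forall>c<d. \<forall>j\<le>n.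
     word_op w Minus (M (Y + 3 * Z + (c * NB + j div d))) (M (Y + 3 * Z + c * NB)) +
     word_op w Minus (M (Y + 1 * Z + j)) (M (Y + 1 * Z + j div d * d)) div 2 ^ ((b + 1) * c) mod (2 * d) = cnt c j)"

lemma rank_mem_cong:
  assumes "rank_mem Y cnt M" "\<And>x. Y \<le> x \<Longrightarrow> x < Y + 4 * Z \<Longrightarrow> M' x = M x"
  shows "rank_mem Y cnt M'"
  unfolding rank_mem_def
proof safe
  fix c j assume cj: "c < d" "j \<le> n"
  have 1: "c * NB + j div d < Z" using lane_less div_d_less_NB cj by simp
  have 2: "j < Z" "j div d * d < Z" using cj nd_Z d_ge_2 div_times_less_eq_dividend[of j d] by linarith+
  have "M' (Y + 3 * Z + (c * NB + j div d)) = M (Y + 3 * Z + (c * NB + j div d))"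
    "M' (Y + 3 * Z + c * NB) = M (Y + 3 * Z + c * NB)"
    "M' (Y + 1 * Z + j) = M (Y + 1 * Z + j)" "M' (Y + 1 * Z + j div d * d) = M (Y + 1 * Z + j div d * d)"
    by (rule assms(2); use 1 2 in linarith)+
  then show "word_op w Minus (M' (Y + 3 * Z + (c * NB + j div d))) (M' (Y + 3 * Z + c * NB)) +
     word_op w Minus (M' (Y + 1 * Z + j)) (M' (Y + 1 * Z + j div d * d)) div 2 ^ ((b + 1) * c) mod (2 * d) = cnt c j"
    using assms(1) cj unfolding rank_mem_def by metis
qed

lemma eval_arr:
  assumes "eval w i s y = Y" "eval w i s z = Z" "eval w i s x = X" "Y + k * Z + X < 2 ^ w"
  shows "eval w i s (arr k y z x) = Y + k * Z + X"
proof -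
  have "k * 1 \<le> k * Z" using Z_ge_3 by (intro mult_le_mono) auto
  then have "k < 2 ^ w" using assms by linarith
  then show ?thesis using assms by (simp add: arr_def eval_Const word_Plus word_Times)
qed

lemma field_shift_less: "c < d \<Longrightarrow> (b + 1) * c < w"
proof -
  assume "c < d"
  then have "(b + 1) * c \<le> (b + 1) * d" by (intro mult_le_mono2) simp
  then show ?thesis using bits by (simp add: mult.commute)
qed

lemma field_shift: 
  assumes "c < d" "eval w i s f = b + 1" "eval w i s cE = c" 
  shows "eval w i s (f \<otimes> cE) = (b + 1) * c"
proof -
  have "(b + 1) * c < 2 ^ w" using field_shift_less[OF assms(1)] w_less by linarith
  then show ?thesis using assms by (simp add: word_Times)
qed

lemma small_consts:
  assumes "4 * Z < 2 ^ w" shows "2 < (2::nat) ^ w" "2 * d < 2 ^ w"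
  using assms Z_ge_3 nd_Z by linarith+

text \<open>The parameters are arbitrary expressions because the formula serves twice: the
  construction supplies registers, while a query loads the values from its node record and from the
  cells 0, 1 and 2.\<close>

lemma eval_le_count:
  assumes M: "rank_mem Y cnt M" and Y: "Y + 64 * Z < 2 ^ w" and cj: "c < d" "j \<le> n" and cnt: "cnt c j \<le> n"
    and ev: "eval w i (R, M) y = Y" "eval w i (R, M) z = Z" "eval w i (R, M) dE = d" 
      "eval w i (R, M) f = b + 1" "eval w i (R, M) cE = c" "eval w i (R, M) jE = j"
  shows "eval w i (R, M) (le_count y z dE f cE jE) = cnt c j"
proof -
  have 1: "c * NB + j div d < Z" using lane_less div_d_less_NB cj by simp
  have 2: "j < Z" "j div d * d < Z" using cj nd_Z d_ge_2 div_times_less_eq_dividend[of j d] by linarith+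
  have small: "2 < (2::nat) ^ w" "2 * d < 2 ^ w" using small_consts Y by linarith+
  have nb: "eval w i (R, M) (cE \<otimes> (z \<oslash> dE)) = c * NB"
    using ev 1 Y by (simp add: NB_def word_Times)
  have nb': "eval w i (R, M) (cE \<otimes> (z \<oslash> dE) \<oplus> jE \<oslash> dE) = c * NB + j div d"
    using ev 1 Y unfolding eval.simps(5)[of w i "(R, M)" Plus] nb by (simp add: word_Plus)
  have jd: "eval w i (R, M) (jE \<oslash> dE \<otimes> dE) = j div d * d"
    using ev 2 Y by (simp add: word_Times)
  have a: "eval w i (R, M) (arr 3 y z (cE \<otimes> (z \<oslash> dE) \<oplus> jE \<oslash> dE)) = Y + 3 * Z + (c * NB + j div d)"
    "eval w i (R, M) (arr 3 y z (cE \<otimes> (z \<oslash> dE))) = Y + 3 * Z + c * NB"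
    "eval w i (R, M) (arr 1 y z jE) = Y + 1 * Z + j"
    "eval w i (R, M) (arr 1 y z (jE \<oslash> dE \<otimes> dE)) = Y + 1 * Z + j div d * d"
    by (rule eval_arr; use ev nb nb' jd 1 2 Y in \<open>simp del: eval.simps\<close>)+
  have sh: "eval w i (R, M) (f \<otimes> cE) = (b + 1) * c" using field_shift cj ev by blast
  let ?A = "word_op w Minus (M (Y + 3 * Z + (c * NB + j div d))) (M (Y + 3 * Z + c * NB))"
  let ?B = "word_op w Minus (M (Y + 1 * Z + j)) (M (Y + 1 * Z + j div d * d)) div 2 ^ ((b + 1) * c) mod (2 * d)"
  have sum: "?A + ?B = cnt c j" using M cj unfolding rank_mem_def by blast
  have "?A + ?B < 2 ^ w" using sum cnt nd_Z Y by linarith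
  have ab: "eval w i (R, M) (Load (arr 3 y z (cE \<otimes> (z \<oslash> dE) \<oplus> jE \<oslash> dE)) \<ominus> Load (arr 3 y z (cE \<otimes> (z \<oslash> dE)))) = ?A"
    "eval w i (R, M) (Load (arr 1 y z jE) \<ominus> Load (arr 1 y z (jE \<oslash> dE \<otimes> dE)))
      = word_op w Minus (M (Y + 1 * Z + j)) (M (Y + 1 * Z + j div d * d))"
    by (simp_all only: eval.simps a snd_conv)
  have d2: "eval w i (R, M) (Const 2 \<otimes> dE) = 2 * d"
    using ev small by (simp add: eval_Const word_Times)
  show ?thesis
    unfolding le_count_def
    unfolding eval.simps(5)[of w i "(R, M)" Plus] eval.simps(5)[of w i "(R, M)" Modulo] eval.simps(5)[of w i "(R, M)" ShiftR] ab sh d2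
    using word_Plus[OF \<open>?A + ?B < 2 ^ w\<close>] sum by (simp only: word_ShiftR word_Modulo)
qed

lemma eval_lt_count:
  assumes M: "rank_mem Y (count_le dig xs) M" and Y: "Y + 64 * Z < 2 ^ w" and cj: "c < d" "j \<le> n"
    and ev: "eval w i (R, M) y = Y" "eval w i (R, M) z = Z" "eval w i (R, M) dE = d" 
      "eval w i (R, M) f = b + 1" "eval w i (R, M) cE = c" "eval w i (R, M) jE = j"
  shows "eval w i (R, M) (lt_count y z dE f cE jE) = count_lt dig xs c j"
proof (cases c)
  case 0
  then show ?thesis using ev w_pos by (simp add: lt_count_def word_LessThan word_Times)
next
  case (Suc c')
  have bd: "count_le dig xs c' j \<le> n" using count_le_bound cj le_trans by blast
  have c': "eval w i (R, M) (cE \<ominus> Const 1) = c'"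
    using ev Suc cj nd_Z Y w_pos by (simp add: word_Minus)
  have "eval w i (R, M) (le_count y z dE f (cE \<ominus> Const 1) jE) = count_le dig xs c' j"
    by (rule eval_le_count[OF M Y _ cj(2) bd ev(1-4) c' ev(6)]) (use Suc cj in simp)
  then show ?thesis
    using ev Suc w_pos bd nd_Z Y
    by (simp add: lt_count_def word_LessThan word_Times count_lt_Suc)
qed

end

section \<open>One level of the tree\<close>

lemma cost_arr [simp]: "cost (arr k y z x) = cost y + cost z + cost x + 4"
  by (simp add: arr_def)

section \<open>Prefix counts of one level\<close>

abbreviation symbol_expr :: expr where "symbol_expr \<equiv> Load (Reg 9 \<oplus> Proc)"

definition digit_expr :: expr where "digit_expr = symbol_expr \<oslash> Reg 12 \<odot> Reg 2"

text \<open>The node of an element is read off its symbol, so no array of node numbers is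
  kept.\<close>

definition key_expr :: expr where "key_expr = symbol_expr \<oslash> Reg 7"

definition fields_expr :: expr where
  "fields_expr = (Op ShiftL (Const 1) (Reg 14 \<otimes> Reg 2) \<ominus> Op ShiftL (Const 1) (Reg 14 \<otimes> digit_expr))
     \<oslash> (Const 2 \<otimes> Reg 2 \<ominus> Const 1)"

text \<open>Processor \<open>c * NB + k\<close> handles lane \<open>c\<close> and block
  \<open>k\<close>. For blocks that the \<open>n\<close> elements do not fill completely the value
  is left unspecified.\<close>

definition block_count_expr :: expr where
  "block_count_expr = (let k = Proc \<odot> (Reg 6 \<oslash> Reg 2); c = Proc \<oslash> (Reg 6 \<oslash> Reg 2) in
     Op ShiftR (Load (arr 1 (Reg 11) (Reg 6) (k \<otimes> Reg 2 \<oplus> Reg 2)) \<ominus> Load (arr 1 (Reg 11) (Reg 6) (k \<otimes> Reg 2)))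
       (Reg 14 \<otimes> c) \<odot> (Const 2 \<otimes> Reg 2))"

definition rank_phase :: com where
  "rank_phase =
     Pardo (Reg 0) (Const 1) (arr 1 (Reg 11) (Reg 6) Proc) fields_expr ;;
     Assign 16 (Reg 11) ;; scan ;;
     Pardo (Reg 6) (Const 1) (arr 3 (Reg 11) (Reg 6) Proc) block_count_expr ;;
     Assign 16 (arr 2 (Reg 11) (Reg 6) (Const 0)) ;; scan"

text \<open>
  At the level whose nodes have the prefixes \<open>x < V\<close>, the prefix of a symbol \<open>s\<close> is \<open>s div E\<close> and its
  digit is \<open>s div D mod d\<close>; the node \<open>x\<close> has the symbols \<open>F x\<close>. The symbols of the level are at \<open>XP\<close>,
  the boundaries of the nodes at \<open>SP\<close>, and the pointer to the root is \<open>rt\<close>.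
\<close>

locale level = word_params +
  fixes E D V Y XP SP rt :: nat and F :: "nat \<Rightarrow> nat list"
  assumes Y_bound: "Y + 64 * Z < 2 ^ w" and XP_le: "XP + Z \<le> Y" and SP_le: "SP + V < Y"
    and E_def: "E = D * d" and V_le: "V \<le> n"
    and V_next: "1 < D \<Longrightarrow> V * d \<le> n" and off_V: "off F V = n"
    and key: "\<And>x s. x < V \<Longrightarrow> s \<in> set (F x) \<Longrightarrow> s div E = x"
begin

definition dig :: "nat \<Rightarrow> nat" where "dig s = s div D mod d"

definition xs :: "nat list" where "xs = flat F V"

definition regs :: "regs \<Rightarrow> bool" where
  "regs R \<longleftrightarrow> R 0 = n \<and> R 2 = d \<and> R 5 = b \<and> R 6 = Z \<and> R 7 = E \<and> R 8 = V \<and> R 9 = XP \<and> R 10 = SP \<and>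
     R 11 = Y \<and> R 12 = D \<and> R 13 = w div b \<and> R 14 = b + 1 \<and> R 17 = rt"

definition input :: "mem \<Rightarrow> bool" where
  "input M \<longleftrightarrow> (\<forall>j<n. M (XP + j) = xs ! j) \<and> (\<forall>x\<le>V. M (SP + x) = off F x)"

lemma input_cong: "input M \<Longrightarrow> (\<And>x. x < Y \<Longrightarrow> M' x = M x) \<Longrightarrow> input M'"
  unfolding input_def using XP_le SP_le nd_Z by simp

lemma regs_upd [simp]:
  "regs (R(15 := x)) = regs R" "regs (R(16 := x)) = regs R" "regs (R(18 := x)) = regs R"
  by (simp_all add: regs_def)

lemma dig_less: "dig s < d" using d_ge_2 by (simp add: dig_def)

lemma length_xs [simp]: "length xs = n" by (simp add: xs_def off_V)

lemma small: "2 < (2::nat) ^ w" "2 * d < 2 ^ w" "4 * n < 2 ^ w"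
  using Y_bound Z_ge_3 nd_Z by linarith+

lemma eval_symbol:
  assumes "regs R" "input M" "j < n"
  shows "eval w j (R, M) symbol_expr = xs ! j"
proof -
  have "XP + j < 2 ^ w" using assms XP_le Y_bound nd_Z by linarith
  then show ?thesis using assms by (simp add: regs_def input_def word_Plus)
qed

lemma eval_digit:
  assumes "regs R" "input M" "j < n"
  shows "eval w j (R, M) digit_expr = dig (xs ! j)"
  using eval_symbol[OF assms] assms(1) unfolding digit_expr_def by (simp add: dig_def regs_def)

lemma eval_arr_regs:
  assumes "regs R" "eval w i (R, M) x = X" "k \<le> 30" "X \<le> 16 * Z"
  shows "eval w i (R, M) (arr k (Reg 11) (Reg 6) x) = Y + k * Z + X"
proof (rule eval_arr)
  have "k * Z \<le> 30 * Z" using assms(3) by (rule mult_le_mono1)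
  then show "Y + k * Z + X < 2 ^ w" using assms(4) Y_bound by linarith
qed (use assms in \<open>simp_all add: regs_def\<close>)

lemma runs_array:
  assumes "regs R" "eval w 0 (R, M) k = K" "K \<le> Z" "m \<le> 14" "cost k + cost v + 10 \<le> C"
  obtains M' where "runs w Z (H + 1) (Pardo k (Const 1) (arr m (Reg 11) (Reg 6) Proc) v) (R, M) C (R, M')"
    and "\<And>i. i < K \<Longrightarrow> M' (Y + m * Z + i) = eval w i (R, M) v"
    and "\<And>x. x < Y + m * Z \<or> Y + m * Z + K \<le> x \<Longrightarrow> M' x = M x"
proof -
  obtain M' where M': "runs w Z (H + 1) (Pardo k (Const 1) (arr m (Reg 11) (Reg 6) Proc) v) (R, M)
      (cost k + cost (arr m (Reg 11) (Reg 6) Proc) + cost v + 3) (R, M')"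
    "\<And>i. i < K \<Longrightarrow> M' (Y + m * Z + i) = eval w i (R, M) v"
    "\<And>x. x < Y + m * Z \<or> Y + m * Z + K \<le> x \<Longrightarrow> M' x = M x"
  proof (rule runs_Pardo_array)
    show "1 \<le> Z" "1 \<le> H + 1" using Z_ge_3 by simp_all
    show "eval w i (R, M) (arr m (Reg 11) (Reg 6) Proc) = Y + m * Z + i" if "i < K" for i
      by (rule eval_arr_regs) (use assms that in simp_all)
    show "0 < w" by (rule w_pos)
  qed (use assms in auto)
  show thesis
    by (rule that[OF runs_mono[OF M'(1)] M'(2,3)]) (use assms(5) in simp_all)
qed

lemma runs_scan_regs:
  assumes "regs R" "R 16 = Y + m * Z" "m \<le> 10"
  obtains R' M' where "runs w Z (H + 1) scan (R, M) 500 (R', M')" and "regs R'"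
    and "\<And>j. j < Z \<Longrightarrow> M' (Y + (m + 1) * Z + j) = take_bit w (\<Sum>i<j. M (Y + (m + 1) * Z + i))"
    and "\<And>x. x < Y + m * Z \<or> Y + (m + 2) * Z \<le> x \<Longrightarrow> M' x = M x"
proof -
  have "m * Z \<le> 10 * Z" using assms(3) by (rule mult_le_mono1)
  then have "Y + m * Z + 4 * 2 ^ H < 2 ^ w" using Y_bound unfolding Z_def by linarith
  moreover have "R 6 = Z" using assms(1) by (simp add: regs_def)
  then have "R 6 = 2 ^ H" by (rule trans[OF _ Z_def])
  ultimately obtain M' where
    "runs w (2 ^ H) (H + 1) scan (R, M) 500 (R(15 := 2 ^ H), M')"
    "\<And>j. j < 2 ^ H \<Longrightarrow> M' (Y + m * Z + 2 ^ H + j) = take_bit w (\<Sum>i<j. M (Y + m * Z + 2 ^ H + i))"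
    "\<And>x. x < Y + m * Z \<or> Y + m * Z + 2 * 2 ^ H \<le> x \<Longrightarrow> M' x = M x"
    using runs_scan[OF w_gt_1, of "Y + m * Z" H R M] assms(2) by blast
  moreover have "Y + m * Z + Z = Y + (m + 1) * Z" "Y + m * Z + 2 * Z = Y + (m + 2) * Z"
    by (simp_all add: algebra_simps)
  ultimately show thesis
    using that[of "R(15 := 2 ^ H)" M'] assms(1) by (simp only: Z_def[symmetric] regs_upd)
qed

lemma eval_fields:
  assumes "regs R" "input M" "j < n"
  shows "eval w j (R, M) fields_expr = (\<Sum>c = dig (xs ! j)..<d. (2 * d) ^ c)"
proof -
  let ?a = "dig (xs ! j)"
  have le: "(b + 1) * ?a \<le> (b + 1) * d" using dig_less by (intro mult_le_mono2 less_imp_le)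
  have lt: "(b + 1) * d < 2 ^ w" using less_trans[OF bits w_less] by (simp only: mult.commute)
  have r: "R 14 = b + 1" "R 2 = d" using assms(1) by (simp_all add: regs_def)
  have 1: "eval w j (R, M) (Reg 14 \<otimes> Reg 2) = (b + 1) * d"
    using lt by (simp only: eval.simps fst_conv r word_Times)
  have 2: "eval w j (R, M) (Reg 14 \<otimes> digit_expr) = (b + 1) * ?a"
    unfolding eval.simps(5) eval_digit[OF assms] using le lt r by (simp only: eval.simps fst_conv word_Times)
  have pw: "(2::nat) ^ ((b + 1) * ?a) \<le> 2 ^ ((b + 1) * d)" using le by (intro power_increasing) auto
  have 3: "eval w j (R, M) (Op ShiftL (Const 1) (Reg 14 \<otimes> Reg 2)) = 2 ^ ((b + 1) * d)"
    "eval w j (R, M) (Op ShiftL (Const 1) (Reg 14 \<otimes> digit_expr)) = 2 ^ ((b + 1) * ?a)"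
    unfolding eval.simps(5)[of w j "(R, M)" ShiftL] 1 2 using fields_less pw w_pos by (simp_all add: word_ShiftL)
  have 4: "eval w j (R, M) (Const 2 \<otimes> Reg 2 \<ominus> Const 1) = 2 * d - 1"
    using small d_ge_2 r w_pos by (simp add: eval_Const word_Times word_Minus)
  have "eval w j (R, M) fields_expr = (2 ^ ((b + 1) * d) - 2 ^ ((b + 1) * ?a)) div (2 * d - 1)"
    unfolding fields_expr_def eval.simps(5)[of w j "(R, M)" Divide] eval.simps(5)[of w j "(R, M)" Minus] 3
      4[unfolded eval.simps(5)[of w j "(R, M)" Minus]]
    using pw fields_less by (simp only: word_Minus word_Divide)
  also have "\<dots> = ((2 * d) ^ d - (2 * d) ^ ?a) div (2 * d - 1)"
    by (simp only: twice_d power_mult)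
  also have "\<dots> = (\<Sum>c = ?a..<d. (2 * d) ^ c)"
    by (rule sum_powers_from[symmetric]) (use d_ge_2 dig_less in \<open>auto intro: less_imp_le\<close>)
  finally show ?thesis .
qed

text \<open>Prefix sums modulo \<open>2 ^ w\<close> suffice, because the fields of one block fit in a word.\<close>

lemma packed_block_count:
  assumes P: "\<And>j. j \<le> n \<Longrightarrow> M (Y + 1 * Z + j) = take_bit w (\<Sum>i<j. \<Sum>c = dig (xs ! i)..<d. (2 * d) ^ c)"
    and ij: "i \<le> j" "j \<le> n" "j \<le> i + d" and c: "c < d"
  shows "word_op w Minus (M (Y + 1 * Z + j)) (M (Y + 1 * Z + i)) div 2 ^ ((b + 1) * c) mod (2 * d)
    = count_le dig xs c j - count_le dig xs c i"
proof -
  let ?g = "\<lambda>c. count_le dig xs c j - count_le dig xs c i"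
  have g: "?g c < 2 * d" for c
    using count_le_diff[of dig xs c j i] ij d_ge_2 by linarith
  have "word_op w Minus (M (Y + 1 * Z + j)) (M (Y + 1 * Z + i))
      = take_bit w (\<Sum>k = i..<j. \<Sum>c = dig (xs ! k)..<d. (2 * d) ^ c)"
    using P[of j] P[of i] ij by (simp only: word_Minus_sums order_trans[OF ij(1,2)])
  also have "(\<Sum>k = i..<j. \<Sum>c = dig (xs ! k)..<d. (2 * d) ^ c) = (\<Sum>c<d. ?g c * (2 * d) ^ c)"
    by (rule sum_fields) (use ij in auto)
  also have "take_bit w (\<Sum>c<d. ?g c * (2 * d) ^ c) = (\<Sum>c<d. ?g c * (2 * d) ^ c)"
  proof -
    have "(\<Sum>c<d. ?g c * (2 * d) ^ c) < (2 * d) ^ d" by (rule sum_digits_less) (rule g)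
    also have "\<dots> = 2 ^ ((b + 1) * d)" by (simp only: twice_d power_mult)
    also have "\<dots> < 2 ^ w" by (rule fields_less)
    finally show ?thesis by (simp add: take_bit_nat_eq_self)
  qed
  finally have *: "word_op w Minus (M (Y + 1 * Z + j)) (M (Y + 1 * Z + i)) = (\<Sum>c<d. ?g c * (2 * d) ^ c)" .
  have "2 ^ ((b + 1) * c) = (2 * d) ^ c" by (simp only: twice_d power_mult)
  then show ?thesis
    unfolding * using nth_digit_sum[of d ?g "2 * d" c] g c by simp
qed

lemma eval_block_count:
  assumes R: "regs R" and c: "c < d" and k: "k < n div d"
    and P: "\<And>j. j \<le> n \<Longrightarrow> M (Y + 1 * Z + j) = take_bit w (\<Sum>i<j. \<Sum>c = dig (xs ! i)..<d. (2 * d) ^ c)"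
  shows "eval w (c * NB + k) (R, M) block_count_expr = count_le dig xs c (k * d + d) - count_le dig xs c (k * d)"
proof -
  let ?i = "c * NB + k"
  have kd: "k * d + d \<le> n"
  proof -
    have "Suc k * d \<le> n div d * d" using k by (intro mult_le_mono1) simp
    then show ?thesis using div_times_less_eq_dividend[of n d] unfolding mult_Suc by linarith
  qed
  have kNB: "k < NB" using k div_d_less_NB[of n] by simp
  have r: "R 14 = b + 1" "R 2 = d" "R 6 = Z" using R by (simp_all add: regs_def)
  let ?k = "Proc \<odot> (Reg 6 \<oslash> Reg 2)" and ?c = "Proc \<oslash> (Reg 6 \<oslash> Reg 2)"
  have kc: "eval w ?i (R, M) ?k = k" "eval w ?i (R, M) ?c = c"
    using r kNB by (simp_all add: NB_def)
  have ks: "eval w ?i (R, M) (?k \<otimes> Reg 2) = k * d"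
    unfolding eval.simps(5)[of w ?i "(R, M)" Times] kc using r kd small by (simp add: word_Times)
  have ks': "eval w ?i (R, M) (?k \<otimes> Reg 2 \<oplus> Reg 2) = k * d + d"
    unfolding eval.simps(5)[of w ?i "(R, M)" Plus] ks using r kd small by (simp add: word_Plus)
  have sh: "eval w ?i (R, M) (Reg 14 \<otimes> ?c) = (b + 1) * c"
    by (rule field_shift[OF c _ kc(2)]) (use r in simp)
  have a: "eval w ?i (R, M) (arr 1 (Reg 11) (Reg 6) (?k \<otimes> Reg 2 \<oplus> Reg 2)) = Y + 1 * Z + (k * d + d)"
    "eval w ?i (R, M) (arr 1 (Reg 11) (Reg 6) (?k \<otimes> Reg 2)) = Y + 1 * Z + k * d"
    by (rule eval_arr_regs[OF R]; use ks ks' kd nd_Z in linarith)+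
  have d2: "eval w ?i (R, M) (Const 2 \<otimes> Reg 2) = 2 * d"
    using r small by (simp add: eval_Const word_Times)
  show ?thesis
    unfolding block_count_expr_def Let_def
    unfolding eval.simps(5)[of w ?i "(R, M)" Modulo] eval.simps(5)[of w ?i "(R, M)" ShiftR]
      eval.simps(5)[of w ?i "(R, M)" Minus] eval.simps(4) a d2 sh snd_conv word_Modulo word_ShiftR
    by (rule packed_block_count[OF P]) (use kd c in auto)
qed

text \<open>Lane-major order makes the blocks of one digit contiguous, so their count is one
  difference of prefix sums. Everything before the lane cancels, including the unspecified counts at
  the ends of earlier lanes; within lane \<open>c\<close> only full blocks
  \<open>k < n div d\<close> are summed.\<close>

lemma rank_memI:
  assumes P: "\<And>j. j \<le> n \<Longrightarrow> M (Y + 1 * Z + j) = take_bit w (\<Sum>i<j. \<Sum>c = dig (xs ! i)..<d. (2 * d) ^ c)"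
    and G: "\<And>j. j < Z \<Longrightarrow> M (Y + 3 * Z + j) = take_bit w (\<Sum>i<j. g i)"
    and g: "\<And>c k. c < d \<Longrightarrow> k < n div d \<Longrightarrow> g (c * NB + k) = count_le dig xs c (k * d + d) - count_le dig xs c (k * d)"
  shows "rank_mem Y (count_le dig xs) M"
  unfolding rank_mem_def
proof safe
  fix c j assume c: "c < d" and j: "j \<le> n"
  define m where "m = j div d"
  have m: "m < NB" "m \<le> n div d" using div_d_less_NB j by (simp_all add: m_def div_le_mono)
  have mj: "m * d \<le> j" "j \<le> m * d + d"
    using mod_less_divisor[of d j] d_ge_2 div_mult_mod_eq[of j d] unfolding m_def by linarith+
  have "word_op w Minus (M (Y + 3 * Z + (c * NB + m))) (M (Y + 3 * Z + c * NB))
      = take_bit w (\<Sum>i = c * NB..<c * NB + m. g i)"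
    using G[of "c * NB + m"] G[of "c * NB"] lane_less[OF c m(1)] by (simp add: word_Minus_sums)
  also have "(\<Sum>i = c * NB..<c * NB + m. g i) = count_le dig xs c (m * d)"
    using m(2)
  proof (induction m)
    case (Suc m)
    have "(\<Sum>i = c * NB..<c * NB + Suc m. g i) = count_le dig xs c (m * d) + g (c * NB + m)"
      using Suc by simp
    also have "\<dots> = count_le dig xs c (Suc m * d)"
      using g[OF c, of m] Suc.prems count_le_mono[of "m * d" "m * d + d" dig xs c] by (simp add: add_ac)
    finally show ?case .
  qed (simp add: count_le_def)
  also have "take_bit w (count_le dig xs c (m * d)) = count_le dig xs c (m * d)"
    using count_le_bound[of dig xs c "m * d"] mj j small by (simp add: take_bit_nat_eq_self)
  finally have 1: "word_op w Minus (M (Y + 3 * Z + (c * NB + m))) (M (Y + 3 * Z + c * NB)) = count_le dig xs c (m * d)" .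
  have 2: "word_op w Minus (M (Y + 1 * Z + j)) (M (Y + 1 * Z + m * d)) div 2 ^ ((b + 1) * c) mod (2 * d)
      = count_le dig xs c j - count_le dig xs c (m * d)"
    by (rule packed_block_count[OF P]) (use mj j c in auto)
  show "word_op w Minus (M (Y + 3 * Z + (c * NB + j div d))) (M (Y + 3 * Z + c * NB)) +
     word_op w Minus (M (Y + 1 * Z + j)) (M (Y + 1 * Z + j div d * d)) div 2 ^ ((b + 1) * c) mod (2 * d)
     = count_le dig xs c j"
    unfolding m_def[symmetric] 1 2 using count_le_mono[OF mj(1), of dig xs c] by simp
qed

lemma runs_rank_phase:
  assumes R: "regs R" and M: "input M"
  obtains R' M' where "runs w Z (H + 1) rank_phase (R, M) 2000 (R', M')" and "regs R'"
    and "rank_mem Y (count_le dig xs) M'"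
    and "\<And>x. x < Y \<or> Y + 4 * Z \<le> x \<Longrightarrow> M' x = M x"
proof -
  have Z1: "1 \<le> Z" using Z_ge_3 by simp
  obtain M1 where 1: "runs w Z (H + 1) (Pardo (Reg 0) (Const 1) (arr 1 (Reg 11) (Reg 6) Proc) fields_expr) (R, M) 100 (R, M1)"
    and M1: "\<And>i. i < n \<Longrightarrow> M1 (Y + 1 * Z + i) = eval w i (R, M) fields_expr"
    and fr1: "\<And>x. x < Y + 1 * Z \<or> Y + 1 * Z + n \<le> x \<Longrightarrow> M1 x = M x"
    by (rule runs_array[OF R, of M "Reg 0" n 1 fields_expr 100])
      (use R nd_Z in \<open>simp_all add: regs_def fields_expr_def digit_expr_def\<close>)
  have 2: "runs w Z (H + 1) (Assign 16 (Reg 11)) (R, M1) 2 (R(16 := Y), M1)"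
    by (rule runs_Assign) (use Z1 R in \<open>simp_all add: regs_def\<close>)
  obtain R3 M3 where 3: "runs w Z (H + 1) scan (R(16 := Y), M1) 500 (R3, M3)" and R3: "regs R3"
    and M3: "\<And>j. j < Z \<Longrightarrow> M3 (Y + (0 + 1) * Z + j) = take_bit w (\<Sum>i<j. M1 (Y + (0 + 1) * Z + i))"
    and fr3: "\<And>x. x < Y + 0 * Z \<or> Y + (0 + 2) * Z \<le> x \<Longrightarrow> M3 x = M1 x"
    by (rule runs_scan_regs[of "R(16 := Y)" 0 M1]) (use R in simp_all)
  \<comment> \<open>An exclusive sum at \<open>j \<le> n\<close> involves only leaves below
    \<open>n\<close>. The cells from \<open>n\<close> up to \<open>Z\<close> were not filled before
    the scan and may have held anything.\<close>
  have P3: "M3 (Y + 1 * Z + j) = take_bit w (\<Sum>i<j. \<Sum>c = dig (xs ! i)..<d. (2 * d) ^ c)" if "j \<le> n" for j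
  proof -
    have "j < Z" using that nd_Z d_ge_2 by linarith
    then have "M3 (Y + 1 * Z + j) = take_bit w (\<Sum>i<j. M1 (Y + 1 * Z + i))" using M3[of j] by simp
    also have "(\<Sum>i<j. M1 (Y + 1 * Z + i)) = (\<Sum>i<j. \<Sum>c = dig (xs ! i)..<d. (2 * d) ^ c)"
      by (rule sum.cong) (use M1 eval_fields[OF R M] that in auto)
    finally show ?thesis .
  qed
  obtain M4 where 4: "runs w Z (H + 1) (Pardo (Reg 6) (Const 1) (arr 3 (Reg 11) (Reg 6) Proc) block_count_expr) (R3, M3) 100 (R3, M4)"
    and M4: "\<And>i. i < Z \<Longrightarrow> M4 (Y + 3 * Z + i) = eval w i (R3, M3) block_count_expr"
    and fr4: "\<And>x. x < Y + 3 * Z \<or> Y + 3 * Z + Z \<le> x \<Longrightarrow> M4 x = M3 x"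
    by (rule runs_array[OF R3, of M3 "Reg 6" Z 3 block_count_expr 100])
      (use R3 in \<open>simp_all add: regs_def block_count_expr_def Let_def\<close>)
  have "eval w 0 (R3, M4) (arr 2 (Reg 11) (Reg 6) (Const 0)) = Y + 2 * Z + 0"
    by (rule eval_arr_regs[OF R3]) simp_all
  then have 5: "runs w Z (H + 1) (Assign 16 (arr 2 (Reg 11) (Reg 6) (Const 0))) (R3, M4) 10 (R3(16 := Y + 2 * Z), M4)"
    by (intro runs_Assign) (use Z1 in simp_all)
  obtain R6 M6 where 6: "runs w Z (H + 1) scan (R3(16 := Y + 2 * Z), M4) 500 (R6, M6)" and R6: "regs R6"
    and M6: "\<And>j. j < Z \<Longrightarrow> M6 (Y + (2 + 1) * Z + j) = take_bit w (\<Sum>i<j. M4 (Y + (2 + 1) * Z + i))"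
    and fr6: "\<And>x. x < Y + 2 * Z \<or> Y + (2 + 2) * Z \<le> x \<Longrightarrow> M6 x = M4 x"
    by (rule runs_scan_regs[of "R3(16 := Y + 2 * Z)" 2 M4]) (use R3 in simp_all)
  have "rank_mem Y (count_le dig xs) M6"
  proof (rule rank_memI)
    fix j assume j: "j \<le> n"
    then have "j < Z" using nd_Z d_ge_2 by linarith
    then have "M6 (Y + 1 * Z + j) = M3 (Y + 1 * Z + j)"
      using fr6[of "Y + 1 * Z + j"] fr4[of "Y + 1 * Z + j"] nd_Z by simp
    then show "M6 (Y + 1 * Z + j) = take_bit w (\<Sum>i<j. \<Sum>c = dig (xs ! i)..<d. (2 * d) ^ c)"
      using P3[OF j] by simp
  next
    show "M6 (Y + 3 * Z + j) = take_bit w (\<Sum>i<j. M4 (Y + 3 * Z + i))" if "j < Z" for j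
      using M6[OF that] by simp
    show "M4 (Y + 3 * Z + (c * NB + k)) = count_le dig xs c (k * d + d) - count_le dig xs c (k * d)"
      if "c < d" "k < n div d" for c k
    proof -
      have "c * NB + k < Z" using lane_less[of c k] that div_d_less_NB[of n] by simp
      then show ?thesis using M4 eval_block_count[OF R3 that P3] by simp
    qed
  qed
  moreover have "M6 x = M x" if "x < Y \<or> Y + 4 * Z \<le> x" for x
    using that fr6[of x] fr4[of x] fr3[of x] fr1[of x] nd_Z by auto
  moreover have "runs w Z (H + 1) rank_phase (R, M) 2000 (R6, M6)"
    unfolding rank_phase_def
    by (rule runs_mono[OF runs_Seq[OF 1 runs_Seq[OF 2 runs_Seq[OF 3 runs_Seq[OF 4 runs_Seq[OF 5 6]]]]]]) simp
  ultimately show thesis using that R6 by blast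
qed

end

section \<open>Child boundaries, child pointers and the permutation to the next level\<close>

definition start_expr :: "expr \<Rightarrow> expr" where "start_expr x = Load (Reg 10 \<oplus> x)"

abbreviation le_expr :: "expr \<Rightarrow> expr \<Rightarrow> expr" where
  "le_expr c j \<equiv> le_count (Reg 11) (Reg 6) (Reg 2) (Reg 14) c j"

abbreviation lt_expr :: "expr \<Rightarrow> expr \<Rightarrow> expr" where
  "lt_expr c j \<equiv> lt_count (Reg 11) (Reg 6) (Reg 2) (Reg 14) c j"

abbreviation arr_expr :: "nat \<Rightarrow> expr \<Rightarrow> expr" where
  "arr_expr k x \<equiv> arr k (Reg 11) (Reg 6) x"

lemma cost_le_count [simp]: "cost (le_count y z d f c j) = 4 * cost y + 6 * cost z + 6 * cost d + 3 * cost c + 3 * cost j + cost f + 36"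
  by (simp add: le_count_def)

text \<open>Start of the parent plus the number of smaller digits in the parent, the latter as a
  difference of level-wide counts at its two boundaries.\<close>

definition child_start_expr :: expr where
  "child_start_expr = start_expr (Proc \<oslash> Reg 2) \<oplus> lt_expr (Proc \<odot> Reg 2) (start_expr (Proc \<oslash> Reg 2 \<oplus> Const 1))
     \<ominus> lt_expr (Proc \<odot> Reg 2) (start_expr (Proc \<oslash> Reg 2))"

text \<open>The area of the next level begins 16 arrays further on and its records 11 arrays into
  it, whence 27; a record has 5 cells. A child exists if its two boundaries differ; otherwise, and
  on the last level, a factor 0 turns the address into the null pointer.\<close>

definition child_pointer_expr :: expr where
  "child_pointer_expr = (Const 1 \<lhd> Reg 12) \<otimes> ((Load (arr_expr 8 Proc) \<lhd> Load (arr_expr 8 (Proc \<oplus> Const 1)))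
     \<otimes> arr_expr 27 (Proc \<otimes> Const 5))"

text \<open>On the last level, where \<open>D = 1\<close>, the product \<open>V * d\<close> may
  exceed the size of an array; there \<open>d\<close> null pointers serve all nodes together. The
  single write stores the boundary after the last child, which is \<open>n\<close>.\<close>

definition children_phase :: com where
  "children_phase =
     If (Const 1 \<lhd> Reg 12) (Assign 18 (Reg 8 \<otimes> Reg 2)) (Assign 18 (Reg 2)) ;;
     Pardo (Reg 18) (Const 1) (arr_expr 8 Proc) child_start_expr ;;
     Pardo (Const 1) (Const 1) (arr_expr 8 (Reg 18)) (Reg 0) ;;
     Pardo (Reg 18) (Const 1) (arr_expr 9 Proc) child_pointer_expr"

text \<open>Write lt, le and eq for the counts of smaller, smaller or equal, and equal digits before
  a position, and let s, e, j be the start of the node, its end and the element. The target is s +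
  (lt e - lt s) + (eq j - eq s). With eq = le - lt the terms lt s cancel, which leaves the four
  counts used here.\<close>

definition new_position_expr :: expr where
  "new_position_expr = (start_expr key_expr \<oplus> lt_expr digit_expr (start_expr (key_expr \<oplus> Const 1)) \<ominus> lt_expr digit_expr Proc)
     \<oplus> (le_expr digit_expr Proc \<ominus> le_expr digit_expr (start_expr key_expr))"

text \<open>Only the inverse permutation is scattered. It stays behind as the select table, and the
  symbols are gathered through it.\<close>

definition permute_phase :: com where
  "permute_phase =
     Pardo (Reg 0) (Const 1) (arr_expr 6 new_position_expr) Proc ;;
     Pardo (Reg 0) (Const 1) (arr_expr 7 Proc) (Load (Reg 9 \<oplus> Load (arr_expr 6 Proc)))"

context level
begin

abbreviation F' :: "nat \<Rightarrow> nat list" where "F' \<equiv> split_block dig d F"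

lemma consts_less: "27 < (2::nat) ^ w"
proof -
  have "64 * 3 \<le> 64 * Z" using Z_ge_3 by simp
  then show ?thesis using Y_bound by linarith
qed

lemma off_F_le: "x \<le> V \<Longrightarrow> off F x \<le> n"
  using off_mono[of x V F] off_V by simp

lemma off_F': "c \<le> d \<Longrightarrow> off F' (x * d + c) = off F x + length (filter (\<lambda>s. dig s < c) (F x))"
  by (rule off_split_block) (use dig_less in auto)

lemma off_F'_V: "off F' (V * d) = n"
  using off_F'[of 0 V] off_V by simp

lemma eval_start:
  assumes "regs R" "input M" "eval w i (R, M) e = x" "x \<le> V"
  shows "eval w i (R, M) (start_expr e) = off F x"
proof -
  have "SP + x < 2 ^ w" using assms(4) SP_le Y_bound by linarith
  then show ?thesis using assms by (simp add: start_expr_def regs_def input_def word_Plus)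
qed

lemma eval_le:
  assumes "regs R" "rank_mem Y (count_le dig xs) M" "eval w i (R, M) cE = c" "eval w i (R, M) jE = j" "c < d" "j \<le> n"
  shows "eval w i (R, M) (le_expr cE jE) = count_le dig xs c j"
  by (rule eval_le_count[OF assms(2) Y_bound assms(5,6) order_trans[OF count_le_bound assms(6)]])
    (use assms in \<open>simp_all add: regs_def\<close>)

lemma eval_lt:
  assumes "regs R" "rank_mem Y (count_le dig xs) M" "eval w i (R, M) cE = c" "eval w i (R, M) jE = j" "c < d" "j \<le> n"
  shows "eval w i (R, M) (lt_expr cE jE) = count_lt dig xs c j"
  by (rule eval_lt_count[OF assms(2) Y_bound assms(5,6)])
    (use assms in \<open>simp_all add: regs_def\<close>)

lemma count_lt_block:
  assumes "x < V" "i \<le> length (F x)"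
  shows "count_lt dig xs c (off F x + i) = count_lt dig xs c (off F x) + length (filter (\<lambda>s. dig s < c) (take i (F x)))"
  unfolding xs_def by (rule count_lt_flat) (use assms in auto)

lemma eval_child_start:
  assumes R: "regs R" and M: "input M" and rk: "rank_mem Y (count_le dig xs) M" and x: "x < V * d"
  shows "eval w x (R, M) child_start_expr = off F' x"
proof -
  have r: "R 2 = d" using R by (simp add: regs_def)
  have d: "x mod d < d" using d_ge_2 by simp
  have V: "x div d < V" using x by (simp add: less_mult_imp_div_less)
  then have V': "x div d + 1 \<le> V" "x div d \<le> V" by simp_all
  have n: "off F (x div d) \<le> n" "off F (x div d + 1) \<le> n" using off_F_le V' by blast+
  have e: "eval w x (R, M) (Proc \<oslash> Reg 2) = x div d" "eval w x (R, M) (Proc \<odot> Reg 2) = x mod d"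
    using r by simp_all
  have e': "eval w x (R, M) (Proc \<oslash> Reg 2 \<oplus> Const 1) = x div d + 1"
    unfolding eval.simps(5)[of w x "(R, M)" Plus] e using V' V_le small w_pos by (simp add: word_Plus)
  have s: "eval w x (R, M) (start_expr (Proc \<oslash> Reg 2)) = off F (x div d)"
    "eval w x (R, M) (start_expr (Proc \<oslash> Reg 2 \<oplus> Const 1)) = off F (x div d + 1)"
    by (rule eval_start[OF R M e(1) V'(2)], rule eval_start[OF R M e' V'(1)])
  have l: "eval w x (R, M) (lt_expr (Proc \<odot> Reg 2) (start_expr (Proc \<oslash> Reg 2))) = count_lt dig xs (x mod d) (off F (x div d))"
    "eval w x (R, M) (lt_expr (Proc \<odot> Reg 2) (start_expr (Proc \<oslash> Reg 2 \<oplus> Const 1)))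
      = count_lt dig xs (x mod d) (off F (x div d + 1))"
    by (rule eval_lt[OF R rk e(2) s(1) d n(1)], rule eval_lt[OF R rk e(2) s(2) d n(2)])
  have c: "count_lt dig xs (x mod d) (off F (x div d + 1))
      = count_lt dig xs (x mod d) (off F (x div d)) + length (filter (\<lambda>s. dig s < x mod d) (F (x div d)))"
    using count_lt_block[OF V, of "length (F (x div d))"] by simp
  have "count_lt dig xs (x mod d) (off F (x div d + 1)) \<le> n" using count_lt_bound n le_trans by blast
  then have "off F (x div d) + count_lt dig xs (x mod d) (off F (x div d + 1)) < 2 ^ w" using n small by linarith
  then have "eval w x (R, M) child_start_expr = off F (x div d) + length (filter (\<lambda>s. dig s < x mod d) (F (x div d)))"
    unfolding child_start_expr_def eval.simps(5)[of w x "(R, M)" Plus] eval.simps(5)[of w x "(R, M)" Minus] s l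
    using c by (simp add: word_Plus word_Minus)
  then show ?thesis using off_F'[of "x mod d" "x div d"] d by simp
qed

definition children_mem :: "mem \<Rightarrow> bool" where
  "children_mem M \<longleftrightarrow>
     (1 < D \<longrightarrow> (\<forall>x \<le> V * d. M (Y + 8 * Z + x) = off F' x) \<and>
        (\<forall>x < V * d. M (Y + 9 * Z + x) = (if F' x = [] then 0 else Y + 27 * Z + x * 5))) \<and>
     (D = 1 \<longrightarrow> (\<forall>x<d. M (Y + 9 * Z + x) = 0))"

lemma runs_children_phase:
  assumes R: "regs R" and M: "input M" and rk: "rank_mem Y (count_le dig xs) M"
  obtains R' M' where "runs w Z (H + 1) children_phase (R, M) 1000 (R', M')" and "regs R'"
    and "children_mem M'" and "\<And>x. x < Y + 8 * Z \<or> Y + 10 * Z \<le> x \<Longrightarrow> M' x = M x"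
proof -
  have Z1: "1 \<le> Z" using Z_ge_3 by simp
  define U where "U = (if 1 < D then V * d else d)"
  define R1 where "R1 = R(18 := U)"
  have R1: "regs R1" "R1 18 = U" using R by (simp_all add: R1_def)
  have U: "U < Z" using V_next nd_Z n_pos d_ge_2 unfolding U_def by (auto split: if_splits intro: le_less_trans)
  have D: "eval w i (Q, N) (Const 1 \<lhd> Reg 12) = of_bool (1 < D)" if "regs Q" for i Q N
    using that w_pos by (simp add: regs_def word_LessThan)
  have "eval w 0 (R, M) (Reg 8 \<otimes> Reg 2) = U" if "1 < D"
    using R that V_next[OF that] small by (simp add: regs_def U_def word_Times)
  then have "runs w Z (H + 1) (if eval w 0 (R, M) (Const 1 \<lhd> Reg 12) \<noteq> 0 then Assign 18 (Reg 8 \<otimes> Reg 2) else Assign 18 (Reg 2))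
      (R, M) 4 (R1, M)"
    unfolding R1_def D[OF R]
    by (cases "1 < D"; simp, intro runs_Assign) (use Z1 R in \<open>simp_all add: U_def regs_def\<close>)
  then have 1: "runs w Z (H + 1) (If (Const 1 \<lhd> Reg 12) (Assign 18 (Reg 8 \<otimes> Reg 2)) (Assign 18 (Reg 2))) (R, M) 10 (R1, M)"
    by (rule runs_If) (use Z1 in simp_all)
  obtain M2 where 2: "runs w Z (H + 1) (Pardo (Reg 18) (Const 1) (arr_expr 8 Proc) child_start_expr) (R1, M) 300 (R1, M2)"
    and M2: "\<And>i. i < U \<Longrightarrow> M2 (Y + 8 * Z + i) = eval w i (R1, M) child_start_expr"
    and fr2: "\<And>x. x < Y + 8 * Z \<or> Y + 8 * Z + U \<le> x \<Longrightarrow> M2 x = M x"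
    by (rule runs_array[OF R1(1), of M "Reg 18" U 8 child_start_expr 300])
      (use R1 U in \<open>simp_all add: child_start_expr_def lt_count_def start_expr_def\<close>)
  obtain M3 where 3: "runs w Z (H + 1) (Pardo (Const 1) (Const 1) (arr_expr 8 (Reg 18)) (Reg 0)) (R1, M2) 12 (R1, M3)"
    and M3: "M3 (Y + 8 * Z + U) = n" and fr3: "\<And>x. x \<noteq> Y + 8 * Z + U \<Longrightarrow> M3 x = M2 x"
  proof -
    have a: "eval w i (R1, M2) (arr_expr 8 (Reg 18)) = Y + 8 * Z + U" for i
      by (rule eval_arr_regs[OF R1(1)]) (use R1 U in simp_all)
    obtain M3 where *: "runs w Z (H + 1) (Pardo (Const 1) (Const 1) (arr_expr 8 (Reg 18)) (Reg 0)) (R1, M2)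
        (cost (Const 1) + cost (arr_expr 8 (Reg 18)) + cost (Reg 0) + 3) (R1, M3)"
      "\<And>i. i < 1 \<Longrightarrow> M3 (Y + 8 * Z + U + i) = eval w i (R1, M2) (Reg 0)"
      "\<And>x. x < Y + 8 * Z + U \<or> Y + 8 * Z + U + 1 \<le> x \<Longrightarrow> M3 x = M2 x"
      by (rule runs_Pardo_array[of Z "H + 1" w R1 M2 "Const 1" 1 "arr_expr 8 (Reg 18)" "Y + 8 * Z + U" "Reg 0"])
        (use Z1 w_pos a in auto)
    show thesis
    proof (rule that[OF runs_mono[OF *(1)]])
      show "M3 (Y + 8 * Z + U) = n" using *(2)[of 0] R1(1) by (simp add: regs_def)
      show "M3 x = M2 x" if "x \<noteq> Y + 8 * Z + U" for x
        by (rule *(3)) (use that in linarith)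
    qed simp
  qed
  obtain M4 where 4: "runs w Z (H + 1) (Pardo (Reg 18) (Const 1) (arr_expr 9 Proc) child_pointer_expr) (R1, M3) 100 (R1, M4)"
    and M4: "\<And>i. i < U \<Longrightarrow> M4 (Y + 9 * Z + i) = eval w i (R1, M3) child_pointer_expr"
    and fr4: "\<And>x. x < Y + 9 * Z \<or> Y + 9 * Z + U \<le> x \<Longrightarrow> M4 x = M3 x"
    by (rule runs_array[OF R1(1), of M3 "Reg 18" U 9 child_pointer_expr 100])
      (use R1 U in \<open>simp_all add: child_pointer_expr_def\<close>)
  have "children_mem M4"
    unfolding children_mem_def
  proof (intro conjI impI allI)
    assume D1: "1 < D"
    then have UV: "U = V * d" by (simp add: U_def)
    have st: "M3 (Y + 8 * Z + x) = off F' x" if "x \<le> V * d" for x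
    proof (cases "x = V * d")
      case True
      then show ?thesis using M3 UV off_F'_V by simp
    next
      case False
      then have "x < U" using that UV by simp
      then have "M3 (Y + 8 * Z + x) = eval w x (R1, M) child_start_expr" using fr3 M2 by simp
      then show ?thesis using eval_child_start[OF R1(1) M rk] \<open>x < U\<close> UV by simp
    qed
    show "M4 (Y + 8 * Z + x) = off F' x" if "x \<le> V * d" for x
      using st[OF that] fr4[of "Y + 8 * Z + x"] that UV U by simp
    fix x assume x: "x < V * d"
    then have xU: "x < U" "x < n" using UV V_next[OF D1] by simp_all
    have x1: "eval w x (R1, M3) (Proc \<oplus> Const 1) = x + 1"
      using xU small w_pos by (simp add: word_Plus)
    have a: "eval w x (R1, M3) (arr_expr 8 Proc) = Y + 8 * Z + x"
      "eval w x (R1, M3) (arr_expr 8 (Proc \<oplus> Const 1)) = Y + 8 * Z + (x + 1)"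
      by (rule eval_arr_regs[OF R1(1)]; use x1 xU U in simp)+
    have x5: "x * 5 \<le> 16 * Z" using xU U by linarith
    have "eval w x (R1, M3) (Proc \<otimes> Const 5) = x * 5"
      using x5 Y_bound consts_less by (simp add: word_Times eval_Const)
    then have b: "eval w x (R1, M3) (arr_expr 27 (Proc \<otimes> Const 5)) = Y + 27 * Z + x * 5"
      by (rule eval_arr_regs[OF R1(1)]) (use x5 in simp_all)
    have lt: "eval w x (R1, M3) (Load (arr_expr 8 Proc) \<lhd> Load (arr_expr 8 (Proc \<oplus> Const 1))) = of_bool (F' x \<noteq> [])"
      using a st[of x] st[of "x + 1"] x w_pos by (simp add: word_LessThan)
    have "Y + 27 * Z + x * 5 < 2 ^ w" using xU U Y_bound by linarith
    then have "eval w x (R1, M3) child_pointer_expr = (if F' x = [] then 0 else Y + 27 * Z + x * 5)"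
      unfolding child_pointer_expr_def eval.simps(5)[of w x "(R1, M3)" Times] lt D[OF R1(1)] b
      using D1 by (simp add: word_Times)
    then show "M4 (Y + 9 * Z + x) = (if F' x = [] then 0 else Y + 27 * Z + x * 5)"
      using M4[OF xU(1)] by simp
  next
    fix x assume D1: "D = 1" and x: "x < d"
    have "eval w x (R1, M3) child_pointer_expr = 0"
      unfolding child_pointer_expr_def eval.simps(5)[of w x "(R1, M3)" Times] D[OF R1(1)]
      using D1 by (simp add: word_Times)
    then show "M4 (Y + 9 * Z + x) = 0" using M4[of x] x D1 by (simp add: U_def)
  qed
  moreover have "M4 x = M x" if "x < Y + 8 * Z \<or> Y + 10 * Z \<le> x" for x
    using that fr4[of x] fr3[of x] fr2[of x] U by auto
  moreover have "runs w Z (H + 1) children_phase (R, M) 1000 (R1, M4)"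
    unfolding children_phase_def
    by (rule runs_mono[OF runs_Seq[OF 1 runs_Seq[OF 2 runs_Seq[OF 3 4]]]]) simp
  ultimately show thesis using that R1(1) by blast
qed

lemma position:
  assumes "j < n"
  obtains x i where "x < V" "i < length (F x)" "j = off F x + i" "xs ! j = F x ! i"
proof -
  have "j < off F V" using assms off_V by simp
  then obtain x i where "x < V" "i < length (F x)" "j = off F x + i" by (rule off_decompose)
  then show thesis using that nth_flat[of x V i F] by (simp add: xs_def)
qed

lemma eval_key:
  assumes "regs R" "input M" "x < V" "i < length (F x)"
  shows "eval w (off F x + i) (R, M) key_expr = x"
proof -
  have n: "off F x + i < n" using off_less[of x V i F] assms(3,4) off_V by simp
  have "eval w (off F x + i) (R, M) symbol_expr = F x ! i"
    using eval_symbol[OF assms(1,2) n] nth_flat[of x V i F] assms(3,4) by (simp add: xs_def)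
  moreover have "F x ! i div E = x" using key assms(3,4) by simp
  ultimately show ?thesis
    using assms(1) unfolding key_expr_def eval.simps(5)[of w _ "(R, M)" Divide] by (simp add: regs_def)
qed

lemma eval_key_start:
  assumes "regs R" "input M" "x < V" "i < length (F x)"
  shows "eval w (off F x + i) (R, M) (start_expr key_expr) = off F x"
    and "eval w (off F x + i) (R, M) (start_expr (key_expr \<oplus> Const 1)) = off F (x + 1)"
proof -
  note k = eval_key[OF assms]
  show "eval w (off F x + i) (R, M) (start_expr key_expr) = off F x"
    by (rule eval_start[OF assms(1,2) k]) (use assms in simp)
  have "eval w (off F x + i) (R, M) (key_expr \<oplus> Const 1) = x + 1"
    unfolding eval.simps(5)[of w _ "(R, M)" Plus] k using assms(3) V_le small w_pos by (simp add: word_Plus)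
  then show "eval w (off F x + i) (R, M) (start_expr (key_expr \<oplus> Const 1)) = off F (x + 1)"
    by (rule eval_start[OF assms(1,2)]) (use assms in simp)
qed

lemma eval_new_position:
  assumes R: "regs R" and M: "input M" and rk: "rank_mem Y (count_le dig xs) M" and x: "x < V" and i: "i < length (F x)"
  defines "c \<equiv> dig (F x ! i)"
  shows "eval w (off F x + i) (R, M) new_position_expr
    = off F' (x * d + c) + length (filter (\<lambda>s. dig s = c) (take i (F x)))"
proof -
  let ?j = "off F x + i"
  have n: "?j < n" using off_less[of x V i F] x i off_V by simp
  have c: "eval w ?j (R, M) digit_expr = c"
    using eval_digit[OF R M n] nth_flat[of x V i F] x i by (simp add: c_def xs_def)
  have cd: "c < d" using dig_less by (simp add: c_def)
  have jn: "?j \<le> n" "off F x \<le> n" "off F (x + 1) \<le> n" using n off_F_le[of "x + 1"] x by simp_all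
  note st = eval_key_start[OF R M x i]
  have j: "eval w ?j (R, M) Proc = ?j" by simp
  note l1 = eval_lt[OF R rk c st(2) cd jn(3)] and l2 = eval_lt[OF R rk c j cd jn(1)]
    and l3 = eval_le[OF R rk c j cd jn(1)] and l4 = eval_le[OF R rk c st(1) cd jn(2)]
  let ?lt = "\<lambda>ys. length (filter (\<lambda>s. dig s < c) ys)" and ?eq = "\<lambda>ys. length (filter (\<lambda>s. dig s = c) ys)"
  have a1: "count_lt dig xs c (off F (x + 1)) = count_lt dig xs c (off F x) + ?lt (F x)"
    using count_lt_block[OF x, of "length (F x)"] by simp
  have a2: "count_lt dig xs c ?j = count_lt dig xs c (off F x) + ?lt (take i (F x))"
    by (rule count_lt_block[OF x]) (use i in simp)
  have "length (filter (\<lambda>s. dig s \<le> c) ys) = ?lt ys + ?eq ys" for ys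
    by (induction ys) auto
  then have a3: "count_le dig xs c ?j = count_le dig xs c (off F x) + ?lt (take i (F x)) + ?eq (take i (F x))"
    using count_le_flat[of x V i F dig c] x i by (simp add: xs_def)
  have a4: "?lt (take i (F x)) \<le> ?lt (F x)"
  proof -
    have "?lt (F x) = ?lt (take i (F x)) + ?lt (drop i (F x))"
      by (metis append_take_drop_id filter_append length_append)
    then show ?thesis by simp
  qed
  have b: "count_lt dig xs c (off F (x + 1)) \<le> n" "count_le dig xs c ?j \<le> n"
    using count_lt_bound count_le_bound jn le_trans by blast+
  let ?v1 = "off F x + count_lt dig xs c (off F (x + 1))"
  have v1: "?v1 < 2 ^ w" "count_lt dig xs c ?j \<le> ?v1" "?v1 - count_lt dig xs c ?j = off F x + ?lt (F x) - ?lt (take i (F x))"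
    using b jn small a1 a2 a4 by linarith+
  have v2: "count_le dig xs c (off F x) \<le> count_le dig xs c ?j" "count_le dig xs c ?j < 2 ^ w"
    "count_le dig xs c ?j - count_le dig xs c (off F x) = ?lt (take i (F x)) + ?eq (take i (F x))"
    using a3 b small by linarith+
  have v3: "off F x + ?lt (F x) - ?lt (take i (F x)) + (?lt (take i (F x)) + ?eq (take i (F x))) = off F x + ?lt (F x) + ?eq (take i (F x))"
    using a4 by linarith
  have "off F x + ?lt (F x) - ?lt (take i (F x)) + (?lt (take i (F x)) + ?eq (take i (F x))) < 2 ^ w"
    using v1 v2 a1 b small jn by linarith
  then have "eval w ?j (R, M) new_position_expr = off F x + ?lt (F x) + ?eq (take i (F x))"
    unfolding new_position_expr_def eval.simps(5)[of w _ "(R, M)" Plus] eval.simps(5)[of w _ "(R, M)" Minus] st l1 l2 l3 l4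
    using v1 v2 by (simp only: word_Plus word_Minus v3)
  then show ?thesis using off_F'[of c x] cd by simp
qed

lemma runs_permute_phase:
  assumes R: "regs R" and M: "input M" and rk: "rank_mem Y (count_le dig xs) M"
  obtains M' where "runs w Z (H + 1) permute_phase (R, M) 1000 (R, M')"
    and "\<And>y. y < n \<Longrightarrow> M' (Y + 6 * Z + y) = flat (origin_block dig d F) (V * d) ! y"
    and "\<And>y. y < n \<Longrightarrow> M' (Y + 7 * Z + y) = flat F' (V * d) ! y"
    and "\<And>x. x < Y + 6 * Z \<or> Y + 8 * Z \<le> x \<Longrightarrow> M' x = M x"
proof -
  let ?inv = "flat (origin_block dig d F) (V * d)"
  have Z1: "1 \<le> Z" "n \<le> Z" using Z_ge_3 nd_Z by simp_all
  have R0: "R 0 = n" using R by (simp add: regs_def)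
  define p where "p j = eval w j (R, M) new_position_expr" for j
  \<comment> \<open>The table \<open>?inv\<close> undoes \<open>p\<close>, so \<open>p\<close> is
    injective on the positions below \<open>n\<close> and, mapping them into themselves, onto.
    Injectivity rules out write conflicts; surjectivity means that every cell of the table is
    filled.\<close>
  have p: "p j < n \<and> ?inv ! p j = j" if j: "j < n" for j
  proof -
    obtain x i where xi: "x < V" "i < length (F x)" "j = off F x + i" "xs ! j = F x ! i"
      by (rule position[OF j])
    show ?thesis
      using nth_origin_block[of x V i F "dig (F x ! i)" dig d] eval_new_position[OF R M rk xi(1,2)] xi(3,4) xi(1,2) dig_less off_F'_V
      by (simp add: p_def)
  qed
  have p_onto: "\<exists>j<n. p j = y" if "y < n" for y
  proof -
    have "inj_on p {..<n}" by (rule inj_on_inverseI[of _ "\<lambda>y. ?inv ! y"]) (use p in simp)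
    moreover have "p ` {..<n} \<subseteq> {..<n}" using p by auto
    ultimately have "p ` {..<n} = {..<n}" by (simp add: endo_inj_surj)
    then show ?thesis using that by (metis imageE lessThan_iff)
  qed
  have a: "eval w j (R, M) (arr_expr 6 new_position_expr) = Y + 6 * Z + p j" if "j < n" for j
    by (rule eval_arr_regs[OF R]) (use p[OF that] Z1 in \<open>auto simp: p_def\<close>)
  obtain M1 where 1: "runs w Z (H + 1) (Pardo (Reg 0) (Const 1) (arr_expr 6 new_position_expr) Proc) (R, M)
      (cost (Reg 0) + cost (Const 1) + cost (arr_expr 6 new_position_expr) + cost Proc + 2) (R, M1)"
    and M1: "\<And>i. i < n \<Longrightarrow> M1 (Y + 6 * Z + p i) = i"
    and fr1: "\<And>x. (\<And>i. i < n \<Longrightarrow> x \<noteq> Y + 6 * Z + p i) \<Longrightarrow> M1 x = M x"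
  proof (rule runs_Pardo[of Z "H + 1" w R M "Reg 0" "Const 1" "arr_expr 6 new_position_expr" Proc])
    show "eval w i (R, M) Proc = eval w j (R, M) Proc"
      if "i < eval w 0 (R, M) (Reg 0)" "j < eval w 0 (R, M) (Reg 0)"
        "eval w i (R, M) (arr_expr 6 new_position_expr) = eval w j (R, M) (arr_expr 6 new_position_expr)" for i j
    proof -
      have ij: "i < n" "j < n" using that R0 by simp_all
      then have "p i = p j" using that(3) a by simp
      then show ?thesis using p ij by (metis eval.simps(3))
    qed
  qed (use R0 Z1 w_pos a in auto)
  have inv: "M1 (Y + 6 * Z + y) = ?inv ! y" if "y < n" for y
    using p_onto[OF that] M1 p by metis
  have fr1': "M1 x = M x" if "x < Y + 6 * Z \<or> Y + 7 * Z \<le> x" for x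
    by (rule fr1) (use that p Z1 in fastforce)
  have M1i: "input M1" by (rule input_cong[OF M]) (use fr1' in simp)
  obtain M2 where 2: "runs w Z (H + 1) (Pardo (Reg 0) (Const 1) (arr_expr 7 Proc) (Load (Reg 9 \<oplus> Load (arr_expr 6 Proc)))) (R, M1) 30 (R, M2)"
    and M2: "\<And>i. i < n \<Longrightarrow> M2 (Y + 7 * Z + i) = eval w i (R, M1) (Load (Reg 9 \<oplus> Load (arr_expr 6 Proc)))"
    and fr2: "\<And>x. x < Y + 7 * Z \<or> Y + 7 * Z + n \<le> x \<Longrightarrow> M2 x = M1 x"
    by (rule runs_array[OF R, of M1 "Reg 0" n 7 "Load (Reg 9 \<oplus> Load (arr_expr 6 Proc))" 30])
      (use R0 Z1 in simp_all)
  have next_xs: "M2 (Y + 7 * Z + y) = flat F' (V * d) ! y" if y: "y < n" for y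
  proof -
    have "?inv ! y < n" using p_onto[OF y] p by metis
    moreover have "eval w y (R, M1) (arr_expr 6 Proc) = Y + 6 * Z + y"
      by (rule eval_arr_regs[OF R]) (use y Z1 in simp_all)
    moreover have "XP + ?inv ! y < 2 ^ w" using calculation(1) XP_le Y_bound nd_Z by linarith
    ultimately have "M2 (Y + 7 * Z + y) = xs ! (?inv ! y)"
      using M2[OF y] inv[OF y] M1i R by (simp add: regs_def input_def word_Plus)
    then show ?thesis using flat_split_block[of y dig d F V] y off_F'_V d_ge_2 by (simp add: xs_def)
  qed
  have "M2 (Y + 6 * Z + y) = ?inv ! y" if "y < n" for y
    using inv[OF that] fr2[of "Y + 6 * Z + y"] that Z1 by simp
  moreover have "M2 x = M x" if "x < Y + 6 * Z \<or> Y + 8 * Z \<le> x" for x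
  proof -
    have "M2 x = M1 x" by (rule fr2) (use that Z1 in linarith)
    also have "\<dots> = M x" by (rule fr1') (use that in linarith)
    finally show ?thesis .
  qed
  moreover have "runs w Z (H + 1) permute_phase (R, M) 1000 (R, M2)"
    unfolding permute_phase_def
    by (rule runs_mono[OF runs_Seq[OF 1 2]])
      (simp add: new_position_expr_def lt_count_def start_expr_def key_expr_def digit_expr_def)
  ultimately show thesis using that next_xs by blast
qed

end

section \<open>Packed digit sequences and node records\<close>

definition offset_expr :: expr where "offset_expr = Proc \<ominus> start_expr key_expr"

definition shifted_digit_expr :: expr where
  "shifted_digit_expr = Op ShiftL digit_expr (Reg 5 \<otimes> (offset_expr \<odot> Reg 13))"

text \<open>A minimum without a branch, as a parallel step evaluates the same expression on all
  processors.\<close>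

definition min_expr :: "expr \<Rightarrow> expr \<Rightarrow> expr" where
  "min_expr x y = (x \<lhd> y) \<otimes> x \<oplus> (Const 1 \<ominus> (x \<lhd> y)) \<otimes> y"

text \<open>A word ends after \<open>w div b\<close> entries or at the end of the node, whichever
  comes first, so that no digit of the following node enters it.\<close>

definition word_expr :: expr where
  "word_expr = Load (arr_expr 5 (min_expr (Proc \<oplus> Reg 13) (start_expr (key_expr \<oplus> Const 1)))) \<ominus> Load (arr_expr 5 Proc)"

text \<open>The words of a node start at the cell numbered by its left boundary. A node has at most
  as many words as elements, so nodes do not overlap, and no prefix sum over word counts is
  needed.\<close>

definition word_address_expr :: expr where
  "word_address_expr = arr_expr 10 (start_expr key_expr \<oplus> offset_expr \<oslash> Reg 13)"

definition pack_phase :: com where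
  "pack_phase =
     Pardo (Reg 0) (Const 1) (arr_expr 5 Proc) shifted_digit_expr ;;
     Assign 16 (arr_expr 4 (Const 0)) ;; scan ;;
     Pardo (Reg 0) (Op Equal (offset_expr \<odot> Reg 13) (Const 0)) word_address_expr word_expr"

definition store_field :: "nat \<Rightarrow> expr \<Rightarrow> com" where
  "store_field k v = Pardo (Reg 8) (Const 1) (arr_expr 11 (Proc \<otimes> Const 5 \<oplus> Const k)) v"

text \<open>Field 2 points to the node's own part of the pointer array, except on the last level,
  where the factor 0 directs all nodes to the same null pointers. Fields 3 and 4 let a query recover
  positions in the level.\<close>

definition record_phase :: com where
  "record_phase =
     store_field 0 (start_expr (Proc \<oplus> Const 1) \<ominus> start_expr Proc) ;;
     store_field 1 (arr_expr 10 (start_expr Proc)) ;;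
     store_field 2 (arr_expr 9 ((Const 1 \<lhd> Reg 12) \<otimes> (Proc \<otimes> Reg 2))) ;;
     store_field 3 (start_expr Proc) ;;
     store_field 4 (Reg 11)"

definition level_com :: com where
  "level_com = rank_phase ;; children_phase ;; permute_phase ;; pack_phase ;; record_phase"

lemma eval_min:
  assumes "eval w i s a = x" "eval w i s b = y" "w > 0" "x < 2 ^ w" "y < 2 ^ w"
  shows "eval w i s (min_expr a b) = min x y"
proof -
  have "(1::nat) < 2 ^ w" using assms(3) by (intro one_less_power) auto
  then show ?thesis
    using assms by (auto simp: min_expr_def word_LessThan word_Times word_Plus word_Minus)
qed

context level
begin

lemma entries_pos: "1 \<le> w div b" and entries_le: "b * (w div b) \<le> w" and n_entries_less: "n + w div b < 2 ^ w"
proof -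
  have "b \<le> d * (b + 1)" using d_ge_2 by (metis le_add1 le_trans mult_le_mono1 one_le_numeral mult_1)
  then have "b \<le> w" using bits by simp
  then show "1 \<le> w div b" using b_pos by (metis div_le_mono div_self not_one_le_zero)
  show "b * (w div b) \<le> w" by simp
  have "w div b \<le> w" by simp
  have "w - 1 < 2 ^ (w - 1)" by (rule less_exp)
  moreover have "(2::nat) ^ w = 2 * 2 ^ (w - 1)" using w_pos by (cases w) simp_all
  \<comment> \<open>Half of the word range bounds \<open>w div b\<close>; the other half has room
    for \<open>n\<close>.\<close>
  ultimately have "2 * w \<le> 2 ^ w" by linarith
  then show "n + w div b < 2 ^ w" using \<open>w div b \<le> w\<close> small by linarith
qed

lemma eval_offset:
  assumes "regs R" "input M" "x < V" "i < length (F x)"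
  shows "eval w (off F x + i) (R, M) offset_expr = i"
proof -
  have "off F x + i < n" using off_less[of x V i F] assms(3,4) off_V by simp
  then show ?thesis
    unfolding offset_expr_def eval.simps(5) eval_key_start(1)[OF assms] using small by (simp add: word_Minus)
qed

lemma eval_slot:
  assumes "regs R" "input M" "x < V" "i < length (F x)"
  shows "eval w (off F x + i) (R, M) (offset_expr \<odot> Reg 13) = i mod (w div b)"
  unfolding eval.simps(5)[of w _ _ Modulo] eval_offset[OF assms] using assms(1) by (simp add: regs_def)

lemma eval_shifted_digit:
  assumes "regs R" "input M" "x < V" "i < length (F x)"
  shows "eval w (off F x + i) (R, M) shifted_digit_expr = dig (F x ! i) * 2 ^ (b * (i mod (w div b)))"
proof -
  let ?t = "i mod (w div b)"
  have n: "off F x + i < n" using off_less[of x V i F] assms(3,4) off_V by simp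
  have dg: "eval w (off F x + i) (R, M) digit_expr = dig (F x ! i)"
    using eval_digit[OF assms(1,2) n] nth_flat[of x V i F] assms(3,4) by (simp add: xs_def)
  have "?t < w div b" using entries_pos by simp
  then have "b * ?t + b \<le> b * (w div b)" by (metis Suc_leI add.commute mult_Suc_right mult_le_mono2)
  then have t: "b * ?t + b \<le> w" using entries_le by linarith
  then have bt: "b * ?t < 2 ^ w" using w_less by linarith
  have "eval w (off F x + i) (R, M) (Reg 5 \<otimes> (offset_expr \<odot> Reg 13)) = b * ?t"
    unfolding eval.simps(5)[of w _ _ Times] eval_slot[OF assms] using assms(1) bt by (simp add: regs_def word_Times)
  moreover have "dig (F x ! i) * 2 ^ (b * ?t) < 2 ^ w"
  proof -
    have "dig (F x ! i) * 2 ^ (b * ?t) < 2 ^ b * 2 ^ (b * ?t)" using dig_less d_def by simp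
    also have "\<dots> = 2 ^ (b * ?t + b)" by (simp add: power_add)
    also have "\<dots> \<le> 2 ^ w" using t by (intro power_increasing) auto
    finally show ?thesis .
  qed
  ultimately show ?thesis
    unfolding shifted_digit_expr_def eval.simps(5)[of w _ _ ShiftL] dg by (simp only: word_ShiftL)
qed

text \<open>All digits of one word fit together, so a difference of two prefix sums modulo \<open>2 ^ w\<close> is the word.\<close>

lemma packed_from_words:
  assumes words: "\<And>k. k * (w div b) < length T \<Longrightarrow> M (a + k) = take_bit w
      (\<Sum>i = k * (w div b)..<min (k * (w div b) + w div b) (length T). T ! i * 2 ^ (b * (i mod (w div b))))"
    and T: "\<And>i. i < length T \<Longrightarrow> T ! i < d"
  shows "packed w b M a T"
  unfolding packed_def
proof safe
  fix i assume i: "i < length T"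
  define e where "e = w div b"
  have e: "1 \<le> e" "b * e \<le> w" using entries_pos entries_le by (simp_all add: e_def)
  define k where "k = i div e"
  define m where "m = min e (length T - k * e)"
  have ki: "k * e \<le> i" "i = k * e + i mod e" by (simp_all add: k_def)
  have te: "i mod e < e" using e by simp
  then have tm: "i mod e < m" using i ki unfolding m_def by linarith
  have me: "m \<le> e" by (simp add: m_def)
  \<comment> \<open>The value 0 from \<open>m\<close> on makes the bound \<open>2 ^ b\<close> hold
    for every index, also past the end of a partly filled last word.\<close>
  define g where "g t = (if t < m then T ! (k * e + t) else 0)" for t
  have g: "g t < 2 ^ b" for t using T d_def unfolding g_def m_def by auto
  have "M (a + k) = take_bit w (\<Sum>i = k * e..<k * e + m. T ! i * 2 ^ (b * (i mod e)))"
  proof -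
    have "k * e < length T" using i ki by linarith
    moreover have "min (k * e + e) (length T) = k * e + m" using calculation unfolding m_def by linarith
    ultimately show ?thesis using words[of k] by (simp add: e_def)
  qed
  also have "(\<Sum>i = k * e..<k * e + m. T ! i * 2 ^ (b * (i mod e))) = (\<Sum>t<m. g t * (2 ^ b) ^ t)"
  proof -
    have "(\<Sum>i = k * e..<k * e + m. T ! i * 2 ^ (b * (i mod e))) = (\<Sum>t = 0..<m. T ! (t + k * e) * 2 ^ (b * ((t + k * e) mod e)))"
      using sum.shift_bounds_nat_ivl[of "\<lambda>i. T ! i * 2 ^ (b * (i mod e))" 0 "k * e" m] by (simp add: add.commute)
    also have "\<dots> = (\<Sum>t<m. g t * (2 ^ b) ^ t)"
      unfolding atLeast0LessThan by (rule sum.cong) (use me in \<open>auto simp: g_def power_mult add.commute\<close>)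
    finally show ?thesis .
  qed
  also have "take_bit w (\<Sum>t<m. g t * (2 ^ b) ^ t) = (\<Sum>t<m. g t * (2 ^ b) ^ t)"
  proof -
    have "(\<Sum>t<m. g t * (2 ^ b) ^ t) < (2 ^ b) ^ m" by (rule sum_digits_less) (rule g)
    also have "\<dots> = 2 ^ (b * m)" by (simp add: power_mult)
    also have "\<dots> \<le> 2 ^ w"
    proof (rule power_increasing)
      have "b * m \<le> b * e" using me by (rule mult_le_mono2)
      then show "b * m \<le> w" using e by linarith
    qed simp
    finally show ?thesis by (simp add: take_bit_nat_eq_self)
  qed
  finally have Mk: "M (a + k) = (\<Sum>t<m. g t * (2 ^ b) ^ t)" .
  have "take_bit b (drop_bit (b * (i mod e)) (M (a + k))) = (\<Sum>t<m. g t * (2 ^ b) ^ t) div (2 ^ b) ^ (i mod e) mod 2 ^ b"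
    unfolding Mk by (simp add: take_bit_eq_mod drop_bit_eq_div power_mult)
  also have "\<dots> = g (i mod e)" by (rule nth_digit_sum) (use g tm in auto)
  also have "\<dots> = T ! i" using tm ki(2) by (simp add: g_def)
  finally show "T ! i = take_bit b (drop_bit (b * (i mod (w div b))) (M (a + i div (w div b))))"
    by (simp add: e_def k_def)
qed

lemma runs_pack_phase:
  assumes R: "regs R" and M: "input M"
  obtains R' M' where "runs w Z (H + 1) pack_phase (R, M) 1000 (R', M')" and "regs R'"
    and "\<And>x. x < V \<Longrightarrow> packed w b M' (Y + 10 * Z + off F x) (map dig (F x))"
    and "\<And>x. x < Y + 4 * Z \<or> (Y + 6 * Z \<le> x \<and> x < Y + 10 * Z) \<or> Y + 11 * Z \<le> x \<Longrightarrow> M' x = M x"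
proof -
  define e where "e = w div b"
  have e1: "1 \<le> e" using entries_pos by (simp add: e_def)
  have Z1: "1 \<le> Z" "n \<le> Z" "n < Z" using Z_ge_3 nd_Z d_ge_2 by linarith+
  have R0: "R 0 = n" using R by (simp add: regs_def)
  obtain M1 where 1: "runs w Z (H + 1) (Pardo (Reg 0) (Const 1) (arr_expr 5 Proc) shifted_digit_expr) (R, M) 100 (R, M1)"
    and M1: "\<And>i. i < n \<Longrightarrow> M1 (Y + 5 * Z + i) = eval w i (R, M) shifted_digit_expr"
    and fr1: "\<And>x. x < Y + 5 * Z \<or> Y + 5 * Z + n \<le> x \<Longrightarrow> M1 x = M x"
    by (rule runs_array[OF R, of M "Reg 0" n 5 shifted_digit_expr 100])
      (use R0 Z1 in \<open>simp_all add: shifted_digit_expr_def offset_expr_def start_expr_def key_expr_def digit_expr_def\<close>)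
  have "eval w 0 (R, M1) (arr_expr 4 (Const 0)) = Y + 4 * Z + 0"
    by (rule eval_arr_regs[OF R]) simp_all
  then have 2: "runs w Z (H + 1) (Assign 16 (arr_expr 4 (Const 0))) (R, M1) 10 (R(16 := Y + 4 * Z), M1)"
    by (intro runs_Assign) (use Z1 in simp_all)
  obtain R3 M3 where 3: "runs w Z (H + 1) scan (R(16 := Y + 4 * Z), M1) 500 (R3, M3)" and R3: "regs R3"
    and M3: "\<And>j. j < Z \<Longrightarrow> M3 (Y + (4 + 1) * Z + j) = take_bit w (\<Sum>i<j. M1 (Y + (4 + 1) * Z + i))"
    and fr3: "\<And>x. x < Y + 4 * Z \<or> Y + (4 + 2) * Z \<le> x \<Longrightarrow> M3 x = M1 x"
    by (rule runs_scan_regs[of "R(16 := Y + 4 * Z)" 4 M1]) (use R in simp_all)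
  have fr3': "M3 x = M x" if "x < Y + 4 * Z \<or> Y + 6 * Z \<le> x" for x
    using that fr3[of x] fr1[of x] Z1 by auto
  have M3i: "input M3" by (rule input_cong[OF M]) (use fr3' in simp)
  have R30: "R3 0 = n" "R3 13 = e" using R3 by (simp_all add: regs_def e_def)
  let ?g = "Op Equal (offset_expr \<odot> Reg 13) (Const 0)"
  have guard: "eval w (off F x + i) (R3, M3) ?g = of_bool (i mod e = 0)" if "x < V" "i < length (F x)" for x i
    unfolding eval.simps(5)[of w _ _ Equal] eval_slot[OF R3 M3i that] using w_pos by (simp add: word_Equal e_def)
  have addr: "eval w (off F x + i) (R3, M3) word_address_expr = Y + 10 * Z + (off F x + i div e)"
    if "x < V" "i < length (F x)" for x i
    unfolding word_address_expr_def
  proof (rule eval_arr_regs[OF R3])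
    have "off F x + i < n" using off_less[of x V i F] that off_V by simp
    moreover have "i div e \<le> i" by simp
    ultimately have l: "off F x + i div e \<le> n" by linarith
    then show "off F x + i div e \<le> 16 * Z" using Z1 by linarith
    have "eval w (off F x + i) (R3, M3) (offset_expr \<oslash> Reg 13) = i div e"
      unfolding eval.simps(5)[of w _ _ Divide] eval_offset[OF R3 M3i that] using R30 by simp
    then show "eval w (off F x + i) (R3, M3) (start_expr key_expr \<oplus> offset_expr \<oslash> Reg 13) = off F x + i div e"
      using l small unfolding eval.simps(5)[of w _ _ Plus] eval_key_start(1)[OF R3 M3i that]
      by (simp add: word_Plus)
  qed simp
  obtain M4 where 4: "runs w Z (H + 1) (Pardo (Reg 0) ?g word_address_expr word_expr) (R3, M3)
      (cost (Reg 0) + cost ?g + cost word_address_expr + cost word_expr + 2) (R3, M4)"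
    and M4: "\<And>i. i < eval w 0 (R3, M3) (Reg 0) \<Longrightarrow> eval w i (R3, M3) ?g \<noteq> 0 \<Longrightarrow>
       M4 (eval w i (R3, M3) word_address_expr) = eval w i (R3, M3) word_expr"
    and fr4: "\<And>x. (\<And>i. i < eval w 0 (R3, M3) (Reg 0) \<Longrightarrow> eval w i (R3, M3) ?g \<noteq> 0 \<Longrightarrow> x \<noteq> eval w i (R3, M3) word_address_expr) \<Longrightarrow> M4 x = M3 x"
  proof (rule runs_Pardo[of Z "H + 1" w R3 M3 "Reg 0" ?g word_address_expr word_expr])
    fix j j'
    assume j: "j < eval w 0 (R3, M3) (Reg 0)" "eval w j (R3, M3) ?g \<noteq> 0"
      and j': "j' < eval w 0 (R3, M3) (Reg 0)" "eval w j' (R3, M3) ?g \<noteq> 0"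
      and eq: "eval w j (R3, M3) word_address_expr = eval w j' (R3, M3) word_address_expr"
    have "j < n" "j' < n" using j j' R30 by simp_all
    obtain x i where x: "x < V" "i < length (F x)" "j = off F x + i" "xs ! j = F x ! i"
      by (rule position[OF \<open>j < n\<close>])
    obtain x' i' where x': "x' < V" "i' < length (F x')" "j' = off F x' + i'" "xs ! j' = F x' ! i'"
      by (rule position[OF \<open>j' < n\<close>])
    have m: "i mod e = 0" "i' mod e = 0" using j(2) j'(2) guard[OF x(1,2)] guard[OF x'(1,2)] x(3) x'(3) by simp_all
    have "off F x + i div e = off F x' + i' div e"
      using eq addr[OF x(1,2)] addr[OF x'(1,2)] x(3) x'(3) by simp
    moreover have "i div e < length (F x)" "i' div e < length (F x')"
      using x(2) x'(2) by (meson div_le_dividend le_less_trans)+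
    \<comment> \<open>Word numbers are smaller than block lengths, so equal addresses force the same
      node and the same word. The guard admits only the first position of a word, hence the
      processors coincide.\<close>
    ultimately have "x = x' \<and> i div e = i' div e" by (rule off_inj)
    moreover have "i = i div e * e" "i' = i' div e * e"
      using m div_mult_mod_eq[of i e] div_mult_mod_eq[of i' e] by simp_all
    ultimately have "j = j'" using x(3) x'(3) by metis
    then show "eval w j (R3, M3) word_expr = eval w j' (R3, M3) word_expr" by simp
  qed (use Z1 R30 in auto)
  have P: "M3 (Y + 5 * Z + j) = take_bit w (\<Sum>i<j. M1 (Y + 5 * Z + i))" if "j \<le> n" for j
    using M3[of j] that Z1 by simp
  have pk: "packed w b M4 (Y + 10 * Z + off F x) (map dig (F x))" if x: "x < V" for x
  proof (rule packed_from_words)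
    let ?l = "length (F x)"
    fix k assume "k * (w div b) < length (map dig (F x))"
    then have k: "k * e < ?l" by (simp add: e_def)
    let ?i = "k * e" and ?m = "min (k * e + e) ?l"
    let ?j = "off F x + ?i"
    have jn: "?j < n" using off_less[of x V ?i F] x k off_V by simp
    have on: "off F (x + 1) \<le> n" by (rule off_F_le) (use x in simp)
    have mi: "min (?j + e) (off F (x + 1)) = off F x + ?m" by simp
    have mn: "off F x + ?m \<le> n" using on by simp
    have "eval w ?j (R3, M3) (min_expr (Proc \<oplus> Reg 13) (start_expr (key_expr \<oplus> Const 1))) = off F x + ?m"
      unfolding mi[symmetric]
    proof (rule eval_min)
      have s: "?j + e < 2 ^ w" using n_entries_less jn by (simp add: e_def)
      then show "eval w ?j (R3, M3) (Proc \<oplus> Reg 13) = ?j + e" using R30 by (simp add: word_Plus)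
      show "eval w ?j (R3, M3) (start_expr (key_expr \<oplus> Const 1)) = off F (x + 1)"
        by (rule eval_key_start(2)[OF R3 M3i x k])
      show "?j + e < 2 ^ w" by (rule s)
      show "off F (x + 1) < 2 ^ w" using on small by linarith
    qed (rule w_pos)
    then have a1: "eval w ?j (R3, M3) (arr_expr 5 (min_expr (Proc \<oplus> Reg 13) (start_expr (key_expr \<oplus> Const 1))))
        = Y + 5 * Z + (off F x + ?m)"
      by (rule eval_arr_regs[OF R3]) (use mn Z1 in linarith)+
    have a2: "eval w ?j (R3, M3) (arr_expr 5 Proc) = Y + 5 * Z + ?j"
      by (rule eval_arr_regs[OF R3]) (use jn Z1 in simp_all)
    have "M4 (Y + 10 * Z + (off F x + k)) = eval w ?j (R3, M3) word_expr"
      using M4[of ?j] guard[OF x k] addr[OF x k] jn R30 e1 by simp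
    also have "\<dots> = word_op w Minus (M3 (Y + 5 * Z + (off F x + ?m))) (M3 (Y + 5 * Z + ?j))"
      unfolding word_expr_def eval.simps(5)[of w _ _ Minus] eval.simps(4) a1 a2 by simp
    also have "\<dots> = take_bit w (\<Sum>i = ?j..<off F x + ?m. M1 (Y + 5 * Z + i))"
      using P[of "off F x + ?m"] P[of ?j] mn jn k by (simp add: word_Minus_sums)
    also have "(\<Sum>i = ?j..<off F x + ?m. M1 (Y + 5 * Z + i)) = (\<Sum>i = ?i..<?m. M1 (Y + 5 * Z + (off F x + i)))"
      using sum.shift_bounds_nat_ivl[of "\<lambda>i. M1 (Y + 5 * Z + i)" ?i "off F x" ?m] by (simp only: add.commute)
    also have "\<dots> = (\<Sum>i = ?i..<?m. map dig (F x) ! i * 2 ^ (b * (i mod e)))"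
    proof (rule sum.cong)
      fix i assume "i \<in> {?i..<?m}"
      then have i: "i < ?l" by simp
      have "off F x + i < n" using off_less[of x V i F] x i off_V by simp
      then show "M1 (Y + 5 * Z + (off F x + i)) = map dig (F x) ! i * 2 ^ (b * (i mod e))"
        using M1 eval_shifted_digit[OF R M x i] i by (simp add: e_def)
    qed simp
    finally show "M4 (Y + 10 * Z + off F x + k) = take_bit w
      (\<Sum>i = k * (w div b)..<min (k * (w div b) + w div b) (length (map dig (F x))). map dig (F x) ! i * 2 ^ (b * (i mod (w div b))))"
      by (simp add: e_def add.assoc)
  next
    show "map dig (F x) ! i < d" if "i < length (map dig (F x))" for i
      using that dig_less by simp
  qed
  have "M4 x = M x" if x: "x < Y + 4 * Z \<or> (Y + 6 * Z \<le> x \<and> x < Y + 10 * Z) \<or> Y + 11 * Z \<le> x" for x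
  proof -
    have "M4 x = M3 x"
    proof (rule fr4)
      fix j assume "j < eval w 0 (R3, M3) (Reg 0)"
      then have "j < n" using R30 by simp
      then obtain y i where y: "y < V" "i < length (F y)" "j = off F y + i" "xs ! j = F y ! i"
        by (rule position)
      have "i div e \<le> i" by simp
      then have "off F y + i div e < Z" using y(3) \<open>j < n\<close> Z1 by linarith
      then show "x \<noteq> eval w j (R3, M3) word_address_expr"
        using addr[OF y(1,2)] x y(3) by auto
    qed
    then show ?thesis using fr3'[of x] x by auto
  qed
  moreover have "runs w Z (H + 1) pack_phase (R, M) 1000 (R3, M4)"
    unfolding pack_phase_def
    by (rule runs_mono[OF runs_Seq[OF 1 runs_Seq[OF 2 runs_Seq[OF 3 4]]]])
      (simp add: word_expr_def word_address_expr_def offset_expr_def start_expr_def key_expr_def min_expr_def)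
  ultimately show thesis using that R3 pk by blast
qed

lemma runs_store_field:
  assumes R: "regs R" and k: "k < 5" and "cost v \<le> 30"
  obtains M' where "runs w Z (H + 1) (store_field k v) (R, M) 60 (R, M')"
    and "\<And>x. x < V \<Longrightarrow> M' (Y + 11 * Z + (x * 5 + k)) = eval w x (R, M) v"
    and "\<forall>a. (\<forall>x<V. a \<noteq> Y + 11 * Z + (x * 5 + k)) \<longrightarrow> M' a = M a"
proof -
  have Z1: "1 \<le> Z" "V < Z" using Z_ge_3 nd_Z V_le d_ge_2 by linarith+
  have R8: "R 8 = V" using R by (simp add: regs_def)
  have a: "eval w x (R, M) (arr_expr 11 (Proc \<otimes> Const 5 \<oplus> Const k)) = Y + 11 * Z + (x * 5 + k)" if "x < V" for x
  proof (rule eval_arr_regs[OF R])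
    have "x * 5 + k < 2 ^ w" using that Z1 k Y_bound by linarith
    then show "eval w x (R, M) (Proc \<otimes> Const 5 \<oplus> Const k) = x * 5 + k"
      using k consts_less by (simp add: eval_Const word_Plus word_Times)
  qed (use that Z1 k in auto)
  obtain M' where *: "runs w Z (H + 1) (store_field k v) (R, M)
     (cost (Reg 8) + cost (Const 1) + cost (arr_expr 11 (Proc \<otimes> Const 5 \<oplus> Const k)) + cost v + 2) (R, M')"
    "\<And>i. i < V \<Longrightarrow> M' (Y + 11 * Z + (i * 5 + k)) = eval w i (R, M) v"
    "\<And>x. (\<And>i. i < V \<Longrightarrow> x \<noteq> Y + 11 * Z + (i * 5 + k)) \<Longrightarrow> M' x = M x"
    unfolding store_field_def
    by (rule runs_Pardo[of Z "H + 1" w R M "Reg 8" "Const 1" "arr_expr 11 (Proc \<otimes> Const 5 \<oplus> Const k)" v])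
      (use Z1 R8 w_pos a in auto)
  show thesis
    by (rule that[OF runs_mono[OF *(1)] *(2)]) (use assms(3) *(3) in simp_all)
qed

definition record_mem :: "mem \<Rightarrow> bool" where
  "record_mem M \<longleftrightarrow> (\<forall>x<V. M (Y + 11 * Z + x * 5) = length (F x) \<and>
     M (Y + 11 * Z + x * 5 + 1) = Y + 10 * Z + off F x \<and>
     M (Y + 11 * Z + x * 5 + 2) = Y + 9 * Z + of_bool (1 < D) * (x * d) \<and>
     M (Y + 11 * Z + x * 5 + 3) = off F x \<and> M (Y + 11 * Z + x * 5 + 4) = Y)"

lemma runs_record_phase:
  assumes R: "regs R" and M: "input M"
  obtains M' where "runs w Z (H + 1) record_phase (R, M) 300 (R, M')" and "record_mem M'"
    and "\<And>a. a < Y + 11 * Z \<or> Y + 16 * Z \<le> a \<Longrightarrow> M' a = M a"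
proof -
  have Z1: "1 \<le> Z" "V < Z" "n < Z" using Z_ge_3 nd_Z V_le d_ge_2 by linarith+
  have frame: "N' a = N a" if "\<forall>a. (\<forall>x<V. a \<noteq> Y + 11 * Z + (x * 5 + k)) \<longrightarrow> N' a = N a" "k < 5"
    "a < Y + 11 * Z \<or> Y + 16 * Z \<le> a" for N N' :: mem and k a
  proof -
    have "a \<noteq> Y + 11 * Z + (x * 5 + k)" if "x < V" for x
      using that \<open>k < 5\<close> \<open>a < Y + 11 * Z \<or> Y + 16 * Z \<le> a\<close> Z1 by linarith
    then show ?thesis using that(1) by blast
  qed
  \<comment> \<open>Relative to the start of the records, different fields lie in different residue
    classes modulo 5, so writing one field leaves the others alone.\<close>
  have other: "N' (Y + 11 * Z + (x * 5 + l)) = N (Y + 11 * Z + (x * 5 + l))"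
    if "\<forall>a. (\<forall>x<V. a \<noteq> Y + 11 * Z + (x * 5 + k)) \<longrightarrow> N' a = N a" "k < 5" "l < 5" "k \<noteq> l" for N N' :: mem and k l x
  proof -
    have "Y + 11 * Z + (x * 5 + l) \<noteq> Y + 11 * Z + (y * 5 + k)" for y
      using that(2-) by presburger
    then show ?thesis using that(1) by blast
  qed
  have st: "eval w x (R, N) (start_expr Proc) = off F x" "eval w x (R, N) (start_expr (Proc \<oplus> Const 1)) = off F (x + 1)"
    if "input N" "x < V" for N x
  proof -
    show "eval w x (R, N) (start_expr Proc) = off F x" by (rule eval_start[OF R that(1)]) (use that in simp_all)
    have "eval w x (R, N) (Proc \<oplus> Const 1) = x + 1" using that V_le small w_pos by (simp add: word_Plus)
    then show "eval w x (R, N) (start_expr (Proc \<oplus> Const 1)) = off F (x + 1)"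
      by (rule eval_start[OF R that(1)]) (use that in simp)
  qed
  obtain M0 where 0: "runs w Z (H + 1) (store_field 0 (start_expr (Proc \<oplus> Const 1) \<ominus> start_expr Proc)) (R, M) 60 (R, M0)"
    and M0: "\<And>x. x < V \<Longrightarrow> M0 (Y + 11 * Z + (x * 5 + 0)) = eval w x (R, M) (start_expr (Proc \<oplus> Const 1) \<ominus> start_expr Proc)"
    and fr0: "\<forall>a. (\<forall>x<V. a \<noteq> Y + 11 * Z + (x * 5 + 0)) \<longrightarrow> M0 a = M a"
    using runs_store_field[OF R, of 0 "start_expr (Proc \<oplus> Const 1) \<ominus> start_expr Proc" M] by (auto simp: start_expr_def)
  note f0 = frame[where N' = M0 and N = M and k = 0, OF fr0] and o0 = other[where N' = M0 and N = M and k = 0, OF fr0]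
  have I0: "input M0" by (rule input_cong[OF M]) (use f0 in simp)
  obtain M1 where 1: "runs w Z (H + 1) (store_field 1 (arr_expr 10 (start_expr Proc))) (R, M0) 60 (R, M1)"
    and M1: "\<And>x. x < V \<Longrightarrow> M1 (Y + 11 * Z + (x * 5 + 1)) = eval w x (R, M0) (arr_expr 10 (start_expr Proc))"
    and fr1: "\<forall>a. (\<forall>x<V. a \<noteq> Y + 11 * Z + (x * 5 + 1)) \<longrightarrow> M1 a = M0 a"
    using runs_store_field[OF R, of 1 "arr_expr 10 (start_expr Proc)" M0] by (auto simp: start_expr_def)
  note f1 = frame[where N' = M1 and N = M0 and k = 1, OF fr1] and o1 = other[where N' = M1 and N = M0 and k = 1, OF fr1]
  have I1: "input M1" by (rule input_cong[OF I0]) (use f1 in simp)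
  let ?p = "arr_expr 9 ((Const 1 \<lhd> Reg 12) \<otimes> (Proc \<otimes> Reg 2))"
  obtain M2 where 2: "runs w Z (H + 1) (store_field 2 ?p) (R, M1) 60 (R, M2)"
    and M2: "\<And>x. x < V \<Longrightarrow> M2 (Y + 11 * Z + (x * 5 + 2)) = eval w x (R, M1) ?p"
    and fr2: "\<forall>a. (\<forall>x<V. a \<noteq> Y + 11 * Z + (x * 5 + 2)) \<longrightarrow> M2 a = M1 a"
    using runs_store_field[OF R, of 2 ?p M1] by (auto simp: start_expr_def)
  note f2 = frame[where N' = M2 and N = M1 and k = 2, OF fr2] and o2 = other[where N' = M2 and N = M1 and k = 2, OF fr2]
  have I2: "input M2" by (rule input_cong[OF I1]) (use f2 in simp)
  obtain M3 where 3: "runs w Z (H + 1) (store_field 3 (start_expr Proc)) (R, M2) 60 (R, M3)"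
    and M3: "\<And>x. x < V \<Longrightarrow> M3 (Y + 11 * Z + (x * 5 + 3)) = eval w x (R, M2) (start_expr Proc)"
    and fr3: "\<forall>a. (\<forall>x<V. a \<noteq> Y + 11 * Z + (x * 5 + 3)) \<longrightarrow> M3 a = M2 a"
    using runs_store_field[OF R, of 3 "start_expr Proc" M2] by (auto simp: start_expr_def)
  note f3 = frame[where N' = M3 and N = M2 and k = 3, OF fr3] and o3 = other[where N' = M3 and N = M2 and k = 3, OF fr3]
  obtain M4 where 4: "runs w Z (H + 1) (store_field 4 (Reg 11)) (R, M3) 60 (R, M4)"
    and M4: "\<And>x. x < V \<Longrightarrow> M4 (Y + 11 * Z + (x * 5 + 4)) = eval w x (R, M3) (Reg 11)"
    and fr4: "\<forall>a. (\<forall>x<V. a \<noteq> Y + 11 * Z + (x * 5 + 4)) \<longrightarrow> M4 a = M3 a"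
    using runs_store_field[OF R, of 4 "Reg 11" M3] by (auto simp: start_expr_def)
  note f4 = frame[where N' = M4 and N = M3 and k = 4, OF fr4] and o4 = other[where N' = M4 and N = M3 and k = 4, OF fr4]
  have "record_mem M4"
    unfolding record_mem_def
  proof (intro allI impI conjI)
    fix x assume x: "x < V"
    have ox: "off F x \<le> n" "off F (x + 1) \<le> n" by (rule off_F_le, use x in simp)+
    have "M4 (Y + 11 * Z + (x * 5 + 0)) = eval w x (R, M) (start_expr (Proc \<oplus> Const 1) \<ominus> start_expr Proc)"
      using o4[of 0 x] o3[of 0 x] o2[of 0 x] o1[of 0 x] M0[OF x] by simp
    also have "\<dots> = length (F x)"
      unfolding eval.simps(5)[of w _ _ Minus] st[OF M x] using ox small by (simp add: word_Minus)
    finally show "M4 (Y + 11 * Z + x * 5) = length (F x)" by simp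
    have "M4 (Y + 11 * Z + (x * 5 + 1)) = eval w x (R, M0) (arr_expr 10 (start_expr Proc))"
      using o4[of 1 x] o3[of 1 x] o2[of 1 x] M1[OF x] by simp
    also have "\<dots> = Y + 10 * Z + off F x"
      by (rule eval_arr_regs[OF R st(1)[OF I0 x]]) (use ox Z1 in linarith)+
    finally show "M4 (Y + 11 * Z + x * 5 + 1) = Y + 10 * Z + off F x" by (simp add: add.assoc)
    have "M4 (Y + 11 * Z + (x * 5 + 2)) = eval w x (R, M1) ?p"
      using o4[of 2 x] o3[of 2 x] M2[OF x] by simp
    also have "\<dots> = Y + 9 * Z + of_bool (1 < D) * (x * d)"
    proof (rule eval_arr_regs[OF R])
      have xd: "x * d \<le> n" if "1 < D"
      proof -
        have "x * d \<le> V * d" using x by (intro mult_le_mono1) simp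
        then show ?thesis using V_next[OF that] by linarith
      qed
      then show "of_bool (1 < D) * (x * d) \<le> 16 * Z" using Z1 by auto
      have "eval w x (R, M1) (Const 1 \<lhd> Reg 12) = of_bool (1 < D)"
        using R w_pos by (simp add: regs_def word_LessThan)
      moreover have "eval w x (R, M1) (Proc \<otimes> Reg 2) = x * d" if "1 < D"
        using R xd[OF that] small by (simp add: regs_def word_Times)
      ultimately show "eval w x (R, M1) ((Const 1 \<lhd> Reg 12) \<otimes> (Proc \<otimes> Reg 2)) = of_bool (1 < D) * (x * d)"
        unfolding eval.simps(5)[of w x "(R, M1)" Times "Const 1 \<lhd> Reg 12"]
        using xd small by (cases "1 < D") (simp_all add: word_Times)
    qed simp
    finally show "M4 (Y + 11 * Z + x * 5 + 2) = Y + 9 * Z + of_bool (1 < D) * (x * d)" by (simp add: add.assoc)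
    have "M4 (Y + 11 * Z + (x * 5 + 3)) = eval w x (R, M2) (start_expr Proc)"
      using o4[of 3 x] M3[OF x] by simp
    then show "M4 (Y + 11 * Z + x * 5 + 3) = off F x" using st(1)[OF I2 x] by (simp add: add.assoc)
    show "M4 (Y + 11 * Z + x * 5 + 4) = Y" using M4[OF x] R by (simp add: regs_def add.assoc)
  qed
  moreover have "M4 a = M a" if "a < Y + 11 * Z \<or> Y + 16 * Z \<le> a" for a
    using f0[OF _ that] f1[OF _ that] f2[OF _ that] f3[OF _ that] f4[OF _ that] by simp
  moreover have "runs w Z (H + 1) record_phase (R, M) 300 (R, M4)"
    unfolding record_phase_def
    by (rule runs_mono[OF runs_Seq[OF 0 runs_Seq[OF 1 runs_Seq[OF 2 runs_Seq[OF 3 4]]]]]) simp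
  ultimately show thesis using that by blast
qed

section \<open>Invariants of a finished level\<close>

definition level_mem :: "mem \<Rightarrow> bool" where
  "level_mem M \<longleftrightarrow> rank_mem Y (count_le dig xs) M \<and>
     (\<forall>y<n. M (Y + 6 * Z + y) = flat (origin_block dig d F) (V * d) ! y) \<and>
     children_mem M \<and>
     (\<forall>x<V. packed w b M (Y + 10 * Z + off F x) (map dig (F x))) \<and> record_mem M"

lemma children_mem_cong:
  assumes "children_mem M" "\<And>x. Y + 8 * Z \<le> x \<Longrightarrow> x < Y + 10 * Z \<Longrightarrow> M' x = M x"
  shows "children_mem M'"
proof -
  have "M' (Y + 8 * Z + x) = M (Y + 8 * Z + x)" "M' (Y + 9 * Z + x) = M (Y + 9 * Z + x)" if "x < Z" for x
    using that by (intro assms(2); simp)+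
  moreover have "x < Z" if "1 < D" "x \<le> V * d" for x using that V_next nd_Z d_ge_2 by fastforce
  moreover have "x < Z" if "x < d" for x using that nd_Z by simp
  ultimately show ?thesis using assms(1) unfolding children_mem_def by auto
qed

lemma packed_cong:
  assumes "packed w b M a T" "\<And>i. i < length T \<Longrightarrow> M' (a + i) = M (a + i)"
  shows "packed w b M' a T"
  unfolding packed_def
proof safe
  fix i assume i: "i < length T"
  then have "i div (w div b) < length T" by (meson div_le_dividend le_less_trans)
  then show "T ! i = take_bit b (drop_bit (b * (i mod (w div b))) (M' (a + i div (w div b))))"
    using assms i unfolding packed_def by simp
qed

lemma packed_level_cong:
  assumes "packed w b M (Y + 10 * Z + off F x) (map dig (F x))" "x < V"
    "\<And>x. Y + 10 * Z \<le> x \<Longrightarrow> x < Y + 11 * Z \<Longrightarrow> M' x = M x"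
  shows "packed w b M' (Y + 10 * Z + off F x) (map dig (F x))"
proof (rule packed_cong[OF assms(1)])
  fix i assume "i < length (map dig (F x))"
  then have "off F x + i < n" using off_less[of x V i F] assms(2) off_V by simp
  then show "M' (Y + 10 * Z + off F x + i) = M (Y + 10 * Z + off F x + i)"
    using nd_Z by (intro assms(3)) simp_all
qed

lemma record_mem_cong:
  assumes "record_mem M" "\<And>x. Y + 11 * Z \<le> x \<Longrightarrow> x < Y + 16 * Z \<Longrightarrow> M' x = M x"
  shows "record_mem M'"
proof -
  have "M' (Y + 11 * Z + x * 5 + k) = M (Y + 11 * Z + x * 5 + k)" if "x < V" "k < 5" for x k
    by (rule assms(2)) (use that V_le nd_Z in linarith)+
  from this[of _ 0] this[of _ 1] this[of _ 2] this[of _ 3] this[of _ 4] show ?thesis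
    using assms(1) unfolding record_mem_def by simp
qed

text \<open>All facts about a level concern its own \<open>16 * Z\<close> cells, so they survive the
  construction of later levels.\<close>

lemma level_mem_cong:
  assumes "level_mem M" "\<And>x. Y \<le> x \<Longrightarrow> x < Y + 16 * Z \<Longrightarrow> M' x = M x"
  shows "level_mem M'"
  unfolding level_mem_def
proof (intro conjI allI impI)
  show "rank_mem Y (count_le dig xs) M'"
    by (rule rank_mem_cong[of _ _ M]) (use assms in \<open>auto simp: level_mem_def\<close>)
  show "M' (Y + 6 * Z + y) = flat (origin_block dig d F) (V * d) ! y" if "y < n" for y
    using assms that nd_Z by (simp add: level_mem_def)
  show "children_mem M'"
    by (rule children_mem_cong[of M]) (use assms in \<open>auto simp: level_mem_def\<close>)
  show "packed w b M' (Y + 10 * Z + off F x) (map dig (F x))" if "x < V" for x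
    by (rule packed_level_cong[of M]) (use assms that in \<open>auto simp: level_mem_def\<close>)
  show "record_mem M'"
    by (rule record_mem_cong[of M]) (use assms in \<open>auto simp: level_mem_def\<close>)
qed

lemma runs_level_com:
  assumes R: "regs R" and M: "input M"
  obtains R' M' where "runs w Z (H + 1) level_com (R, M) 6000 (R', M')" and "regs R'" and "level_mem M'"
    and "\<And>y. y < n \<Longrightarrow> M' (Y + 7 * Z + y) = flat F' (V * d) ! y"
    and "\<And>x. x < Y \<or> Y + 16 * Z \<le> x \<Longrightarrow> M' x = M x"
proof -
  obtain R1 M1 where 1: "runs w Z (H + 1) rank_phase (R, M) 2000 (R1, M1)" and R1: "regs R1"
    and rk: "rank_mem Y (count_le dig xs) M1" and fr1: "\<And>x. x < Y \<or> Y + 4 * Z \<le> x \<Longrightarrow> M1 x = M x"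
    using runs_rank_phase[OF R M] by blast
  have I1: "input M1" by (rule input_cong[OF M]) (use fr1 in simp)
  obtain R2 M2 where 2: "runs w Z (H + 1) children_phase (R1, M1) 1000 (R2, M2)" and R2: "regs R2"
    and ch: "children_mem M2" and fr2: "\<And>x. x < Y + 8 * Z \<or> Y + 10 * Z \<le> x \<Longrightarrow> M2 x = M1 x"
    using runs_children_phase[OF R1 I1 rk] by blast
  have I2: "input M2" by (rule input_cong[OF I1]) (use fr2 in simp)
  have rk2: "rank_mem Y (count_le dig xs) M2" by (rule rank_mem_cong[OF rk]) (use fr2 in simp)
  obtain M3 where 3: "runs w Z (H + 1) permute_phase (R2, M2) 1000 (R2, M3)"
    and inv: "\<And>y. y < n \<Longrightarrow> M3 (Y + 6 * Z + y) = flat (origin_block dig d F) (V * d) ! y"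
    and nxt: "\<And>y. y < n \<Longrightarrow> M3 (Y + 7 * Z + y) = flat F' (V * d) ! y"
    and fr3: "\<And>x. x < Y + 6 * Z \<or> Y + 8 * Z \<le> x \<Longrightarrow> M3 x = M2 x"
    using runs_permute_phase[OF R2 I2 rk2] by blast
  have I3: "input M3" by (rule input_cong[OF I2]) (use fr3 in simp)
  obtain R4 M4 where 4: "runs w Z (H + 1) pack_phase (R2, M3) 1000 (R4, M4)" and R4: "regs R4"
    and pk: "\<And>x. x < V \<Longrightarrow> packed w b M4 (Y + 10 * Z + off F x) (map dig (F x))"
    and fr4: "\<And>x. x < Y + 4 * Z \<or> (Y + 6 * Z \<le> x \<and> x < Y + 10 * Z) \<or> Y + 11 * Z \<le> x \<Longrightarrow> M4 x = M3 x"
    using runs_pack_phase[OF R2 I3] by blast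
  have I4: "input M4" by (rule input_cong[OF I3]) (use fr4 in simp)
  obtain M5 where 5: "runs w Z (H + 1) record_phase (R4, M4) 300 (R4, M5)" and rc: "record_mem M5"
    and fr5: "\<And>a. a < Y + 11 * Z \<or> Y + 16 * Z \<le> a \<Longrightarrow> M5 a = M4 a"
    using runs_record_phase[OF R4 I4] by blast
  have "level_mem M5"
    unfolding level_mem_def
  proof (intro conjI allI impI)
    show "rank_mem Y (count_le dig xs) M5"
      by (rule rank_mem_cong[OF rk2]) (use fr3 fr4 fr5 in simp)
    show "M5 (Y + 6 * Z + y) = flat (origin_block dig d F) (V * d) ! y" if "y < n" for y
      using inv[OF that] fr4 fr5 that nd_Z by simp
    show "children_mem M5" by (rule children_mem_cong[OF ch]) (use fr3 fr4 fr5 in simp)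
    show "packed w b M5 (Y + 10 * Z + off F x) (map dig (F x))" if "x < V" for x
      by (rule packed_level_cong[OF pk[OF that] that]) (use fr5 in simp)
    show "record_mem M5" by (rule rc)
  qed
  moreover have "M5 (Y + 7 * Z + y) = flat F' (V * d) ! y" if "y < n" for y
    using nxt[OF that] fr4 fr5 that nd_Z by simp
  moreover have "M5 x = M x" if "x < Y \<or> Y + 16 * Z \<le> x" for x
  proof -
    have "M5 x = M4 x" by (rule fr5) (use that in linarith)
    also have "\<dots> = M3 x" by (rule fr4) (use that in linarith)
    also have "\<dots> = M2 x" by (rule fr3) (use that in linarith)
    also have "\<dots> = M1 x" by (rule fr2) (use that in linarith)
    also have "\<dots> = M x" by (rule fr1) (use that in linarith)
    finally show ?thesis .
  qed
  moreover have "runs w Z (H + 1) level_com (R, M) 6000 (R4, M5)"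
    unfolding level_com_def
    by (rule runs_mono[OF runs_Seq[OF 1 runs_Seq[OF 2 runs_Seq[OF 3 runs_Seq[OF 4 5]]]]]) simp
  ultimately show thesis using that R4 by blast
qed

end

section \<open>Queries\<close>

abbreviation query_le :: "expr \<Rightarrow> expr" where
  "query_le \<equiv> le_count (Load (Reg 0 \<oplus> Const 4)) (Load (Const 0)) (Load (Const 1)) (Load (Const 2)) (Reg 1)"

abbreviation query_lt :: "expr \<Rightarrow> expr" where
  "query_lt \<equiv> lt_count (Load (Reg 0 \<oplus> Const 4)) (Load (Const 0)) (Load (Const 1)) (Load (Const 2)) (Reg 1)"

abbreviation start_field :: expr where "start_field \<equiv> Load (Reg 0 \<oplus> Const 3)"

text \<open>Subtracting the level-wide count at the left boundary restricts it to the node. The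
  summand 1 is there because \<open>gen_rank\<close> includes position \<open>i\<close>, while
  prefix counts exclude their end.\<close>

definition rank_query_expr :: expr where
  "rank_query_expr = query_le (start_field \<oplus> Reg 2 \<oplus> Const 1) \<ominus> query_le start_field"

text \<open>In the inverse permutation the occurrences of a digit in a node are consecutive, from
  the start of the corresponding child on. Occurrences are counted from 1, hence the decrement; the
  final subtraction makes the position relative to the node. The table exists on the last level too,
  where there are no child nodes.\<close>

definition select_query_expr :: expr where
  "select_query_expr =
     Load (arr 6 (Load (Reg 0 \<oplus> Const 4)) (Load (Const 0))
       (start_field \<oplus> (query_lt (start_field \<oplus> Load (Reg 0)) \<ominus> query_lt start_field) \<oplus> (Reg 2 \<ominus> Const 1))) \<ominus> start_field"

lemma answers_Assign:
  assumes "eval w 0 (init_regs args, M) e = out" "cost e + 1 \<le> q"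
  shows "answers w q (Assign 0 e) M args out"
proof -
  have "exec w (Assign 0 e) (init_regs args, M) (cost e + 1) (cost e + 1) ((init_regs args)(0 := out), M)"
    using exec.Assign[of w 0 e "init_regs args" M] assms(1) by simp
  then show ?thesis
    unfolding answers_def using assms(2)
    by (intro exI[of _ "cost e + 1"] exI[of _ "(init_regs args)(0 := out)"] conjI) simp_all
qed

lemma gen_rank_eq:
  assumes "i < length T"
  shows "gen_rank c T i = length (filter (\<lambda>x. x \<le> c) (take (i + 1) T))"
proof -
  have "{j. j \<le> i \<and> j < length T \<and> T ! j \<le> c} = {j. j < length (take (i + 1) T) \<and> take (i + 1) T ! j \<le> c}"
    using assms by auto
  then show ?thesis unfolding gen_rank_def by (simp only: length_filter_conv_card)
qed

context level
begin

text \<open>The cells 0, 1 and 2 are shared by the queries on all nodes. They are filled only after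
  the construction, when the symbols stored there are no longer read.\<close>

definition query_mem :: "mem \<Rightarrow> bool" where
  "query_mem M \<longleftrightarrow> level_mem M \<and> M 0 = Z \<and> M 1 = d \<and> M 2 = b + 1"

lemma query_evals:
  fixes c i :: nat
  assumes "query_mem M" "x < V"
  defines "s \<equiv> (init_regs [Y + 11 * Z + x * 5, c, i], M)"
  shows "eval w k s (Load (Reg 0 \<oplus> Const 4)) = Y" "eval w k s (Load (Const 0)) = Z"
    "eval w k s (Load (Const 1)) = d" "eval w k s (Load (Const 2)) = b + 1"
    "eval w k s (Load (Reg 0 \<oplus> Const 3)) = off F x" "eval w k s (Load (Reg 0)) = length (F x)"
    "eval w k s (Reg 1) = c" "eval w k s (Reg 2) = i"
proof -
  have v: "Y + 11 * Z + x * 5 + 4 < 2 ^ w" using assms(2) V_le nd_Z Y_bound Z_ge_3 by linarith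
  have M: "record_mem M" "M 0 = Z" "M 1 = d" "M 2 = b + 1" using assms(1) by (simp_all add: query_mem_def level_mem_def)
  have s: "fst s 0 = Y + 11 * Z + x * 5" "fst s 1 = c" "fst s 2 = i" "snd s = M" 
    by (simp_all add: s_def init_regs_def)
  have c: "4 < (2::nat) ^ w" "3 < (2::nat) ^ w" "2 < (2::nat) ^ w" using consts_less by linarith+
  show "eval w k s (Load (Reg 0 \<oplus> Const 4)) = Y"
    using M(1) v c s assms(2) by (simp add: record_mem_def eval_Const word_Plus)
  show "eval w k s (Load (Reg 0 \<oplus> Const 3)) = off F x"
    using M(1) v c s assms(2) by (simp add: record_mem_def eval_Const word_Plus)
  show "eval w k s (Load (Reg 0)) = length (F x)" 
    using M(1) s assms(2) by (simp add: record_mem_def)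
  show "eval w k s (Load (Const 0)) = Z" "eval w k s (Load (Const 1)) = d" "eval w k s (Load (Const 2)) = b + 1"
    "eval w k s (Reg 1) = c" "eval w k s (Reg 2) = i"
    using M c s w_pos by (simp_all add: eval_Const)
qed

lemma eval_rank_query:
  assumes M: "query_mem M" and x: "x < V" and c: "c < d" and i: "i < length (F x)"
  shows "eval w 0 (init_regs [Y + 11 * Z + x * 5, c, i], M) rank_query_expr = gen_rank c (map dig (F x)) i"
proof -
  note q = query_evals[OF M x, where c = c and i = i and k = 0]
  let ?s = "(init_regs [Y + 11 * Z + x * 5, c, i], M)"
  have n: "off F x + i < n" using off_less[of x V i F] x i off_V by simp
  then have n': "off F x \<le> n" "off F x + (i + 1) \<le> n" by simp_all
  have rk: "rank_mem Y (count_le dig xs) M" using M by (simp add: query_mem_def level_mem_def)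
  have j: "eval w 0 ?s (start_field \<oplus> Reg 2 \<oplus> Const 1) = off F x + (i + 1)"
    unfolding eval.simps(5)[of w 0 ?s Plus "_ \<oplus> _"] eval.simps(5)[of w 0 ?s Plus "Load _"] q using n small w_pos
    by (simp add: word_Plus)
  have l1: "eval w 0 ?s (query_le
      (start_field \<oplus> Reg 2 \<oplus> Const 1)) = count_le dig xs c (off F x + (i + 1))"
    by (rule eval_le_count[OF rk Y_bound c n'(2) order_trans[OF count_le_bound n'(2)] q(1-4,7) j])
  have l2: "eval w 0 ?s (query_le
      start_field) = count_le dig xs c (off F x)"
    by (rule eval_le_count[OF rk Y_bound c n'(1) order_trans[OF count_le_bound n'(1)] q(1-4,7,5)])
  have le: "count_le dig xs c (off F x) \<le> count_le dig xs c (off F x + (i + 1))" by (rule count_le_mono) simp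
  have lt: "count_le dig xs c (off F x + (i + 1)) < 2 ^ w"
    using count_le_bound[of dig xs c "off F x + (i + 1)"] n'(2) small by linarith
  have "eval w 0 ?s rank_query_expr = count_le dig xs c (off F x + (i + 1)) - count_le dig xs c (off F x)"
    unfolding rank_query_expr_def Let_def eval.simps(5)[of w 0 ?s Minus] l1 l2 by (rule word_Minus[OF le lt])
  also have "\<dots> = length (filter (\<lambda>s. dig s \<le> c) (take (i + 1) (F x)))"
    using count_le_flat[of x V "i + 1" F dig c] x i by (simp add: xs_def)
  also have "\<dots> = gen_rank c (map dig (F x)) i"
    using i by (simp add: gen_rank_eq take_map filter_map comp_def)
  finally show ?thesis .
qed

lemma eval_select_query:
  assumes M: "query_mem M" and x: "x < V" and c: "c < d" and i: "i \<in> {1..count_list (map dig (F x)) c}"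
  shows "eval w 0 (init_regs [Y + 11 * Z + x * 5, c, i], M) select_query_expr = gen_select c (map dig (F x)) i"
proof -
  note q = query_evals[OF M x, where c = c and i = i and k = 0]
  let ?s = "(init_regs [Y + 11 * Z + x * 5, c, i], M)"
  let ?T = "map dig (F x)" and ?y = "x * d + c"
  let ?I = "filter (\<lambda>j. ?T ! j = c) [0..<length ?T]"
  have "Suc x * d \<le> V * d" using x by (intro mult_le_mono1) simp
  then have y: "?y < V * d" "?y div d = x" "?y mod d = c" using c by auto
  have "count_list ?T c = length (filter (\<lambda>t. t = c) ?T)"
    unfolding count_list_eq_length_filter by (rule arg_cong[of _ _ length], rule filter_cong) auto
  also have "\<dots> = length ?I"
    using length_filter_take_nth[of "length ?T" ?T "\<lambda>t. t = c"] by simp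
  finally have iI: "i - 1 < length ?I" "1 \<le> i" using i by auto
  \<comment> \<open>These are the positions of \<open>c\<close> in the node in increasing order,
    shifted by its left boundary; up to this shift, entry \<open>i - 1\<close> is what
    \<open>gen_select\<close> returns.\<close>
  have origin: "origin_block dig d F ?y = map (\<lambda>i. off F x + i) ?I"
    unfolding origin_block_def y by (auto intro!: filter_cong)
  define p where "p = ?I ! (i - 1)"
  have "p \<in> set ?I" unfolding p_def using iI(1) by (rule nth_mem)
  then have p: "p < length (F x)" by simp
  then have pn: "off F x + p < n" using off_less[of x V p F] x off_V by simp
  have inv: "flat (origin_block dig d F) (V * d) ! (off F' ?y + (i - 1)) = off F x + p"
    using nth_flat[of ?y "V * d" "i - 1" "origin_block dig d F"] y(1) iI(1) origin by (simp add: p_def)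
  have len: "length (F' ?y) = length ?I" unfolding length_origin_block[symmetric] origin by simp
  then have yn: "off F' ?y + (i - 1) < n"
    using off_less[of ?y "V * d" "i - 1" F'] y(1) iI(1) off_F'_V by simp
  have on: "off F x \<le> n" "off F x + length (F x) \<le> n" using off_F_le[of x] off_F_le[of "x + 1"] x by simp_all
  have rk: "rank_mem Y (count_le dig xs) M" using M by (simp add: query_mem_def level_mem_def)
  have j: "eval w 0 ?s (start_field \<oplus> Load (Reg 0)) = off F x + length (F x)"
    unfolding eval.simps(5)[of w 0 ?s Plus "Load _" "Load _"] q using on small by (simp add: word_Plus)
  have l1: "eval w 0 ?s (query_lt
      (start_field \<oplus> Load (Reg 0))) = count_lt dig xs c (off F x + length (F x))"
    by (rule eval_lt_count[OF rk Y_bound c on(2) q(1-4,7) j])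
  have l2: "eval w 0 ?s (query_lt
      start_field) = count_lt dig xs c (off F x)"
    by (rule eval_lt_count[OF rk Y_bound c on(1) q(1-4,7,5)])
  have lt: "count_lt dig xs c (off F x + length (F x)) < 2 ^ w"
    using count_lt_bound[of dig xs c "off F x + length (F x)"] on small by linarith
  have le: "count_lt dig xs c (off F x) \<le> count_lt dig xs c (off F x + length (F x))" by (rule count_lt_mono) simp
  have df: "count_lt dig xs c (off F x + length (F x)) - count_lt dig xs c (off F x) = length (filter (\<lambda>s. dig s < c) (F x))"
    using count_lt_block[OF x, of "length (F x)" c] by simp
  have oF: "off F' ?y = off F x + length (filter (\<lambda>s. dig s < c) (F x))" by (rule off_F') (use c in simp)
  have i1: "eval w 0 ?s (Reg 2 \<ominus> Const 1) = i - 1"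
  proof -
    have "length ?I \<le> length (F x)" by (rule order_trans[OF length_filter_le]) simp
    then have "i < 2 ^ w" using iI on small by linarith
    then show ?thesis unfolding eval.simps(5)[of w 0 ?s Minus] q using iI w_pos by (simp add: word_Minus)
  qed
  have "off F x + length (filter (\<lambda>s. dig s < c) (F x)) < 2 ^ w"
    "off F x + length (filter (\<lambda>s. dig s < c) (F x)) + (i - 1) < 2 ^ w"
    using yn oF small by linarith+
  then have "eval w 0 ?s (start_field \<oplus>
      (query_lt (start_field \<oplus> Load (Reg 0))
        \<ominus> query_lt start_field)
      \<oplus> (Reg 2 \<ominus> Const 1)) = off F' ?y + (i - 1)"
    unfolding eval.simps(5)[of w 0 ?s Plus "_ \<oplus> _"] eval.simps(5)[of w 0 ?s Plus "Load _"]
      eval.simps(5)[of w 0 ?s Minus] l1 l2 q i1[unfolded eval.simps(5)[of w 0 ?s Minus] q] word_Minus[OF le lt] df oF by (simp only: word_Plus)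
  then have "eval w 0 ?s (arr 6 (Load (Reg 0 \<oplus> Const 4)) (Load (Const 0)) (start_field \<oplus>
      (query_lt (start_field \<oplus> Load (Reg 0))
        \<ominus> query_lt start_field)
      \<oplus> (Reg 2 \<ominus> Const 1))) = Y + 6 * Z + (off F' ?y + (i - 1))"
    by (rule eval_arr[OF q(1,2)]) (use yn nd_Z Y_bound in linarith)
  note a = this
  have "M (Y + 6 * Z + (off F' ?y + (i - 1))) = off F x + p"
    using M yn inv by (simp add: query_mem_def level_mem_def)
  then have "eval w 0 ?s select_query_expr = word_op w Minus (off F x + p) (off F x)"
    unfolding select_query_expr_def Let_def eval.simps(5)[of w 0 ?s Minus] q eval.simps(4)[of w 0 ?s "arr 6 _ _ _"]
      a[unfolded eval.simps(5)[of w 0 ?s Minus]] by simp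
  also have "\<dots> = p" using pn small by (simp add: word_Minus)
  finally show ?thesis by (simp add: gen_select_def p_def)
qed

lemma supports_rank_selectI:
  assumes "query_mem M" "x < V" "cost rank_query_expr + 1 \<le> q" "cost select_query_expr + 1 \<le> q"
  shows "supports_rank_select w q (Assign 0 rank_query_expr) (Assign 0 select_query_expr) d M (Y + 11 * Z + x * 5) (map dig (F x))"
  unfolding supports_rank_select_def
proof (intro conjI allI impI ballI)
  show "answers w q (Assign 0 rank_query_expr) M [Y + 11 * Z + x * 5, c, i] (gen_rank c (map dig (F x)) i)"
    if "c < d" "i < length (map dig (F x))" for c i
    by (rule answers_Assign, rule eval_rank_query) (use assms that in simp_all)
  show "answers w q (Assign 0 select_query_expr) M [Y + 11 * Z + x * 5, c, i] (gen_select c (map dig (F x)) i)"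
    if "c < d" "i \<in> {1..count_list (map dig (F x)) c}" for c i
    by (rule answers_Assign, rule eval_select_query) (use assms that in simp_all)
qed

end


section \<open>Computing powers\<close>

text \<open>Logarithms are not machine operations. Repeated multiplication finds the least power
  that reaches a bound, and register \<open>ry\<close> counts up to its exponent. The setup obtains
  \<open>h\<close>, \<open>b\<close>, \<open>Z\<close> and \<open>d ^ L\<close> in this way.\<close>

definition pow_loop :: "nat \<Rightarrow> expr \<Rightarrow> expr \<Rightarrow> nat \<Rightarrow> com" where
  "pow_loop rx bnd k ry = While (Reg rx \<lhd> bnd) (Assign rx (Reg rx \<otimes> k) ;; Assign ry (Reg ry \<oplus> Const 1))"

lemma pow_loop_exec:
  assumes "w > 0" "rx \<noteq> ry" "\<And>u v. eval w 0 (R(rx := u, ry := v), M) bnd = t" "\<And>u v. eval w 0 (R(rx := u, ry := v), M) kE = k"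
    and "t * k < 2 ^ w" "\<And>j. j < i \<Longrightarrow> x * k ^ j < t" "t \<le> x * k ^ i" "y + i < 2 ^ w"
  shows "\<exists>W D. exec w (pow_loop rx bnd kE ry) (R(rx := x, ry := y), M) W D (R(rx := x * k ^ i, ry := y + i), M)
    \<and> W \<le> (cost bnd + cost kE + 20) * (i + 1) \<and> D \<le> (cost bnd + cost kE + 20) * (i + 1)"
  using assms(6-)
proof (induction i arbitrary: x y)
  case 0
  have "eval w 0 (R(rx := x, ry := y), M) (Reg rx \<lhd> bnd) = 0"
    using 0 assms(1-3) by (simp add: word_LessThan fun_upd_def)
  from exec.WhileFalse[OF this] have "exec w (pow_loop rx bnd kE ry) (R(rx := x, ry := y), M)
      (cost bnd + 3) (cost bnd + 3) (R(rx := x * k ^ 0, ry := y + 0), M)"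
    unfolding pow_loop_def by (simp add: numeral_3_eq_3)
  moreover have "cost bnd + 3 \<le> (cost bnd + cost kE + 20) * (0 + 1)" by simp
  ultimately show ?case by (metis order_refl)
next
  case (Suc i)
  let ?R = "R(rx := x, ry := y)" and ?R1 = "R(rx := x * k, ry := y)" and ?R2 = "R(rx := x * k, ry := y + 1)"
  let ?body = "Assign rx (Reg rx \<otimes> kE) ;; Assign ry (Reg ry \<oplus> Const 1)"
  let ?C = "cost bnd + cost kE + 20"
  have xt: "x < t" using Suc.prems(1)[of 0] by simp
  then have e0: "eval w 0 (?R, M) (Reg rx \<lhd> bnd) \<noteq> 0"
    using assms(1-3) by (simp add: word_LessThan)
  \<comment> \<open>The loop multiplies only values below \<open>t\<close>, so
    \<open>t * k < 2 ^ w\<close> excludes an overflow in the last round as well.\<close>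
  have "x * k \<le> t * k" using xt by (intro mult_le_mono1) simp
  then have "x * k < 2 ^ w" using assms(5) by linarith
  then have "eval w 0 (?R, M) (Reg rx \<otimes> kE) = x * k"
    using assms(2,4) by (simp add: word_Times)
  then have 1: "exec w (Assign rx (Reg rx \<otimes> kE)) (?R, M) (cost kE + 3) (cost kE + 3) (?R1, M)"
    using exec.Assign[of w rx "Reg rx \<otimes> kE" ?R M] assms(2) by (simp add: fun_upd_twist numeral_3_eq_3)
  have "eval w 0 (?R1, M) (Reg ry \<oplus> Const 1) = y + 1"
    using Suc.prems(3) assms(1) by (simp add: word_Plus)
  then have 2: "exec w (Assign ry (Reg ry \<oplus> Const 1)) (?R1, M) 4 4 (?R2, M)"
    using exec.Assign[of w ry "Reg ry \<oplus> Const 1" ?R1 M] by (simp add: numeral_eq_Suc)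
  have "\<exists>W D. exec w (pow_loop rx bnd kE ry) (?R2, M) W D (R(rx := x * k * k ^ i, ry := y + 1 + i), M)
    \<and> W \<le> ?C * (i + 1) \<and> D \<le> ?C * (i + 1)"
  proof (rule Suc.IH)
    show "x * k * k ^ j < t" if "j < i" for j using Suc.prems(1)[of "Suc j"] that by (simp add: mult.assoc)
  qed (use Suc.prems in \<open>simp_all add: mult.assoc\<close>)
  then obtain W D where 3: "exec w (pow_loop rx bnd kE ry) (?R2, M) W D (R(rx := x * k * k ^ i, ry := y + 1 + i), M)"
    "W \<le> ?C * (i + 1)" "D \<le> ?C * (i + 1)" by blast
  have "cost (Reg rx \<lhd> bnd) = cost bnd + 2" by simp
  then have ex: "exec w (pow_loop rx bnd kE ry) (?R, M) (cost bnd + 2 + 1 + (cost kE + 3 + 4) + W)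
      (cost bnd + 2 + 1 + (cost kE + 3 + 4) + D) (R(rx := x * k * k ^ i, ry := y + 1 + i), M)"
    using exec.WhileTrue[OF e0 exec.Seq[OF 1 2] 3(1)[unfolded pow_loop_def]] unfolding pow_loop_def by metis
  have "cost bnd + 2 + 1 + (cost kE + 3 + 4) + W \<le> ?C * (Suc i + 1)" "cost bnd + 2 + 1 + (cost kE + 3 + 4) + D \<le> ?C * (Suc i + 1)"
    using 3(2,3) by simp_all
  moreover have "x * k * k ^ i = x * k ^ Suc i" "y + 1 + i = y + Suc i" by simp_all
  ultimately show ?case using ex by metis
qed

lemma least_power:
  fixes t x k :: nat
  assumes "k \<ge> 2" "x \<ge> 1"
  obtains i where "t \<le> x * k ^ i" "\<And>j. j < i \<Longrightarrow> x * k ^ j < t"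
proof -
  have "t \<le> x * k ^ t"
  proof -
    have "t < 2 ^ t" by (rule less_exp)
    also have "\<dots> \<le> k ^ t" using assms(1) by (rule power_mono) simp
    also have "\<dots> \<le> x * k ^ t" using assms(2) by simp
    finally show ?thesis by simp
  qed
  then have "t \<le> x * k ^ (LEAST i. t \<le> x * k ^ i)" by (rule LeastI)
  moreover have "x * k ^ j < t" if "j < (LEAST i. t \<le> x * k ^ i)" for j
    using not_less_Least[OF that] by simp
  ultimately show thesis by (rule that)
qed

section \<open>Digit prefixes\<close>

lemma length_digits [simp]: "length (digits d l x) = l"
  by (simp add: digits_def)

lemma digits_Suc: "d > 0 \<Longrightarrow> digits d (Suc l) x = digits d l (x div d) @ [x mod d]"
proof -
  assume "d > 0"
  have "x div d ^ (Suc l - 1 - i) mod d = x div d div d ^ (l - 1 - i) mod d" if "i < l" for i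
  proof -
    have "Suc l - 1 - i = Suc (l - 1 - i)" using that by simp
    then show ?thesis by (simp add: div_mult2_eq)
  qed
  then show ?thesis by (simp add: digits_def)
qed

text \<open>Cutting off the last \<open>L - l\<close> digits is a division, so the nodes of level
  \<open>l\<close> can be numbered by \<open>x < d ^ l\<close>, with \<open>digits d l x\<close> as
  their prefixes.\<close>

lemma take_digits:
  assumes "l \<le> L"
  shows "take l (digits d L s) = digits d l (s div d ^ (L - l))"
proof (rule nth_equalityI)
  fix i assume "i < length (take l (digits d L s))"
  then have i: "i < l" using assms by simp
  then have "d ^ (L - 1 - i) = d ^ (L - l) * d ^ (l - 1 - i)" using assms by (simp flip: power_add)
  then show "take l (digits d L s) ! i = digits d l (s div d ^ (L - l)) ! i"
    using i assms by (simp add: digits_def div_mult2_eq)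
qed (use assms in simp)

definition digits_value :: "nat \<Rightarrow> nat list \<Rightarrow> nat" where
  "digits_value d p = foldl (\<lambda>a c. a * d + c) 0 p"

lemma digits_value_digits: "d > 0 \<Longrightarrow> x < d ^ l \<Longrightarrow> digits_value d (digits d l x) = x"
proof (induction l arbitrary: x)
  case 0
  then show ?case by (simp add: digits_value_def digits_def)
next
  case (Suc l)
  have "x div d < d ^ l" using Suc.prems by (simp add: less_mult_imp_div_less mult.commute)
  then have "digits_value d (digits d l (x div d)) = x div d" using Suc by simp
  then show ?case using Suc.prems(1) by (simp add: digits_Suc digits_value_def)
qed

lemma digits_inj: "d > 0 \<Longrightarrow> x < d ^ l \<Longrightarrow> y < d ^ l \<Longrightarrow> digits d l x = digits d l y \<longleftrightarrow> x = y"
  by (metis digits_value_digits)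


section \<open>The whole tree\<close>

text \<open>Register 7 runs through \<open>d ^ (L - l)\<close> and ends the loop at 1, so no level
  counter is kept. Nothing is copied between levels: the arrays 7 and 8 of a level serve in place as
  symbols and boundaries of the next.\<close>

definition tree_loop :: com where
  "tree_loop = While (Const 1 \<lhd> Reg 7)
     (Assign 12 (Reg 7 \<oslash> Reg 2) ;; level_com ;; Assign 7 (Reg 12) ;; Assign 8 (Reg 8 \<otimes> Reg 2) ;;
      Assign 9 (arr_expr 7 (Const 0)) ;; Assign 10 (arr_expr 8 (Const 0)) ;; Assign 11 (arr_expr 16 (Const 0)))"

text \<open>Here \<open>L\<close> is the least exponent with \<open>\<sigma> \<le> d ^ L\<close>;
  its relation to the real logarithm is a separate matter. The bound \<open>space\<close> covers all
  addresses, and also \<open>d ^ L\<close>, which is at most \<open>Z * Z\<close>.\<close>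

locale tree = word_params +
  fixes S :: "nat list" and \<sigma> L :: nat
  assumes length_S: "length S = n" and S_less: "set S \<subseteq> {..<\<sigma>}" and sigma_le: "\<sigma> \<le> n"
    and sigma_pow: "\<sigma> \<le> d ^ L" and L_least: "0 < L \<Longrightarrow> d ^ (L - 1) < \<sigma>"
    and space: "64 * (L + 2) * (Z * Z) < 2 ^ w"
begin

definition block :: "nat \<Rightarrow> nat \<Rightarrow> nat list" where
  "block l x = filter (\<lambda>s. s div d ^ (L - l) = x) S"

text \<open>The first \<open>Z\<close> cells hold the input, followed by the two boundaries of the
  root node at \<open>n\<close> and \<open>n + 1\<close>. Each level then takes 16 arrays.\<close>

definition Yl :: "nat \<Rightarrow> nat" where "Yl l = Z + 16 * Z * l"

definition XPl :: "nat \<Rightarrow> nat" where "XPl l = (if l = 0 then 0 else Yl (l - 1) + 7 * Z)"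

definition SPl :: "nat \<Rightarrow> nat" where "SPl l = (if l = 0 then n else Yl (l - 1) + 8 * Z)"

text \<open>The root has the first record of level 0, at \<open>Yl 0 + 11 * Z\<close>. For
  \<open>\<sigma> = 1\<close> there are no levels and the pointer is null.\<close>

definition root :: nat where "root = of_bool (1 < d ^ L) * (12 * Z)"

lemma Yl_Suc: "Yl (Suc l) = Yl l + 16 * Z"
  by (simp add: Yl_def)

lemma d_pos: "0 < d" using d_ge_2 by simp

lemma Z_sq: "k * Z \<le> k * (Z * Z)"
  using Z_ge_3 by (intro mult_le_mono2) simp

lemma Yl_bound: "l \<le> L \<Longrightarrow> Yl l + 64 * Z < 2 ^ w"
proof -
  assume "l \<le> L"
  then have "Yl l \<le> Z + 16 * Z * L" by (simp add: Yl_def)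
  also have "\<dots> + 64 * Z \<le> 64 * (L + 2) * Z" by (simp add: algebra_simps)
  also have "\<dots> \<le> 64 * (L + 2) * (Z * Z)" by (rule Z_sq)
  finally show ?thesis using space by simp
qed

lemma S_less_pow: "s \<in> set S \<Longrightarrow> s < d ^ L"
  using S_less sigma_pow by auto

lemma block_key_less: "l \<le> L \<Longrightarrow> s \<in> set S \<Longrightarrow> s div d ^ (L - l) < d ^ l"
proof -
  assume "l \<le> L" "s \<in> set S"
  then have "s < d ^ l * d ^ (L - l)" using S_less_pow by (simp flip: power_add)
  then show ?thesis by (rule less_mult_imp_div_less)
qed

lemma off_block: "l \<le> L \<Longrightarrow> off (block l) (d ^ l) = n"
proof -
  assume l: "l \<le> L"
  have "off (block l) V = length (filter (\<lambda>s. s div d ^ (L - l) < V) S)" for V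
  proof (induction V)
    case (Suc V)
    have "length (filter (\<lambda>s. f s < Suc V) ys) = length (filter (\<lambda>s. f s < V) ys) + length (filter (\<lambda>s. f s = V) ys)"
      for f :: "nat \<Rightarrow> nat" and ys by (induction ys) auto
    then show ?case using Suc by (simp add: block_def)
  qed simp
  then show ?thesis using block_key_less[OF l] length_S by (simp add: filter_id_conv)
qed

lemma pow_less_sigma: "l < L \<Longrightarrow> d ^ l < \<sigma>"
proof -
  assume "l < L"
  then have "d ^ l \<le> d ^ (L - 1)" using d_ge_2 by (intro power_increasing) auto
  then show ?thesis using L_least \<open>l < L\<close> by simp
qed

lemma level_l:
  assumes "l < L"
  shows "level w n d b Z H (d ^ (L - l)) (d ^ (L - Suc l)) (d ^ l) (Yl l) (XPl l) (SPl l) (block l)"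
proof -
  have E: "d ^ (L - l) = d ^ (L - Suc l) * d" using assms by (metis Suc_diff_Suc power_Suc2)
  have V: "d ^ l \<le> n" using pow_less_sigma[OF assms] sigma_le by simp
  \<comment> \<open>If \<open>1 < d ^ (L - Suc l)\<close>, then \<open>l\<close> is not the last
    level, so the next level still has fewer than \<open>\<sigma>\<close> prefixes.\<close>
  have V': "d ^ l * d \<le> n" if "1 < d ^ (L - Suc l)"
  proof -
    have "Suc l < L" using that by (cases "L - Suc l") auto
    then show ?thesis using pow_less_sigma[of "Suc l"] sigma_le by (simp add: mult.commute)
  qed
  have "SPl l + d ^ l < Yl l"
  proof (cases l)
    case 0
    then show ?thesis using nd_Z d_ge_2 by (simp add: SPl_def Yl_def)
  next
    case (Suc k)
    then show ?thesis using V nd_Z d_ge_2 unfolding Suc Yl_Suc by (simp add: SPl_def)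
  qed
  moreover have "XPl l + Z \<le> Yl l"
    by (cases l) (simp_all add: XPl_def Yl_Suc, simp add: Yl_def)
  ultimately show ?thesis
    using E V V' assms Yl_bound[of l] off_block[of l] word_params_axioms d_pos
    unfolding level_def level_axioms_def
    by (auto simp: Yl_def block_def)
qed

text \<open>The prefix of length \<open>Suc l\<close> of a symbol, read as a number, is determined
  by its quotient and its remainder by \<open>d\<close>, that is, by the shorter prefix and the new
  digit. So one stable partition turns the blocks of a level into those of the next.\<close>

lemma split_block_block:
  assumes "l < L"
  shows "split_block (\<lambda>s. s div d ^ (L - Suc l) mod d) d (block l) = block (Suc l)"
proof
  fix x
  have E: "d ^ (L - l) = d ^ (L - Suc l) * d" using assms by (metis Suc_diff_Suc power_Suc2)
  have "s div d ^ (L - l) = x div d \<and> s div d ^ (L - Suc l) mod d = x mod d \<longleftrightarrow> s div d ^ (L - Suc l) = x" for s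
    unfolding E div_mult2_eq by (metis div_mult_mod_eq)
  then show "split_block (\<lambda>s. s div d ^ (L - Suc l) mod d) d (block l) x = block (Suc l) x"
    by (simp add: split_block_def block_def conj_commute)
qed

abbreviation lev_dig :: "nat \<Rightarrow> nat \<Rightarrow> nat" where
  "lev_dig l \<equiv> \<lambda>s. s div d ^ (L - Suc l) mod d"

abbreviation lev_mem :: "nat \<Rightarrow> mem \<Rightarrow> bool" where
  "lev_mem l M \<equiv> level.level_mem w n d b Z (d ^ (L - Suc l)) (d ^ l) (Yl l) (block l) M"

abbreviation lev_input :: "nat \<Rightarrow> mem \<Rightarrow> bool" where
  "lev_input l M \<equiv> level.input n (d ^ l) (XPl l) (SPl l) (block l) M"

lemma lev_dig_eq: "l < L \<Longrightarrow> level.dig d (d ^ (L - Suc l)) = lev_dig l"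
  using level.dig_def[OF level_l] by blast

definition loop_regs :: "nat \<Rightarrow> regs \<Rightarrow> bool" where
  "loop_regs l R \<longleftrightarrow> R 0 = n \<and> R 2 = d \<and> R 5 = b \<and> R 6 = Z \<and> R 7 = d ^ (L - l) \<and> R 8 = d ^ l \<and> R 9 = XPl l \<and> R 10 = SPl l \<and>
     R 11 = Yl l \<and> R 13 = w div b \<and> R 14 = b + 1 \<and> R 17 = root"

lemma pow_L_less: "l \<le> L \<Longrightarrow> d ^ l < 2 ^ w"
proof -
  assume l: "l \<le> L"
  have "d ^ L \<le> Z * Z"
  proof (cases "L = 0")
    case True
    then show ?thesis using Z_ge_3 by simp
  next
    case False
    then have "d ^ (L - 1) \<le> Z" using L_least sigma_le nd_Z by linarith
    then have "d ^ (L - 1) * d \<le> Z * Z" using nd_Z by (intro mult_le_mono) auto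
    then show ?thesis using False by (metis power_minus_mult not_gr_zero)
  qed
  moreover have "d ^ l \<le> d ^ L" using l d_ge_2 by (intro power_increasing) auto
  ultimately show ?thesis using space by (simp add: algebra_simps)
qed

lemma next_input:
  assumes "Suc l < L" "lev_mem l M" "\<And>y. y < n \<Longrightarrow> M (Yl l + 7 * Z + y) = flat (split_block (level.dig d (d ^ (L - Suc l))) d (block l)) (d ^ l * d) ! y"
  shows "lev_input (Suc l) M"
proof -
  have l: "l < L" using assms(1) by simp
  note lv = level_l[OF l] and lv' = level_l[OF assms(1)]
  have "d ^ 1 \<le> d ^ (L - Suc l)" using assms(1) d_ge_2 by (intro power_increasing) auto
  then have D: "1 < d ^ (L - Suc l)" using d_ge_2 by simp
  have "M (Yl l + 8 * Z + x) = off (block (Suc l)) x" if "x \<le> d ^ l * d" for x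
    using assms(2) that D
    unfolding level.level_mem_def[OF lv] level.children_mem_def[OF lv] lev_dig_eq[OF l] split_block_block[OF l] by blast
  moreover have "M (Yl l + 7 * Z + y) = flat (block (Suc l)) (d ^ Suc l) ! y" if "y < n" for y
    using assms(3)[OF that] unfolding lev_dig_eq[OF l] split_block_block[OF l] by (simp add: mult.commute)
  ultimately show ?thesis
    unfolding level.input_def[OF lv'] level.xs_def[OF lv'] by (simp add: XPl_def SPl_def mult.commute)
qed

text \<open>The input of a level is assumed only for \<open>l < L\<close>, because the last level
  leaves no boundaries behind. Unlike in the sweeps, every round has the same bound, a constant
  number of units.\<close>

lemma tree_loop_exec:
  assumes "l \<le> L" "loop_regs l R" "l < L \<Longrightarrow> lev_input l M" "\<forall>k<l. lev_mem k M"
  shows "\<exists>W D' R' M'. exec w tree_loop (R, M) W D' (R', M') \<and> W \<le> 6200 * Z * (L - l + 1) \<and> D' \<le> 6200 * (H + 1) * (L - l + 1) \<and>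
    loop_regs L R' \<and> (\<forall>k<L. lev_mem k M')"
  using assms
proof (induction "L - l" arbitrary: l R M)
  case 0
  then have "l = L" by simp
  then have "eval w 0 (R, M) (Const 1 \<lhd> Reg 7) = 0"
    using 0 w_pos by (simp add: loop_regs_def word_LessThan)
  then have "exec w tree_loop (R, M) (cost (Const 1 \<lhd> Reg 7) + 1) (cost (Const 1 \<lhd> Reg 7) + 1) (R, M)"
    unfolding tree_loop_def by (rule exec.WhileFalse)
  moreover have "cost (Const 1 \<lhd> Reg 7) + 1 \<le> 6200 * Z * (L - l + 1)" "cost (Const 1 \<lhd> Reg 7) + 1 \<le> 6200 * (H + 1) * (L - l + 1)"
    using Z_ge_3 by simp_all
  ultimately show ?case using 0 \<open>l = L\<close> by blast
next
  case (Suc m)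
  have l: "l < L" and m: "m = L - Suc l" using Suc.hyps(2) by simp_all
  note lv = level_l[OF l]
  interpret lv: level w n d b Z H "d ^ (L - l)" "d ^ (L - Suc l)" "d ^ l" "Yl l" "XPl l" "SPl l" root "block l"
    by (rule lv)
  have Z1: "1 \<le> Z" using Z_ge_3 by simp
  define R1 where "R1 = R(12 := d ^ (L - Suc l))"
  have E: "d ^ (L - l) = d ^ (L - Suc l) * d" using l by (metis Suc_diff_Suc power_Suc2)
  have R7: "R 7 = d ^ (L - l)" "R 2 = d" using Suc.prems(2) by (simp_all add: loop_regs_def)
  have 1: "runs w Z (H + 1) (Assign 12 (Reg 7 \<oslash> Reg 2)) (R, M) 4 (R1, M)"
    unfolding R1_def by (rule runs_Assign) (use Z1 R7 E d_pos in simp_all)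
  have R1: "lv.regs R1" using Suc.prems(2) by (simp add: R1_def lv.regs_def loop_regs_def)
  obtain R2 M2 where 2: "runs w Z (H + 1) level_com (R1, M) 6000 (R2, M2)" and R2: "lv.regs R2" and M2: "lv.level_mem M2"
    and nxt: "\<And>y. y < n \<Longrightarrow> M2 (Yl l + 7 * Z + y) = flat (split_block lv.dig d (block l)) (d ^ l * d) ! y"
    and fr: "\<And>x. x < Yl l \<or> Yl l + 16 * Z \<le> x \<Longrightarrow> M2 x = M x"
    using lv.runs_level_com[OF R1 Suc.prems(3)[OF l]] by blast
  define R3 where "R3 = R2(7 := d ^ (L - Suc l), 8 := d ^ Suc l, 9 := XPl (Suc l), 10 := SPl (Suc l), 11 := Yl (Suc l))"
  let ?tail = "Assign 7 (Reg 12) ;; Assign 8 (Reg 8 \<otimes> Reg 2) ;;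
      Assign 9 (arr_expr 7 (Const 0)) ;; Assign 10 (arr_expr 8 (Const 0)) ;; Assign 11 (arr_expr 16 (Const 0))"
  have 3: "runs w Z (H + 1) ?tail (R2, M2) 100 (R3, M2)"
  proof -
    have yz: "R2 11 = Yl l" "R2 6 = Z" "R2 12 = d ^ (L - Suc l)" "R2 8 = d ^ l" "R2 2 = d"
      using R2 by (simp_all add: lv.regs_def)
    have yb: "Yl l + 16 * Z < 2 ^ w" using Yl_bound[of l] l by simp
    have a: "eval w 0 (Q, M2) (arr_expr k (Const 0)) = Yl l + k * Z" if "Q 11 = Yl l" "Q 6 = Z" "k \<le> 16" for Q k
    proof -
      have "k * Z \<le> 16 * Z" using that(3) by (rule mult_le_mono1)
      then have "Yl l + k * Z + 0 < 2 ^ w" using yb by linarith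
      then show ?thesis using eval_arr[of 0 "(Q, M2)" "Reg 11" "Yl l" "Reg 6" "Const 0" 0 k] that by simp
    qed
    have "d ^ l * d < 2 ^ w" using pow_L_less[of "Suc l"] l by (simp add: mult.commute)
    then have t2: "runs w Z (H + 1) (Assign 8 (Reg 8 \<otimes> Reg 2)) (R2(7 := d ^ (L - Suc l)), M2) 4 (R2(7 := d ^ (L - Suc l), 8 := d ^ Suc l), M2)"
      by (intro runs_Assign) (use Z1 yz in \<open>simp_all add: word_Times mult.commute\<close>)
    have t1: "runs w Z (H + 1) (Assign 7 (Reg 12)) (R2, M2) 4 (R2(7 := d ^ (L - Suc l)), M2)"
      by (rule runs_Assign) (use Z1 yz in simp_all)
    let ?R = "R2(7 := d ^ (L - Suc l), 8 := d ^ Suc l)"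
    have t3: "runs w Z (H + 1) (Assign 9 (arr_expr 7 (Const 0))) (?R, M2) 10 (?R(9 := XPl (Suc l)), M2)"
      by (rule runs_Assign) (use Z1 a[of ?R 7] yz in \<open>simp_all add: XPl_def\<close>)
    let ?R = "?R(9 := XPl (Suc l))"
    have t4: "runs w Z (H + 1) (Assign 10 (arr_expr 8 (Const 0))) (?R, M2) 10 (?R(10 := SPl (Suc l)), M2)"
      by (rule runs_Assign) (use Z1 a[of ?R 8] yz in \<open>simp_all add: SPl_def\<close>)
    let ?R = "?R(10 := SPl (Suc l))"
    have t5: "runs w Z (H + 1) (Assign 11 (arr_expr 16 (Const 0))) (?R, M2) 10 (?R(11 := Yl (Suc l)), M2)"
      by (rule runs_Assign) (use Z1 a[of ?R 16] yz in \<open>simp_all add: Yl_Suc\<close>)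
    show ?thesis
      unfolding R3_def
      by (rule runs_mono[OF runs_Seq[OF t1 runs_Seq[OF t2 runs_Seq[OF t3 runs_Seq[OF t4 t5]]]]]) simp
  qed
  let ?body = "Assign 12 (Reg 7 \<oslash> Reg 2) ;; level_com ;; ?tail"
  have "runs w Z (H + 1) ?body (R, M) 6110 (R3, M2)"
    by (rule runs_mono[OF runs_Seq[OF 1 runs_Seq[OF 2 3]]]) simp
  then obtain W1 D1 where body: "exec w ?body (R, M) W1 D1 (R3, M2)" "W1 \<le> 6110 * Z" "D1 \<le> 6110 * (H + 1)"
    unfolding runs_def by blast
  have R3: "loop_regs (Suc l) R3" using R2 by (simp add: R3_def loop_regs_def lv.regs_def)
  have mem: "lev_mem k M2" if "k < Suc l" for k
  proof (cases "k = l")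
    case False
    then have k: "k < l" using that by simp
    have "16 * Z * Suc k \<le> 16 * Z * l" using k by (intro mult_le_mono2) simp
    then have "Yl k + 16 * Z \<le> Yl l" by (simp add: Yl_def)
    then show ?thesis
      using level.level_mem_cong[OF level_l[of k], of M M2] Suc.prems(4) k l fr by simp
  qed (use M2 in simp)
  have inp: "lev_input (Suc l) M2" if "Suc l < L"
    by (rule next_input[OF that M2 nxt])
  obtain W2 D2 R' M' where IH: "exec w tree_loop (R3, M2) W2 D2 (R', M')" "W2 \<le> 6200 * Z * (L - Suc l + 1)"
    "D2 \<le> 6200 * (H + 1) * (L - Suc l + 1)" "loop_regs L R'" "\<forall>k<L. lev_mem k M'"
  proof -
    have "\<exists>W D' R' M'. exec w tree_loop (R3, M2) W D' (R', M') \<and> W \<le> 6200 * Z * (L - Suc l + 1) \<and>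
      D' \<le> 6200 * (H + 1) * (L - Suc l + 1) \<and> loop_regs L R' \<and> (\<forall>k<L. lev_mem k M')"
      by (rule Suc.hyps(1)[OF m _ R3 inp]) (use l mem in auto)
    then show thesis using that by blast
  qed
  have e0: "eval w 0 (R, M) (Const 1 \<lhd> Reg 7) \<noteq> 0"
  proof -
    have "1 \<le> d ^ (L - Suc l)" using d_pos by simp
    then have "1 * 2 \<le> d ^ (L - l)" unfolding E using d_ge_2 by (intro mult_le_mono)
    then show ?thesis using R7 w_pos by (simp add: word_LessThan)
  qed
  have c: "cost (Const 1 \<lhd> Reg 7) = 3" by simp
  have ex: "exec w tree_loop (R, M) (3 + 1 + W1 + W2) (3 + 1 + D1 + D2) (R', M')"
    using exec.WhileTrue[OF e0 body(1) IH(1)[unfolded tree_loop_def], unfolded c] unfolding tree_loop_def .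
  have s: "L - l + 1 = (L - Suc l + 1) + 1" using l by simp
  have bound: "3 + 1 + u + v \<le> 6200 * X * (L - l + 1)"
    if "u \<le> 6110 * X" "v \<le> 6200 * X * (L - Suc l + 1)" "1 \<le> X" for u v X
    using that unfolding s add_mult_distrib2[of "6200 * X" _ 1] by linarith
  have "3 + 1 + W1 + W2 \<le> 6200 * Z * (L - l + 1)" "3 + 1 + D1 + D2 \<le> 6200 * (H + 1) * (L - l + 1)"
    by (rule bound; use body IH Z1 in simp)+
  then show ?case using ex IH(4,5) by blast
qed

section \<open>The represented tree\<close>

definition loc :: "nat list \<Rightarrow> nat" where
  "loc p = Yl (length p) + 11 * Z + digits_value d p * 5"

lemma loc_digits: "x < d ^ l \<Longrightarrow> loc (digits d l x) = Yl l + 11 * Z + x * 5"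
  by (simp add: loc_def digits_value_digits d_pos)

context
  assumes num_levels: "num_levels d \<sigma> = L"
begin

text \<open>Records are written for all \<open>x < d ^ l\<close>. Those with an empty block are not
  nodes, and the corresponding child pointers are null.\<close>

lemma node_iff:
  assumes "x < d ^ l"
  shows "digits d l x \<in> nodes d \<sigma> S \<longleftrightarrow> l < L \<and> block l x \<noteq> []"
proof
  assume "digits d l x \<in> nodes d \<sigma> S"
  then obtain k s where ks: "digits d l x = take k (digits d L s)" "k < L" "s \<in> set S"
    unfolding nodes_def num_levels by blast
  have lk: "l = k" using arg_cong[OF ks(1), of length] ks(2) by simp
  have "digits d l x = digits d l (s div d ^ (L - l))"
    unfolding ks(1) unfolding lk by (rule take_digits) (use ks(2) in simp)
  then have "x = s div d ^ (L - l)"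
    using digits_inj[OF d_pos assms block_key_less[OF _ ks(3)]] ks(2) lk by simp
  then show "l < L \<and> block l x \<noteq> []" using ks lk by (auto simp: block_def filter_empty_conv)
next
  assume a: "l < L \<and> block l x \<noteq> []"
  then obtain s where s: "s \<in> set S" "s div d ^ (L - l) = x" by (auto simp: block_def filter_empty_conv)
  have "take l (digits d L s) = digits d l (s div d ^ (L - l))" by (rule take_digits) (use a in simp)
  then have "digits d l x = take l (digits d L s)" unfolding s(2) by (rule sym)
  then show "digits d l x \<in> nodes d \<sigma> S" using s a unfolding nodes_def num_levels by blast
qed

lemma node_cases:
  assumes "p \<in> nodes d \<sigma> S"
  obtains l x where "l < L" "x < d ^ l" "p = digits d l x"
proof -
  obtain k s where ks: "p = take k (digits d L s)" "k < L" "s \<in> set S"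
    using assms unfolding nodes_def num_levels by blast
  then show thesis using that[of k "s div d ^ (L - k)"] take_digits[of k L d s] block_key_less[of k s] by simp
qed

lemma node_seq_digits:
  assumes "l < L" "x < d ^ l"
  shows "node_seq d \<sigma> S (digits d l x) = map (lev_dig l) (block l x)"
proof -
  have "concat (map (\<lambda>s. if P s then [f s] else []) ys) = map f (filter P ys)" for f :: "nat \<Rightarrow> nat" and P ys
    by (induction ys) auto
  then have "node_seq d \<sigma> S (digits d l x)
      = map (\<lambda>s. digits d L s ! l) (filter (\<lambda>s. take l (digits d L s) = digits d l x) S)"
    unfolding node_seq_def num_levels by simp
  also have "filter (\<lambda>s. take l (digits d L s) = digits d l x) S = block l x"
    unfolding block_def
  proof (rule filter_cong)
    show "take l (digits d L s) = digits d l x \<longleftrightarrow> s div d ^ (L - l) = x" if "s \<in> set S" for s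
      using take_digits[of l L d s] digits_inj[OF d_pos block_key_less assms(2)] assms(1) that by simp
  qed simp
  also have "map (\<lambda>s. digits d L s ! l) (block l x) = map (lev_dig l) (block l x)"
    using assms(1) by (simp add: digits_def)
  finally show ?thesis .
qed

lemma represents:
  assumes mem: "\<forall>l<L. lev_mem l M" and glob: "M 0 = Z" "M 1 = d" "M 2 = b + 1"
    and q: "cost rank_query_expr + 1 \<le> q" "cost select_query_expr + 1 \<le> q"
  shows "represents_wavelet_tree w q (Assign 0 rank_query_expr) (Assign 0 select_query_expr) b d \<sigma> S M root"
  unfolding represents_wavelet_tree_def
proof (intro exI[of _ loc] conjI ballI allI impI)
  have val_less: "x * 5 < 5 * Z" if "l < L" "x < d ^ l" for l x
    using pow_less_sigma[OF that(1)] that(2) sigma_le nd_Z by linarith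
  show "inj_on loc (nodes d \<sigma> S)"
  proof (rule inj_onI)
    fix p p' assume p: "p \<in> nodes d \<sigma> S" and p': "p' \<in> nodes d \<sigma> S" and eq: "loc p = loc p'"
    obtain l x where x: "l < L" "x < d ^ l" "p = digits d l x" using p by (rule node_cases)
    obtain l' x' where x': "l' < L" "x' < d ^ l'" "p' = digits d l' x'" using p' by (rule node_cases)
    have e: "16 * Z * l + x * 5 = 16 * Z * l' + x' * 5"
      using eq x x' by (simp add: loc_digits Yl_def)
    \<comment> \<open>The offset of a record within a level stays below the stride
      \<open>16 * Z\<close>, so division by the stride recovers the level.\<close>
    have v: "x * 5 < 16 * Z" "x' * 5 < 16 * Z" using val_less[OF x(1,2)] val_less[OF x'(1,2)] by linarith+
    have "l = (16 * Z * l + x * 5) div (16 * Z)" "l' = (16 * Z * l' + x' * 5) div (16 * Z)"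
      using v by simp_all
    then have "l = l'" using e by simp
    then show "p = p'" using e x x' by simp
  qed
  show "0 \<notin> loc ` nodes d \<sigma> S" using Z_ge_3 by (auto simp: loc_def Yl_def)
  have nil: "[] = digits d 0 0" by (simp add: digits_def)
  have "block 0 0 \<noteq> []"
  proof -
    have "hd S \<in> set S" using length_S n_pos by (cases S) auto
    then show ?thesis using S_less_pow by (auto simp: block_def filter_empty_conv)
  qed
  then have "[] \<in> nodes d \<sigma> S \<longleftrightarrow> 0 < L" using node_iff[of 0 0] nil by simp
  moreover have "1 < d ^ L \<longleftrightarrow> 0 < L" using d_ge_2 one_less_power[of d L] by (cases "L = 0") auto
  moreover have "loc [] = 12 * Z" using loc_digits[of 0 0] nil by (simp add: Yl_def)
  ultimately show "root = (if [] \<in> nodes d \<sigma> S then loc [] else 0)" by (simp add: root_def)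
  fix p assume p: "p \<in> nodes d \<sigma> S"
  obtain l x where x: "l < L" "x < d ^ l" "p = digits d l x" using p by (rule node_cases)
  note lv = level_l[OF x(1)]
  interpret lv: level w n d b Z H "d ^ (L - l)" "d ^ (L - Suc l)" "d ^ l" "Yl l" "XPl l" "SPl l" root "block l"
    by (rule lv)
  have lm: "lv.level_mem M" using mem x(1) by blast
  have dig: "lv.dig = lev_dig l" by (rule lev_dig_eq[OF x(1)])
  have loc: "loc p = Yl l + 11 * Z + x * 5" using loc_digits x by simp
  have seq: "node_seq d \<sigma> S p = map lv.dig (block l x)" using node_seq_digits x dig by simp
  have rec: "M (loc p) = length (block l x)" "M (loc p + 1) = Yl l + 10 * Z + off (block l) x"
    "M (loc p + 2) = Yl l + 9 * Z + of_bool (1 < d ^ (L - Suc l)) * (x * d)"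
    using lm x(2) unfolding loc lv.level_mem_def lv.record_mem_def by blast+
  show "M (loc p) = length (node_seq d \<sigma> S p)" using rec seq by simp
  show "packed w b M (M (loc p + 1)) (node_seq d \<sigma> S p)"
    using lm x(2) unfolding rec(2) seq lv.level_mem_def by blast
  show "supports_rank_select w q (Assign 0 rank_query_expr) (Assign 0 select_query_expr) d M (loc p) (node_seq d \<sigma> S p)"
    unfolding loc seq by (rule lv.supports_rank_selectI) (use lm glob x q in \<open>simp_all add: lv.query_mem_def\<close>)
  fix j assume j: "j < d"
  have "p @ [j] = digits d (Suc l) (x * d + j)" using digits_Suc[OF d_pos, of l "x * d + j"] x(3) j by simp
  moreover have xd: "x * d + j < d ^ l * d"
  proof -
    have "Suc x * d \<le> d ^ l * d" using x(2) by (intro mult_le_mono1) simp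
    then show ?thesis using j by simp
  qed
  ultimately have pj: "p @ [j] \<in> nodes d \<sigma> S \<longleftrightarrow> Suc l < L \<and> block (Suc l) (x * d + j) \<noteq> []"
    "loc (p @ [j]) = Yl (Suc l) + 11 * Z + (x * d + j) * 5"
    using node_iff[of "x * d + j" "Suc l"] loc_digits[of "x * d + j" "Suc l"] by (simp_all add: mult.commute)
  show "M (M (loc p + 2) + j) = (if p @ [j] \<in> nodes d \<sigma> S then loc (p @ [j]) else 0)"
  proof (cases "Suc l < L")
    case True
    then have "d ^ 1 \<le> d ^ (L - Suc l)" using d_ge_2 by (intro power_increasing) auto
    then have D: "1 < d ^ (L - Suc l)" using d_ge_2 by simp
    have "M (Yl l + 9 * Z + (x * d + j)) = (if block (Suc l) (x * d + j) = [] then 0 else Yl l + 27 * Z + (x * d + j) * 5)"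
      using lm D xd unfolding lv.level_mem_def lv.children_mem_def dig split_block_block[OF x(1)] by blast
    then show ?thesis unfolding rec(3) pj using D True by (simp add: Yl_Suc add_ac)
  next
    case False
    then have "d ^ (L - Suc l) = 1" by simp
    then have "M (Yl l + 9 * Z + j) = 0" using lm j unfolding lv.level_mem_def lv.children_mem_def by blast
    then show ?thesis unfolding rec(3) pj using False by simp
  qed
qed

end

end

section \<open>The complete program\<close>

definition store :: "expr \<Rightarrow> expr \<Rightarrow> com" where
  "store a v = Pardo (Const 1) (Const 1) a v"

lemma runs_store:
  assumes "Z \<ge> 1" "T \<ge> 1" "w > 0" "eval w 0 (R, M) a = A" "eval w 0 (R, M) v = V" "cost a + cost v + 4 \<le> k"
  shows "runs w Z T (store a v) (R, M) k (R, M(A := V))"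
proof -
  obtain M' where M': "runs w Z T (store a v) (R, M) (cost (Const 1) + cost (Const 1) + cost a + cost v + 2) (R, M')"
    "\<And>i. i < 1 \<Longrightarrow> M' (eval w i (R, M) a) = eval w i (R, M) v"
    "\<And>x. (\<And>i. i < 1 \<Longrightarrow> x \<noteq> eval w i (R, M) a) \<Longrightarrow> M' x = M x"
    unfolding store_def by (rule runs_Pardo[of Z T w R M "Const 1" "Const 1" a v]) (use assms in auto)
  have "M' = M(A := V)"
    using M'(2)[of 0] M'(3) assms(4,5) by (intro ext) (metis fun_upd_apply less_one)
  then show ?thesis using runs_mono[OF M'(1), of k] assms(6) by simp
qed

lemma runs_pow_loop:
  assumes "w > 0" "rx \<noteq> ry" "\<And>u v. eval w 0 (R(rx := u, ry := v), M) bnd = t" "\<And>u v. eval w 0 (R(rx := u, ry := v), M) kE = k"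
    and "t * k < 2 ^ w" "\<And>j. j < i \<Longrightarrow> x * k ^ j < t" "t \<le> x * k ^ i" "y + i < 2 ^ w"
    and "i + 1 \<le> Z" "i + 1 \<le> T" "cost bnd + cost kE + 20 \<le> C"
    and "x * k ^ i = x'" "y + i = y'"
  shows "runs w Z T (pow_loop rx bnd kE ry) (R(rx := x, ry := y), M) C (R(rx := x', ry := y'), M)"
proof -
  obtain W D where *: "exec w (pow_loop rx bnd kE ry) (R(rx := x, ry := y), M) W D (R(rx := x', ry := y'), M)"
    "W \<le> (cost bnd + cost kE + 20) * (i + 1)" "D \<le> (cost bnd + cost kE + 20) * (i + 1)"
    using pow_loop_exec[OF assms(1-8)] assms(12,13) by blast
  moreover have "(cost bnd + cost kE + 20) * (i + 1) \<le> C * Z" "(cost bnd + cost kE + 20) * (i + 1) \<le> C * T"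
    by (intro mult_le_mono assms)+
  ultimately show ?thesis unfolding runs_def using le_trans by blast
qed

text \<open>The program depends on \<open>c\<close> alone. It finds from \<open>n\<close> the number
  \<open>h\<close> with \<open>w = c * h\<close>, and thereby the number of entries of a word, kept
  in register 13. The two stores at the end are the boundaries of the root node.\<close>

definition setup_com :: "nat \<Rightarrow> com" where
  "setup_com c =
     Assign 4 (Const 2) ;; Assign 3 (Const 1) ;; pow_loop 4 (Reg 0) (Const 2) 3 ;;
     Assign 6 (Const 1) ;; Assign 5 (Const 0) ;; pow_loop 6 (Reg 2) (Const 2) 5 ;;
     Assign 6 (Const 1) ;; Assign 15 (Const 0) ;; pow_loop 6 (Reg 0 \<oplus> Reg 2) (Const 2) 15 ;;
     Assign 7 (Const 1) ;; Assign 16 (Const 0) ;; pow_loop 7 (Reg 1) (Reg 2) 16 ;;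
     Assign 13 (Const c \<otimes> Reg 3 \<oslash> Reg 5) ;; Assign 14 (Reg 5 \<oplus> Const 1) ;;
     Assign 8 (Const 1) ;; Assign 9 (Const 0) ;; Assign 10 (Reg 0) ;; Assign 11 (Reg 6) ;;
     Assign 17 ((Const 1 \<lhd> Reg 7) \<otimes> (Const 12 \<otimes> Reg 6)) ;;
     store (Reg 0) (Const 0) ;; store (Reg 0 \<oplus> Const 1) (Reg 0)"

definition finish_com :: com where
  "finish_com = store (Const 0) (Reg 6) ;; store (Const 1) (Reg 2) ;; store (Const 2) (Reg 14) ;; Assign 0 (Reg 17)"

definition tree_com :: "nat \<Rightarrow> com" where
  "tree_com c = setup_com c ;; tree_loop ;; finish_com"

text \<open>As \<open>lg\<close> is at least 1, so is \<open>h\<close>, even for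
  \<open>n = 1\<close>. Hence minimality is claimed only for positive exponents, and the loop for
  \<open>h\<close> starts at 2 with exponent 1.\<close>

locale tree_input = tree +
  fixes c h :: nat
  assumes w_def: "w = c * h" and h_pos: "1 \<le> h" and h_ge: "n \<le> 2 ^ h" and h_least: "\<And>j. Suc j < h \<Longrightarrow> 2 ^ Suc j < n"
    and H_least: "\<And>j. j < H \<Longrightarrow> 2 ^ j < n + d"
begin

lemma Z_less: "64 * (Z * Z) < 2 ^ w" "64 * Z < 2 ^ w"
proof -
  have "64 * 1 * (Z * Z) \<le> 64 * (L + 2) * (Z * Z)" by (intro mult_le_mono) auto
  then show "64 * (Z * Z) < 2 ^ w" using space by linarith
  then show "64 * Z < 2 ^ w" using Z_sq[of 64] by linarith
qed

lemma H_less_Z: "H + 1 \<le> Z" using less_exp[of H] unfolding Z_def by linarith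

text \<open>This and the next two bounds show that each loop of the setup has at most
  \<open>H\<close> rounds, so that its cost is a constant number of units in work and in
  depth.\<close>

lemma b_le_H: "b \<le> H"
proof (rule ccontr)
  assume "\<not> b \<le> H"
  then have "(2::nat) ^ H < 2 ^ b" by (intro power_strict_increasing) auto
  then show False using nd_Z unfolding d_def Z_def by linarith
qed

lemma h_le_H: "h - 1 \<le> H"
proof (rule ccontr)
  assume "\<not> h - 1 \<le> H"
  then have "h - 1 = Suc (h - 2)" "H \<le> h - 1" "Suc (h - 2) < h" by linarith+
  then have "2 ^ (h - 1) < n" using h_least[of "h - 2"] by simp
  moreover have "(2::nat) ^ H \<le> 2 ^ (h - 1)" using \<open>H \<le> h - 1\<close> by (rule power_increasing) simp
  ultimately have "2 ^ H < n" by linarith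
  then show False using nd_Z unfolding Z_def by linarith
qed

lemma L_le_H: "L \<le> H"
proof (rule ccontr)
  assume "\<not> L \<le> H"
  then have "d ^ H < \<sigma>" by (intro pow_less_sigma) simp
  moreover have "2 ^ H \<le> d ^ H" using d_ge_2 by (rule power_mono) simp
  ultimately show False using sigma_le nd_Z unfolding Z_def by linarith
qed

lemma runs_setup:
  assumes M: "\<And>i. i < n \<Longrightarrow> M i = S ! i"
  obtains R' M' where "runs w Z (H + 1) (setup_com c) (init_regs [n, \<sigma>, d], M) 500 (R', M')"
    and "loop_regs 0 R'" and "0 < L \<Longrightarrow> lev_input 0 M'"
proof -
  have Z1: "1 \<le> Z" "1 \<le> H + 1" "n < Z" "d < Z" using Z_ge_3 nd_Z n_pos d_ge_2 by simp_all
  note zl = Z_less(2) and Hz = H_less_Z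
  have sg: "\<sigma> * d < 2 ^ w"
  proof -
    have "\<sigma> * d \<le> Z * Z" using sigma_le nd_Z by (intro mult_le_mono) auto
    then show ?thesis using Z_less(1) by linarith
  qed
  have cs: "12 < (2::nat) ^ w" "2 < (2::nat) ^ w" using zl Z_ge_3 by linarith+
  have cw: "c < 2 ^ w" "c * h < 2 ^ w"
  proof -
    have "c * 1 \<le> c * h" using h_pos by (rule mult_le_mono2)
    then show "c < 2 ^ w" "c * h < 2 ^ w" using w_less unfolding w_def by linarith+
  qed
  let ?r = "runs w Z (H + 1)"
  define R0 where "R0 = init_regs [n, \<sigma>, d]"
  have R0: "R0 0 = n" "R0 1 = \<sigma>" "R0 2 = d" by (simp_all add: R0_def init_regs_def)
  have s1: "?r (Assign 4 (Const 2)) (R0, M) 3 (R0(4 := 2), M)"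
    by (rule runs_Assign) (use Z1 cs in \<open>simp_all add: eval_Const\<close>)
  have s2: "?r (Assign 3 (Const 1)) (R0(4 := 2), M) 3 (R0(4 := 2, 3 := 1), M)"
    by (rule runs_Assign) (use Z1 w_pos in simp_all)
  have s3: "?r (pow_loop 4 (Reg 0) (Const 2) 3) (R0(4 := 2, 3 := 1), M) 30 (R0(4 := 2 ^ h, 3 := h), M)"
  proof (rule runs_pow_loop[where i = "h - 1" and t = n and k = 2])
    show "2 * 2 ^ j < n" if "j < h - 1" for j using h_least[of j] that by simp
    show "n \<le> 2 * 2 ^ (h - 1)" "2 * 2 ^ (h - 1) = (2::nat) ^ h" "1 + (h - 1) = h" using h_ge h_pos by (cases h; simp)+
    show "1 + (h - 1) < 2 ^ w" using h_le_H Hz zl by linarith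
  qed (use R0 cs w_pos Z1 zl h_le_H Hz in \<open>simp_all add: eval_Const\<close>)
  define R1 where "R1 = R0(4 := 2 ^ h, 3 := h)"
  have R1: "R1 0 = n" "R1 1 = \<sigma>" "R1 2 = d" "R1 3 = h" using R0 by (simp_all add: R1_def)
  have s4: "?r (Assign 6 (Const 1)) (R1, M) 3 (R1(6 := 1), M)"
    by (rule runs_Assign) (use Z1 w_pos in simp_all)
  have s5: "?r (Assign 5 (Const 0)) (R1(6 := 1), M) 3 (R1(6 := 1, 5 := 0), M)"
    by (rule runs_Assign) (use Z1 w_pos in simp_all)
  have s6: "?r (pow_loop 6 (Reg 2) (Const 2) 5) (R1(6 := 1, 5 := 0), M) 30 (R1(6 := d, 5 := b), M)"
  proof (rule runs_pow_loop[where i = b and t = d and k = 2])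
    show "1 * 2 ^ j < d" if "j < b" for j using that by (simp add: d_def power_strict_increasing)
    show "0 + b < 2 ^ w" using b_le_H Hz zl by linarith
  qed (use R1 cs w_pos Z1 zl b_le_H Hz in \<open>simp_all add: eval_Const d_def\<close>)
  define R2 where "R2 = R1(6 := d, 5 := b)"
  have R2: "R2 0 = n" "R2 1 = \<sigma>" "R2 2 = d" "R2 3 = h" "R2 5 = b" using R1 by (simp_all add: R2_def)
  have s7: "?r (Assign 6 (Const 1)) (R2, M) 3 (R2(6 := 1), M)"
    by (rule runs_Assign) (use Z1 w_pos in simp_all)
  have s8: "?r (Assign 15 (Const 0)) (R2(6 := 1), M) 3 (R2(6 := 1, 15 := 0), M)"
    by (rule runs_Assign) (use Z1 w_pos in simp_all)
  have nd: "n + d < 2 ^ w" "(n + d) * 2 < 2 ^ w" using nd_Z zl by simp_all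
  have s9: "?r (pow_loop 6 (Reg 0 \<oplus> Reg 2) (Const 2) 15) (R2(6 := 1, 15 := 0), M) 30 (R2(6 := Z, 15 := H), M)"
  proof (rule runs_pow_loop[where i = H and t = "n + d" and k = 2])
    show "1 * 2 ^ j < n + d" if "j < H" for j using H_least[OF that] by simp
    show "n + d \<le> 1 * 2 ^ H" using nd_Z unfolding Z_def by simp
    show "1 * 2 ^ H = Z" by (simp add: Z_def)
    show "0 + H < 2 ^ w" using Hz zl by linarith
    show "(n + d) * 2 < 2 ^ w" by (rule nd(2))
  qed (use R2 cs w_pos Hz nd(1) in \<open>simp_all add: eval_Const word_Plus\<close>)
  define R3 where "R3 = R2(6 := Z, 15 := H)"
  have R3: "R3 0 = n" "R3 1 = \<sigma>" "R3 2 = d" "R3 3 = h" "R3 5 = b" "R3 6 = Z" using R2 by (simp_all add: R3_def)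
  have s10: "?r (Assign 7 (Const 1)) (R3, M) 3 (R3(7 := 1), M)"
    by (rule runs_Assign) (use Z1 w_pos in simp_all)
  have s11: "?r (Assign 16 (Const 0)) (R3(7 := 1), M) 3 (R3(7 := 1, 16 := 0), M)"
    by (rule runs_Assign) (use Z1 w_pos in simp_all)
  have s12: "?r (pow_loop 7 (Reg 1) (Reg 2) 16) (R3(7 := 1, 16 := 0), M) 30 (R3(7 := d ^ L, 16 := L), M)"
  proof (rule runs_pow_loop[where i = L and t = \<sigma> and k = d])
    show "1 * d ^ j < \<sigma>" if "j < L" for j using pow_less_sigma[OF that] by simp
    show "\<sigma> \<le> 1 * d ^ L" using sigma_pow by simp
    show "0 + L < 2 ^ w" using L_le_H Hz zl by linarith
    show "\<sigma> * d < 2 ^ w" by (rule sg)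
  qed (use R3 w_pos Hz L_le_H in simp_all)
  define R4 where "R4 = R3(7 := d ^ L, 16 := L)"
  have R4: "R4 0 = n" "R4 2 = d" "R4 3 = h" "R4 5 = b" "R4 6 = Z" "R4 7 = d ^ L" using R3 by (simp_all add: R4_def)
  have s13: "?r (Assign 13 (Const c \<otimes> Reg 3 \<oslash> Reg 5)) (R4, M) 6 (R4(13 := w div b), M)"
    by (rule runs_Assign) (use Z1 R4 cw in \<open>simp_all add: eval_Const word_Times w_def\<close>)
  let ?R = "R4(13 := w div b)"
  have "b + 1 < 2 ^ w" using b_le_H Hz zl by linarith
  then have s14: "?r (Assign 14 (Reg 5 \<oplus> Const 1)) (?R, M) 4 (?R(14 := b + 1), M)"
    by (intro runs_Assign) (use Z1 R4 w_pos in \<open>simp_all add: word_Plus\<close>)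
  let ?R = "?R(14 := b + 1)"
  have s15: "?r (Assign 8 (Const 1)) (?R, M) 3 (?R(8 := 1), M)"
    by (rule runs_Assign) (use Z1 w_pos in simp_all)
  let ?R = "?R(8 := 1)"
  have s16: "?r (Assign 9 (Const 0)) (?R, M) 3 (?R(9 := 0), M)"
    by (rule runs_Assign) (use Z1 w_pos in simp_all)
  let ?R = "?R(9 := 0)"
  have s17: "?r (Assign 10 (Reg 0)) (?R, M) 3 (?R(10 := n), M)"
    by (rule runs_Assign) (use Z1 R4 in simp_all)
  let ?R = "?R(10 := n)"
  have s18: "?r (Assign 11 (Reg 6)) (?R, M) 3 (?R(11 := Z), M)"
    by (rule runs_Assign) (use Z1 R4 in simp_all)
  let ?R = "?R(11 := Z)"
  have s19: "?r (Assign 17 ((Const 1 \<lhd> Reg 7) \<otimes> (Const 12 \<otimes> Reg 6))) (?R, M) 10 (?R(17 := root), M)"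
  proof (rule runs_Assign)
    have "12 * Z < 2 ^ w" using zl by linarith
    then show "eval w 0 (?R, M) ((Const 1 \<lhd> Reg 7) \<otimes> (Const 12 \<otimes> Reg 6)) = root"
      using R4 w_pos cs by (simp add: word_LessThan word_Times eval_Const root_def)
  qed (use Z1 in simp_all)
  let ?R = "?R(17 := root)"
  have s20: "?r (store (Reg 0) (Const 0)) (?R, M) 10 (?R, M(n := 0))"
    by (rule runs_store) (use Z1 w_pos R4 in simp_all)
  have "n + 1 < 2 ^ w" using Z1 zl by linarith
  then have s21: "?r (store (Reg 0 \<oplus> Const 1) (Reg 0)) (?R, M(n := 0)) 10 (?R, M(n := 0, n + 1 := n))"
    by (intro runs_store) (use Z1 w_pos R4 in \<open>simp_all add: word_Plus\<close>)
  have "?r (setup_com c) (R0, M) 500 (?R, M(n := 0, n + 1 := n))"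
    unfolding setup_com_def
    by (rule runs_mono[OF runs_Seq[OF s1 runs_Seq[OF s2 runs_Seq[OF s3[folded R1_def] runs_Seq[OF s4 runs_Seq[OF s5
      runs_Seq[OF s6[folded R2_def] runs_Seq[OF s7 runs_Seq[OF s8 runs_Seq[OF s9[folded R3_def] runs_Seq[OF s10
      runs_Seq[OF s11 runs_Seq[OF s12[folded R4_def] runs_Seq[OF s13 runs_Seq[OF s14 runs_Seq[OF s15 runs_Seq[OF s16
      runs_Seq[OF s17 runs_Seq[OF s18 runs_Seq[OF s19 runs_Seq[OF s20 s21]]]]]]]]]]]]]]]]]]]]]) simp
  moreover have "loop_regs 0 ?R"
    unfolding loop_regs_def using R4 by (simp add: XPl_def SPl_def Yl_def)
  moreover have "lev_input 0 (M(n := 0, n + 1 := n))" if "0 < L"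
  proof -
    note lv = level_l[OF that]
    have "block 0 0 = S" using S_less_pow by (simp add: block_def filter_id_conv)
    moreover have "off (block 0) 1 = n" using off_block[of 0] by simp
    ultimately show ?thesis
      unfolding level.input_def[OF lv] level.xs_def[OF lv] using M by (auto simp: XPl_def SPl_def flat_def less_Suc_eq_le le_Suc_eq)
  qed
  ultimately show thesis using that unfolding R0_def by blast
qed

lemma runs_finish:
  assumes "loop_regs L R"
  obtains R' where "runs w Z (H + 1) finish_com (R, M) 40 (R', M(0 := Z, 1 := d, 2 := b + 1))" and "R' 0 = root"
proof -
  have Z1: "1 \<le> Z" "1 \<le> H + 1" using Z_ge_3 by simp_all
  have R: "R 6 = Z" "R 2 = d" "R 14 = b + 1" "R 17 = root" using assms by (simp_all add: loop_regs_def)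
  have "2 < (2::nat) ^ w" using Z_less(2) Z_ge_3 by linarith
  then have s3: "runs w Z (H + 1) (store (Const 2) (Reg 14)) (R, M(0 := Z, 1 := d)) 10 (R, M(0 := Z, 1 := d, 2 := b + 1))"
    by (intro runs_store) (use Z1 w_pos R in \<open>simp_all add: eval_Const\<close>)
  have s1: "runs w Z (H + 1) (store (Const 0) (Reg 6)) (R, M) 10 (R, M(0 := Z))"
    by (rule runs_store) (use Z1 w_pos R in simp_all)
  have s2: "runs w Z (H + 1) (store (Const 1) (Reg 2)) (R, M(0 := Z)) 10 (R, M(0 := Z, 1 := d))"
    by (rule runs_store) (use Z1 w_pos R in simp_all)
  have s4: "runs w Z (H + 1) (Assign 0 (Reg 17)) (R, M(0 := Z, 1 := d, 2 := b + 1)) 3 (R(0 := root), M(0 := Z, 1 := d, 2 := b + 1))"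
    by (rule runs_Assign) (use Z1 R in simp_all)
  have "runs w Z (H + 1) finish_com (R, M) 40 (R(0 := root), M(0 := Z, 1 := d, 2 := b + 1))"
    unfolding finish_com_def by (rule runs_mono[OF runs_Seq[OF s1 runs_Seq[OF s2 runs_Seq[OF s3 s4]]]]) simp
  then show thesis by (rule that) simp
qed

text \<open>The three overwritten cells lie in the input area, as \<open>Z\<close> is at least
  3.\<close>

lemma lev_mem_finish:
  assumes "l < L" "lev_mem l M"
  shows "lev_mem l (M(0 := Z, 1 := d, 2 := b + 1))"
proof (rule level.level_mem_cong[OF level_l[OF assms(1)] assms(2)])
  fix x assume "Yl l \<le> x"
  then have "3 \<le> x" using Z_ge_3 unfolding Yl_def by linarith
  then show "(M(0 := Z, 1 := d, 2 := b + 1)) x = M x" by simp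
qed

lemma tree_com_exec:
  assumes M: "\<And>i. i < n \<Longrightarrow> M i = S ! i" and nl: "num_levels d \<sigma> = L"
    and q: "cost rank_query_expr + 1 \<le> q" "cost select_query_expr + 1 \<le> q"
  obtains W D R' M' where "exec w (tree_com c) (init_regs [n, \<sigma>, d], M) W D (R', M')"
    and "W \<le> 7000 * Z * (L + 1)" and "D \<le> 7000 * (H + 1) * (L + 1)"
    and "represents_wavelet_tree w q (Assign 0 rank_query_expr) (Assign 0 select_query_expr) b d \<sigma> S M' (R' 0)"
proof -
  obtain R1 M1 where 1: "runs w Z (H + 1) (setup_com c) (init_regs [n, \<sigma>, d], M) 500 (R1, M1)"
    and R1: "loop_regs 0 R1" and M1: "0 < L \<Longrightarrow> lev_input 0 M1"
    using runs_setup[OF M] by blast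
  obtain W2 D2 R2 M2 where 2: "exec w tree_loop (R1, M1) W2 D2 (R2, M2)" "W2 \<le> 6200 * Z * (L - 0 + 1)"
    "D2 \<le> 6200 * (H + 1) * (L - 0 + 1)" "loop_regs L R2" "\<forall>k<L. lev_mem k M2"
    using tree_loop_exec[OF _ R1 M1] by auto
  let ?M3 = "M2(0 := Z, 1 := d, 2 := b + 1)"
  obtain R3 where 3: "runs w Z (H + 1) finish_com (R2, M2) 40 (R3, ?M3)" and R3: "R3 0 = root"
    by (rule runs_finish[OF 2(4)])
  obtain W1 D1 where e1: "exec w (setup_com c) (init_regs [n, \<sigma>, d], M) W1 D1 (R1, M1)" "W1 \<le> 500 * Z" "D1 \<le> 500 * (H + 1)"
    using 1 unfolding runs_def by blast
  obtain W3 D3 where e3: "exec w finish_com (R2, M2) W3 D3 (R3, ?M3)" "W3 \<le> 40 * Z" "D3 \<le> 40 * (H + 1)"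
    using 3 unfolding runs_def by blast
  have bound: "u + (v + t) \<le> 7000 * X * (L + 1)"
    if "u \<le> 500 * X" "v \<le> 6200 * X * (L - 0 + 1)" "t \<le> 40 * X" for u v t X
  proof -
    have "u + (v + t) \<le> 540 * X * 1 + 6200 * X * (L + 1)" using that by simp
    also have "\<dots> \<le> 540 * X * (L + 1) + 6200 * X * (L + 1)" by (intro add_right_mono mult_le_mono2) simp
    finally show ?thesis by (simp add: algebra_simps)
  qed
  have "represents_wavelet_tree w q (Assign 0 rank_query_expr) (Assign 0 select_query_expr) b d \<sigma> S ?M3 root"
    by (rule represents[OF nl]) (use 2(5) lev_mem_finish q in auto)
  then show thesis
    using that[OF exec.Seq[OF e1(1) exec.Seq[OF 2(1) e3(1)], folded tree_com_def]]
      bound[OF e1(2) 2(2) e3(2)] bound[OF e1(3) 2(3) e3(3)] R3 by simp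
qed

end


section \<open>Choice of the constants\<close>

lemma ceiling_lg:
  assumes "n \<ge> 1" "h = nat \<lceil>lg 2 n\<rceil>"
  shows "1 \<le> h" "n \<le> 2 ^ h" "\<And>j. Suc j < h \<Longrightarrow> 2 ^ Suc j < n" "real h \<le> 2 * lg 2 n" "lg 2 n \<le> real h"
proof -
  have lg1: "1 \<le> lg 2 n" by (simp add: lg_def)
  have hr: "real h = real_of_int \<lceil>lg 2 n\<rceil>" using assms(2) lg1 by simp
  show h_lg: "lg 2 n \<le> real h" unfolding hr by (rule le_of_int_ceiling)
  have hlt: "real h < lg 2 n + 1" unfolding hr by linarith
  then show "real h \<le> 2 * lg 2 n" using lg1 by linarith
  show "1 \<le> h" using h_lg lg1 by linarith
  have "log 2 n \<le> real h" using h_lg by (simp add: lg_def)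
  then have "real n \<le> 2 powr real h" using assms(1) by (simp add: log_le_iff)
  then have "real n \<le> real (2 ^ h)" by (simp add: powr_realpow)
  then show "n \<le> 2 ^ h" by (simp only: of_nat_le_iff)
  show "2 ^ Suc j < n" if "Suc j < h" for j
  proof -
    have "real (Suc j) < lg 2 n" using that hlt by linarith
    then have "real (Suc j) < log 2 n" by (simp add: lg_def)
    then have "2 powr real (Suc j) < real n" using assms(1) by (simp add: less_log_iff)
    then have "real (2 ^ Suc j) < real n" by (simp add: powr_realpow del: of_nat_Suc)
    then show ?thesis by (simp only: of_nat_less_iff)
  qed
qed

text \<open>The factor 3 arises from \<open>L < log d \<sigma> + 1\<close>: so \<open>L + 1\<close>
  is less than the logarithm plus 2, and \<open>lg d \<sigma>\<close> is at least 1.\<close>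

lemma num_levels_eq:
  assumes "d \<ge> 2" "\<sigma> \<ge> 1" "\<sigma> \<le> d ^ L" "\<And>j. j < L \<Longrightarrow> d ^ j < \<sigma>"
  shows "num_levels d \<sigma> = L" "real (L + 1) \<le> 3 * lg d \<sigma>"
proof -
  show L: "num_levels d \<sigma> = L"
  proof (cases L)
    case 0
    then show ?thesis using assms(2,3) by (simp add: num_levels_def)
  next
    case (Suc k)
    then show ?thesis
      using ceiling_log_nat_eq_if[of d k \<sigma>] assms(1,3,4) by (simp add: num_levels_def)
  qed
  have "log d \<sigma> \<ge> 0" using assms(1,2) by simp
  then have "real L < log d \<sigma> + 1" unfolding L[symmetric] num_levels_def by linarith
  then show "real (L + 1) \<le> 3 * lg d \<sigma>" unfolding lg_def by simp
qed

text \<open>Squaring leads to the exponent \<open>2 * \<epsilon> < 1\<close>, so the power of the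
  logarithm is at most the logarithm itself. The square is what counts, because \<open>d\<close>
  fields of \<open>b + 1 \<le> d\<close> bits must fit in a word.\<close>

lemma degree_bound:
  assumes "0 < \<epsilon>" "\<epsilon> < 1 / 3" "real d \<le> C * lg 2 n powr \<epsilon>" "lg 2 n \<le> real h"
  shows "d * d \<le> nat \<lceil>C * C\<rceil> * h"
proof -
  have lg1: "1 \<le> lg 2 n" by (simp add: lg_def)
  have "real d * real d \<le> (C * lg 2 n powr \<epsilon>) * (C * lg 2 n powr \<epsilon>)"
    using assms(3) by (intro mult_mono) auto
  also have "\<dots> = C * C * lg 2 n powr (\<epsilon> + \<epsilon>)" by (simp only: powr_add mult_ac)
  also have "\<dots> \<le> C * C * lg 2 n powr 1"
    using assms(1,2) lg1 by (intro mult_left_mono powr_mono) auto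
  also have "\<dots> = C * C * lg 2 n" using lg1 by simp
  also have "\<dots> \<le> real (nat \<lceil>C * C\<rceil>) * real h"
    using lg1 by (intro mult_mono[OF real_nat_ceiling_ge assms(4)] of_nat_0_le_iff) linarith
  finally have "real (d * d) \<le> real (nat \<lceil>C * C\<rceil> * h)" by simp
  then show ?thesis by (simp only: of_nat_le_iff)
qed

text \<open>The first three conclusions are the conditions of the locales for the word size
  \<open>c * h\<close>. The last two, \<open>Z = O(n)\<close> and \<open>H = O(h)\<close>, convert
  units of cost into the bounds of the theorem.\<close>

lemma constants:
  fixes n d h c \<sigma> b C' H L :: nat
  assumes d: "d * d \<le> C' * h" "d = 2 ^ b" "2 \<le> d" and n: "1 \<le> n" "\<sigma> \<le> n" "1 \<le> \<sigma>"
    and h: "1 \<le> h" "n \<le> 2 ^ h" "\<forall>j. Suc j < h \<longrightarrow> 2 ^ Suc j < n" and c: "14 + 3 * C' \<le> c"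
    and H: "n + d \<le> 2 ^ H" "\<forall>j<H. 2 ^ j < n + d"
    and L: "\<forall>j<L. d ^ j < \<sigma>"
  shows "1 \<le> b" "d * (b + 1) < c * h" "64 * (L + 2) * (2 ^ H * 2 ^ H) < 2 ^ (c * h)"
    "2 ^ H \<le> 2 * (1 + C') * n" "H \<le> 1 + C' + h"
proof -
  show "1 \<le> b" using d(2,3) by (cases b) auto
  have "b + 1 \<le> d" using less_exp[of b] d(2) by linarith
  then have "d * (b + 1) \<le> d * d" by (rule mult_le_mono2)
  also have "\<dots> \<le> C' * h" by (rule d(1))
  also have "\<dots> < c * h" using c h(1) by simp
  finally show "d * (b + 1) < c * h" .
  have "d \<le> d * d" using d(3) by simp
  then have dh: "d \<le> C' * h" using d(1) by linarith
  \<comment> \<open>The degree is bounded by a multiple of \<open>h\<close>; with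
    \<open>h \<le> n\<close> this makes \<open>Z\<close> linear in \<open>n\<close>.\<close>
  have hn: "h \<le> n"
  proof (cases "h = 1")
    case False
    then have "2 ^ Suc (h - 2) < n" using h(1) by (intro h(3)[rule_format]) linarith
    moreover have "Suc (h - 2) < 2 ^ Suc (h - 2)" by (rule less_exp)
    ultimately show ?thesis using h(1) by linarith
  qed (use n in simp)
  have Z2: "2 ^ H \<le> 2 * (n + d)"
  proof (cases H)
    case (Suc k)
    then have "2 ^ k < n + d" using H(2) by blast
    then show ?thesis using Suc by simp
  qed (use n in simp)
  have "C' * h \<le> C' * n" using hn by (rule mult_le_mono2)
  with dh have "d \<le> C' * n" by (rule order_trans)
  then have "2 * (n + d) \<le> 2 * (n + C' * n)" by simp
  then have "2 ^ H \<le> 2 * (n + C' * n)" by (rule order_trans[OF Z2])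
  then show "2 ^ H \<le> 2 * (1 + C') * n" by (simp add: algebra_simps)
  have "h \<le> 2 ^ h" using less_exp[of h] by simp
  then have "C' * h \<le> C' * 2 ^ h" by (rule mult_le_mono2)
  with dh have "d \<le> C' * 2 ^ h" by (rule order_trans)
  with h(2) have "n + d \<le> 2 ^ h + C' * 2 ^ h" by (rule add_mono)
  then have "2 * (n + d) \<le> 2 * (2 ^ h + C' * 2 ^ h)" by (rule mult_le_mono2)
  then have "2 ^ H \<le> 2 * (2 ^ h + C' * 2 ^ h)" by (rule order_trans[OF Z2])
  then have "2 ^ H \<le> 2 * ((1 + C') * 2 ^ h)" by (simp add: algebra_simps)
  also have "\<dots> \<le> 2 * (2 ^ C' * 2 ^ h)"
  proof -
    have "1 + C' \<le> 2 ^ C'" using less_exp[of C'] by linarith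
    then show ?thesis by (intro mult_le_mono) auto
  qed
  also have "\<dots> = 2 ^ (1 + C' + h)" by (simp add: power_add)
  finally have Zh: "2 ^ H \<le> (2::nat) ^ (1 + C' + h)" .
  then show Hh: "H \<le> 1 + C' + h" by (rule power_le_imp_le_exp[rotated]) simp
  have LH: "L \<le> H"
  proof (rule ccontr)
    assume "\<not> L \<le> H"
    then have "d ^ H < \<sigma>" by (intro L[rule_format]) simp
    moreover have "2 ^ H \<le> d ^ H" using d(3) by (rule power_mono) simp
    ultimately show False using n(2) H(1) by linarith
  qed
  have "3 \<le> (2::nat) ^ H" using H(1) n(1) d(3) by linarith
  moreover have "H < 2 ^ H" by (rule less_exp)
  ultimately have L2: "L + 2 \<le> 2 * 2 ^ H" using LH by linarith
  have "64 * (L + 2) * (2 ^ H * 2 ^ H) \<le> 64 * (2 * 2 ^ H) * (2 ^ H * 2 ^ H)"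
    using L2 by (intro mult_le_mono1 mult_le_mono2)
  also have "\<dots> = 2 ^ (7 + 3 * H)" by (simp add: power_add power_mult power3_eq_cube power_mult_distrib mult.commute[of 3])
  also have "\<dots> < 2 ^ (c * h)"
  proof (rule power_strict_increasing)
    \<comment> \<open>The origin of \<open>14 + 3 * C'\<close>: the exponent
      \<open>7 + 3 * H\<close> is at most \<open>10 + 3 * C' + 3 * h\<close> because
      \<open>H \<le> 1 + C' + h\<close>, and \<open>h \<ge> 1\<close> lets a multiple of
      \<open>h\<close> absorb the constant part.\<close>
    have "(11 + 3 * C') * 1 \<le> (11 + 3 * C') * h" using h(1) by (rule mult_le_mono2)
    then have "11 + 3 * C' + 3 * h \<le> (14 + 3 * C') * h" by (simp add: algebra_simps)
    also have "\<dots> \<le> c * h" using c by (rule mult_le_mono1)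
    finally show "7 + 3 * H < c * h" using Hh by linarith
  qed simp
  finally show "64 * (L + 2) * (2 ^ H * 2 ^ H) < 2 ^ (c * h)" .
qed

theorem mainTheorem7:
  fixes \<epsilon> C :: real
  assumes "0 < \<epsilon>" and "\<epsilon> < 1 / 3"
  shows "\<exists>c\<^sub>0. \<forall>c\<ge>c\<^sub>0. \<exists>P Qr Qs q. \<exists>K::real.
    \<forall>n \<sigma> d b S M.
      n \<ge> 1 \<and> length S = n \<and> set S \<subseteq> {..<\<sigma>} \<and> \<sigma> \<le> n \<and>
      d \<ge> 2 \<and> d = 2 ^ b \<and> real d \<le> C * lg 2 n powr \<epsilon> \<and>
      (\<forall>a. M a < 2 ^ word_size c n) \<and> (\<forall>i<n. M i = S ! i) \<longrightarrow>
      (\<exists>W D R' M'.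
        exec (word_size c n) P (init_regs [n, \<sigma>, d], M) W D (R', M') \<and>
        real W \<le> K * (real n * lg d \<sigma>) \<and>
        real D \<le> K * (lg 2 n * lg d \<sigma>) \<and>
        represents_wavelet_tree (word_size c n) q Qr Qs b d \<sigma> S M' (R' 0))"
proof -
  define C' where "C' = nat \<lceil>C * C\<rceil>"
  define q where "q = max (cost rank_query_expr + 1) (cost select_query_expr + 1)"
  \<comment> \<open>The program contributes 7000 and the number of levels 3. The array size adds the
    factor \<open>2 * (1 + C')\<close> to the work, and the tree height adds \<open>4 + C'\<close>
    to the depth; \<open>K\<close> dominates both products.\<close>
  define K :: real where "K = 42000 * (4 + real C')"
  have main: "\<exists>W D R' M'.
        exec (word_size c n) (tree_com c) (init_regs [n, \<sigma>, d], M) W D (R', M') \<and>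
        real W \<le> K * (real n * lg d \<sigma>) \<and>
        real D \<le> K * (lg 2 n * lg d \<sigma>) \<and>
        represents_wavelet_tree (word_size c n) q (Assign 0 rank_query_expr) (Assign 0 select_query_expr) b d \<sigma> S M' (R' 0)"
    if c: "14 + 3 * C' \<le> c" and n: "n \<ge> 1" "length S = n" and S: "set S \<subseteq> {..<\<sigma>}" "\<sigma> \<le> n"
      and d: "d \<ge> 2" "d = 2 ^ b" "real d \<le> C * lg 2 n powr \<epsilon>" and M: "\<forall>i<n. M i = S ! i"
    for c n \<sigma> d b S and M :: mem
  proof -
    define h where "h = nat \<lceil>lg 2 n\<rceil>"
    note hs = ceiling_lg[OF n(1) h_def]
    have w: "word_size c n = c * h" by (simp add: word_size_def h_def)
    have dd: "d * d \<le> C' * h"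
      unfolding C'_def by (rule degree_bound[OF assms d(3) hs(5)])
    have s1: "1 \<le> \<sigma>" using S n by (cases S) auto
    \<comment> \<open>The least exponents are taken because the loops of the setup stop
      there.\<close>
    obtain H where H: "n + d \<le> 1 * 2 ^ H" "\<And>j. j < H \<Longrightarrow> 1 * 2 ^ j < n + d"
      by (rule least_power[of 2 1 "n + d"]) auto
    obtain L where L: "\<sigma> \<le> 1 * d ^ L" "\<And>j. j < L \<Longrightarrow> 1 * d ^ j < \<sigma>"
      by (rule least_power[of d 1 \<sigma>]) (use d in auto)
    note H = H[unfolded mult_1] and L = L[unfolded mult_1]
    have "\<forall>j. Suc j < h \<longrightarrow> 2 ^ Suc j < n" "\<forall>j<H. 2 ^ j < n + d" "\<forall>j<L. d ^ j < \<sigma>"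
      using hs(3) H(2) L(2) by blast+
    note k = constants[OF dd d(2,1) n(1) S(2) s1 hs(1,2) this(1) c H(1) this(2,3)]
    note nl = num_levels_eq[OF d(1) s1 L]
    interpret tree_input "c * h" n d b "2 ^ H" H S \<sigma> L c h
      by unfold_locales (use k n S d H L hs c in auto)
    obtain W D R' M' where ex: "exec (c * h) (tree_com c) (init_regs [n, \<sigma>, d], M) W D (R', M')"
      and W: "W \<le> 7000 * 2 ^ H * (L + 1)" and D: "D \<le> 7000 * (H + 1) * (L + 1)"
      and rep: "represents_wavelet_tree (c * h) q (Assign 0 rank_query_expr) (Assign 0 select_query_expr) b d \<sigma> S M' (R' 0)"
      by (rule tree_com_exec[of M q]) (use M nl in \<open>simp_all add: q_def\<close>)
    have lg1: "1 \<le> lg 2 n" "1 \<le> lg d \<sigma>" by (simp_all add: lg_def)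
    have "real W \<le> 7000 * real (2 ^ H) * real (L + 1)"
      using of_nat_mono[OF W, where ?'a = real] by (simp only: of_nat_mult of_nat_numeral)
    also have "\<dots> \<le> 7000 * (2 * (1 + real C') * real n) * (3 * lg d \<sigma>)"
    proof -
      have "real (2 ^ H) \<le> 2 * (1 + real C') * real n"
        using of_nat_mono[OF k(4), where ?'a = real] by (simp only: of_nat_mult of_nat_add of_nat_numeral of_nat_1)
      then show ?thesis using nl(2) by (intro mult_mono) auto
    qed
    also have "\<dots> = (42000 * (1 + real C')) * (real n * lg d \<sigma>)" by simp
    also have "\<dots> \<le> K * (real n * lg d \<sigma>)"
      unfolding K_def using lg1 by (intro mult_right_mono) auto
    finally have Wr: "real W \<le> K * (real n * lg d \<sigma>)" .
    have "real D \<le> 7000 * real (H + 1) * real (L + 1)"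
      using of_nat_mono[OF D, where ?'a = real] by (simp only: of_nat_mult of_nat_numeral)
    also have "\<dots> \<le> 7000 * ((4 + real C') * lg 2 n) * (3 * lg d \<sigma>)"
    proof -
      have "real (H + 1) \<le> 2 + real C' + real h"
        using of_nat_mono[OF k(5), where ?'a = real] by simp
      also have "\<dots> \<le> (2 + real C') * lg 2 n + 2 * lg 2 n"
      proof -
        have "(2 + real C') * 1 \<le> (2 + real C') * lg 2 n" using lg1 by (intro mult_left_mono) auto
        from add_mono[OF this hs(4)] show ?thesis by (simp only: mult_1_right)
      qed
      finally have "real (H + 1) \<le> (4 + real C') * lg 2 n" by (simp add: algebra_simps)
      then show ?thesis using nl(2) lg1 by (intro mult_mono) auto
    qed
    also have "\<dots> = (21000 * (4 + real C')) * (lg 2 n * lg d \<sigma>)" by simp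
    also have "\<dots> \<le> K * (lg 2 n * lg d \<sigma>)"
      unfolding K_def using lg1 by (intro mult_right_mono) auto
    finally have "real D \<le> K * (lg 2 n * lg d \<sigma>)" .
    then show ?thesis unfolding w using ex Wr rep by blast
  qed
  \<comment> \<open>Only the construction program varies with \<open>c\<close>; the query programs,
    \<open>q\<close> and \<open>K\<close> are the same for all \<open>c\<close>.\<close>
  show ?thesis
    by (rule exI[of _ "14 + 3 * C'"], intro allI impI, rule exI, rule exI, rule exI, rule exI[of _ q], rule exI[of _ K],
      intro allI impI) (rule main; blast)
qed

end
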